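(* Let $\ell\geq 2$ and $t=1+\lfloor \frac{\ell-1}{2}\rfloor$. Then for all sufficiently large $n$: if $\ell$ is odd, $H(n,2,t+1)$ is the unique extremal graph for $C_{3,\ell}^{3}$; if $\ell$ is even, $H(n,2,t+2)$ is the unique extremal graph for $C_{3,\ell}^{3}$ (extremal meaning: $n$-vertex, $C_{3,\ell}^3$-free, with the maximum number of edges).
   Context: All graphs are finite, simple and undirected. For a graph $H$ and integer $p\geq 2$, the edge blow-up $H^{p+1}$ is obtained from $H$ by replacing each edge by a clique of order $p+1$, where the new vertices of the different cliques are all distinct. The lollipop $C_{k,\ell}$ is obtained from a cycle $C_k$ by identifying one endpoint of a path $P_{\ell+1}$ (on $\ell+1$ vertices) with a vertex of the cycle. $T_p(n)$ is the $p$-partite Turán graph on $n$ vertices and $H(n,p,q)=K_{q-1}\vee T_p(n-q+1)$ ($\vee$ = join). *)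

theory Defs
  imports Main "HOL-Library.Ramsey"
begin

text \<open>A graph is a pair of a vertex set and a set of two-element subsets of it;
  \<open>nsets V 2\<close> is the set of all two-element subsets of \<open>V\<close>.\<close>

type_synonym 'a ugraph = "'a set \<times> 'a set set"

abbreviation verts :: "'a ugraph \<Rightarrow> 'a set" where
  "verts G \<equiv> fst G"

abbreviation edges :: "'a ugraph \<Rightarrow> 'a set set" where
  "edges G \<equiv> snd G"

definition simple_graph :: "'a ugraph \<Rightarrow> bool" where
  "simple_graph G \<longleftrightarrow> finite (verts G) \<and> edges G \<subseteq> nsets (verts G) 2"

definition graph_iso :: "'a ugraph \<Rightarrow> 'b ugraph \<Rightarrow> bool" where
  "graph_iso G H \<longleftrightarrow>
     (\<exists>f. bij_betw f (verts G) (verts H) \<and> (\<lambda>e. f ` e) ` edges G = edges H)"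

text \<open>Containment as a not necessarily induced subgraph.\<close>

definition contains_copy :: "'a ugraph \<Rightarrow> 'b ugraph \<Rightarrow> bool" where
  "contains_copy G F \<longleftrightarrow>
     (\<exists>f. inj_on f (verts F) \<and> f ` verts F \<subseteq> verts G \<and> (\<forall>e\<in>edges F. f ` e \<in> edges G))"

definition complete_graph :: "nat \<Rightarrow> nat ugraph" where
  "complete_graph m = ({..<m}, nsets {..<m} 2)"

text \<open>The residue classes modulo \<open>p\<close> split \<open>{..<n}\<close> into \<open>p\<close> classes whose sizes
  differ by at most one.\<close>

definition turan_graph :: "nat \<Rightarrow> nat \<Rightarrow> nat ugraph" where
  "turan_graph p n = ({..<n}, {{i, j} | i j. i < n \<and> j < n \<and> i mod p \<noteq> j mod p})"

definition graph_join :: "'a ugraph \<Rightarrow> 'b ugraph \<Rightarrow> ('a + 'b) ugraph" where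
  "graph_join G H =
     (Inl ` verts G \<union> Inr ` verts H,
      (\<lambda>e. Inl ` e) ` edges G \<union> (\<lambda>e. Inr ` e) ` edges H
        \<union> {{Inl u, Inr v} | u v. u \<in> verts G \<and> v \<in> verts H})"

text \<open>\<open>H(n, p, q)\<close>. For \<open>n \<ge> q\<close> the truncated difference \<open>n + 1 - q\<close> is the intended
  \<open>n - q + 1\<close>.\<close>

definition H_graph :: "nat \<Rightarrow> nat \<Rightarrow> nat \<Rightarrow> (nat + nat) ugraph" where
  "H_graph n p q = graph_join (complete_graph (q - 1)) (turan_graph p (n + 1 - q))"

text \<open>The cycle is \<open>0, \<dots>, k - 1\<close> and the path, with \<open>l + 1\<close> vertices, is
  \<open>k - 1, \<dots>, k - 1 + l\<close>; they share the vertex \<open>k - 1\<close>.\<close>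

definition lollipop :: "nat \<Rightarrow> nat \<Rightarrow> nat ugraph" where
  "lollipop k l =
     ({..<k + l},
      {{i, (i + 1) mod k} | i. i < k} \<union> {{i, i + 1} | i. k - 1 \<le> i \<and> i < k - 1 + l})"

text \<open>\<open>edge_blowup H r\<close> replaces every edge by a clique of order \<open>r\<close>; the paper's
  \<open>H\<^sup>p\<^sup>+\<^sup>1\<close> is the case \<open>r = p + 1\<close>. The \<open>r - 2\<close> new vertices of the clique on the edge \<open>e\<close>
  are the \<open>Inr (e, i)\<close>.\<close>

definition blowup_clique :: "nat \<Rightarrow> 'a set \<Rightarrow> ('a + 'a set \<times> nat) set" where
  "blowup_clique r e = Inl ` e \<union> {Inr (e, i) | i. i < r - 2}"

definition edge_blowup :: "'a ugraph \<Rightarrow> nat \<Rightarrow> ('a + 'a set \<times> nat) ugraph" where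
  "edge_blowup H r =
     (Inl ` verts H \<union> (\<Union>e\<in>edges H. blowup_clique r e),
      \<Union>e\<in>edges H. nsets (blowup_clique r e) 2)"

text \<open>Competitors have natural numbers as vertices, which is no restriction: every finite
  graph is isomorphic to such a graph.\<close>

definition extremal_graph :: "nat \<Rightarrow> 'b ugraph \<Rightarrow> 'a ugraph \<Rightarrow> bool" where
  "extremal_graph n F G \<longleftrightarrow>
     simple_graph G \<and> card (verts G) = n \<and> \<not> contains_copy G F \<and>
     (\<forall>G' :: nat ugraph. simple_graph G' \<and> card (verts G') = n \<and> \<not> contains_copy G' F
        \<longrightarrow> card (edges G') \<le> card (edges G))"

definition unique_extremal_graph :: "nat \<Rightarrow> 'b ugraph \<Rightarrow> 'a ugraph \<Rightarrow> bool" where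
  "unique_extremal_graph n F H \<longleftrightarrow>
     extremal_graph n F H \<and> (\<forall>G :: nat ugraph. extremal_graph n F G \<longrightarrow> graph_iso G H)"

end

theory Submission imports Defs begin

text \<open>
  Put \<open>s = 1 + l div 2\<close>; for both parities of \<open>l\<close> the claimed extremal graph is the join of \<open>K\<^sub>s\<close> and a
  balanced complete bipartite graph. It contains no copy of the blow-up \<open>F\<close> because the core (a triangle with a
  private triangle on each edge) needs two apexes and the rest of the path carries \<open>l div 2\<close> disjoint triangles.

  Deleting a vertex, an edge or a suitable four-set that meets too few edges increases the surplus of edges over the
  extremal number, so one may assume that vertices, edges and such four-sets meet as many edges as they do in
  the extremal graph; in particular every edge lies in at least \<open>s \<ge> 2\<close> triangles. A graph in which
  every edge lies in many triangles contains \<open>F\<close>, hence an \<open>F\<close>-free graph has \<open>O(n\<^sup>2)\<close> triangles and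
  some edge \<open>ab\<close> has few common neighbours while \<open>N(a)\<close> and \<open>N(b)\<close> span only \<open>O(n)\<close> edges. These
  neighbourhoods are the sides of a near-bipartition. If one side had many paths on three
  vertices (``cherries''), chains of triangles could zigzag through their centres, and the four-set condition
  would provide a core; so, up to boundedly many vertices \<open>W\<close>, the edges inside the sides form matchings.

  Sorting the vertices of the sides by their neighbourhood in \<open>W\<close>, the four-set
  condition excludes frequent matching edges, and all frequent types share the same \<open>s\<close> apexes. One more vertex
  with many neighbours on both sides, an edge at a neighbour of an apex, or a
  cherry inside a side would now each produce \<open>F\<close>; so deleting the apexes leaves a bipartite graph.
\<close>

section \<open>Triangle chains and copies of the blow-up\<close>

text \<open>The obstacle is that matchings inside the sides imitate apexes. With
  \<open>s - 1\<close> apexes and a perfect matching in one side, a cross edge still lies in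
  \<open>s\<close> triangles, so the edge condition misses the defect. The four-set condition sees
  it: for a matching edge and two vertices of the other side, two disjoint cross edges have
  \<open>2 * s\<close> common neighbours in total, one fewer than required. With
  \<open>s - 1\<close> apexes and perfect matchings in both sides, counting fails altogether, as
  this rival has about as many edges as the optimum. It can only be refuted by a copy, so chains may
  also end in gadgets built from side edges.

  The budget is counted in apexes. An apex inside a chain serves the two triangles that meet in it,
  an apex at the start only one, and the core uses two. So \<open>s\<close> apexes leave a chain of
  \<open>2 * (s - 2) + 1\<close> triangles, which is one short of \<open>l\<close> for even
  \<open>l\<close> and two short for odd \<open>l\<close>. Every irregularity excluded at the end
  either adds two triangles to the chain or replaces an apex of the core.\<close>

text \<open>\<open>tchain r m p S\<close>: a chain of \<open>m\<close> triangles, consecutive ones sharing a vertex, that starts at \<open>p\<close>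
  and whose other vertices lie outside \<open>S\<close> (normally \<open>p \<in> S\<close>). Graphs are handled as symmetric sets of arcs, so that
  the cardinality of an arc set is twice the number of edges.\<close>

fun tchain :: "('a \<times> 'a) set \<Rightarrow> nat \<Rightarrow> 'a \<Rightarrow> 'a set \<Rightarrow> bool" where
  "tchain r 0 p S = True"
| "tchain r (Suc m) p S =
     (\<exists>q w. q \<noteq> w \<and> q \<notin> S \<and> w \<notin> S \<and> (p, q) \<in> r \<and> (p, w) \<in> r \<and> (q, w) \<in> r \<and>
        tchain r m q (insert q (insert w S)))"

definition core :: "('a \<times> 'a) set \<Rightarrow> 'a \<Rightarrow> 'a \<Rightarrow> 'a \<Rightarrow> 'a \<Rightarrow> 'a \<Rightarrow> 'a \<Rightarrow> bool" where
  "core r x y z p q u \<longleftrightarrow> distinct [x, y, z, p, q, u] \<and>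
     (x, y) \<in> r \<and> (y, z) \<in> r \<and> (z, x) \<in> r \<and>
     (x, p) \<in> r \<and> (y, p) \<in> r \<and> (y, q) \<in> r \<and> (z, q) \<in> r \<and> (z, u) \<in> r \<and> (x, u) \<in> r"

definition has_lollipop :: "('a \<times> 'a) set \<Rightarrow> nat \<Rightarrow> bool" where
  "has_lollipop r l \<longleftrightarrow>
     (\<exists>x y z p q u. core r x y z p q u \<and> tchain r l z {x, y, z, p, q, u})"

lemma tchain_lists:
  assumes "tchain r m p S"
  shows "\<exists>ps ws. length ps = m \<and> length ws = m \<and> distinct (ps @ ws) \<and> set (ps @ ws) \<inter> S = {} \<and>
    (\<forall>i<m. ((p # ps) ! i, ps ! i) \<in> r \<and> ((p # ps) ! i, ws ! i) \<in> r \<and> (ps ! i, ws ! i) \<in> r)"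
  using assms
proof (induction m arbitrary: p S)
  case 0
  then show ?case by auto
next
  case (Suc m)
  then obtain q w where qw: "q \<noteq> w" "q \<notin> S" "w \<notin> S" "(p, q) \<in> r" "(p, w) \<in> r" "(q, w) \<in> r"
    and t: "tchain r m q (insert q (insert w S))" by auto
  from Suc.IH[OF t] obtain ps ws where l: "length ps = m" "length ws = m" "distinct (ps @ ws)"
    and d: "set (ps @ ws) \<inter> insert q (insert w S) = {}"
    and a: "\<forall>i<m. ((q # ps) ! i, ps ! i) \<in> r \<and> ((q # ps) ! i, ws ! i) \<in> r \<and> (ps ! i, ws ! i) \<in> r"
    by blast
  have "\<forall>i<Suc m. ((p # q # ps) ! i, (q # ps) ! i) \<in> r \<and> ((p # q # ps) ! i, (w # ws) ! i) \<in> r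
      \<and> ((q # ps) ! i, (w # ws) ! i) \<in> r"
    using a qw by (auto simp: less_Suc_eq_0_disj)
  then show ?case
    using l d qw by (intro exI[of _ "q # ps"] exI[of _ "w # ws"]) auto
qed

lemma tchain_mono:
  assumes "tchain r m p S" "k \<le> m"
  shows "tchain r k p S"
  using assms
proof (induction m arbitrary: p S k)
  case (Suc m)
  show ?case
  proof (cases k)
    case (Suc k')
    then show ?thesis using Suc.prems Suc.IH[of _ _ k'] by (simp del: insert_iff) metis
  qed simp
qed simp

section \<open>Embedding the blow-up along a core and a chain\<close>

definition arcs :: "'a set set \<Rightarrow> ('a \<times> 'a) set" where
  "arcs E = {(u, v). {u, v} \<in> E}"

lemma lollipop_edges_iff:
  "e \<in> edges (lollipop 3 l) \<longleftrightarrow> e = {0, 1} \<or> e = {1, 2} \<or> e = {0, 2} \<or> (\<exists>i\<ge>2. i < l + 2 \<and> e = {i, i + 1})"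
proof -
  have "{..<3} = {0, 1, 2 :: nat}" by auto
  then have "{{i, (i + 1) mod 3} | i. i < 3} = (\<lambda>i. {i, (i + 1) mod 3}) ` {0, 1, 2 :: nat}"
    by (auto simp only: image_def lessThan_iff simp flip: \<open>{..<3} = _\<close>)
  also have "\<dots> = {{0, 1}, {1, 2}, {0, 2}}" by (simp add: insert_commute numeral_2_eq_2)
  finally have 1: "{{i, (i + 1) mod 3} | i. i < 3} = {{0, 1}, {1, 2}, {0, 2 :: nat}}" .
  have "3 - 1 \<le> i \<and> i < 3 - 1 + l \<longleftrightarrow> 2 \<le> i \<and> i < l + 2" for i by auto
  then show ?thesis unfolding lollipop_def snd_conv 1 by blast
qed

lemma blowup_clique_3: "blowup_clique 3 e = insert (Inr (e, 0)) (Inl ` e)"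
  unfolding blowup_clique_def by auto

text \<open>A numbering of the lollipop edges that lets one list hold all private vertices: the
  cycle edges \<open>{0, 1}\<close>, \<open>{1, 2}\<close>, \<open>{0, 2}\<close> get 0, 1, 2 and
  the path edge \<open>{i, i + 1}\<close> gets \<open>i + 1\<close>.\<close>

definition edge_index :: "nat set \<Rightarrow> nat" where
  "edge_index e = (if e = {0, 2} then 2 else if e \<subseteq> {..2} then Min e else Suc (Min e))"

lemma edge_index_simps:
  "edge_index {0, 1} = 0" "edge_index {0, Suc 0} = 0" "edge_index {1, 2} = 1" "edge_index {Suc 0, 2} = 1" "edge_index {0, 2} = 2"
  "i \<ge> 2 \<Longrightarrow> edge_index {i, i + 1} = i + 1" "i \<ge> 2 \<Longrightarrow> edge_index {i, Suc i} = Suc i"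
  by (auto simp: edge_index_def doubleton_eq_iff min_def)

lemma inj_on_edge_index: "inj_on edge_index (edges (lollipop 3 l))"
  by (rule inj_onI) (auto simp: lollipop_edges_iff edge_index_simps)

lemma edge_index_less: "e \<in> edges (lollipop 3 l) \<Longrightarrow> edge_index e < l + 3"
  by (auto simp: lollipop_edges_iff edge_index_simps)

lemma edge_blowup_verts:
  "verts (edge_blowup (lollipop 3 l) 3) =
     Inl ` {..<3 + l} \<union> (\<lambda>e. Inr (e, 0)) ` edges (lollipop 3 l)"
proof -
  have "e \<subseteq> {..<3 + l}" if "e \<in> edges (lollipop 3 l)" for e
    using that by (auto simp: lollipop_edges_iff)
  moreover have "verts (lollipop 3 l) = {..<3 + l}" by (simp add: lollipop_def)
  ultimately show ?thesis
    unfolding edge_blowup_def fst_conv blowup_clique_3 by blast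
qed

lemma has_lollipop_contains_copy:
  assumes sg: "simple_graph (V, E)" and F: "has_lollipop (arcs E) l"
  shows "contains_copy (V, E) (edge_blowup (lollipop 3 l) 3)"
proof -
  obtain x y z p q u where c: "core (arcs E) x y z p q u"
    and t: "tchain (arcs E) l z {x, y, z, p, q, u}"
    using F unfolding has_lollipop_def by blast
  obtain ps ws where l: "length ps = l" "length ws = l" "distinct (ps @ ws)"
    and d: "set (ps @ ws) \<inter> {x, y, z, p, q, u} = {}"
    and a: "\<And>i. i < l \<Longrightarrow> ((z # ps) ! i, ps ! i) \<in> arcs E \<and> ((z # ps) ! i, ws ! i) \<in> arcs E
        \<and> (ps ! i, ws ! i) \<in> arcs E"
    using tchain_lists[OF t] by blast
  \<comment> \<open>\<open>L\<close> holds the images of the original vertices, with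
    \<open>z\<close> in the place of vertex 2, where the path is attached. \<open>K\<close> holds
    the images of the private vertices in the order of \<open>edge_index\<close>.\<close>
  define L where "L = x # y # z # ps"
  define K where "K = p # q # u # ws"
  define f where "f = (\<lambda>v. case v of Inl i \<Rightarrow> L ! i | Inr (e, _ :: nat) \<Rightarrow> K ! edge_index e)"
  have f: "f (Inl i) = L ! i" "f (Inr (e, k)) = K ! edge_index e" for i e k by (auto simp: f_def)
  have len: "length L = 3 + l" "length K = 3 + l" by (auto simp: L_def K_def l)
  have dist: "distinct L" "distinct K" "set L \<inter> set K = {}"
    using c d l(3) unfolding L_def K_def core_def by auto
  have pair: "e \<in> nsets V 2" if "e \<in> E" for e using sg that by (auto simp: simple_graph_def)
  have inV: "a \<in> V \<and> b \<in> V" if "(a, b) \<in> arcs E" for a b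
    using pair[of "{a, b}"] that by (auto simp: arcs_def nsets_def)
  have tri: "(L ! i, L ! j) \<in> arcs E \<and> (L ! i, K ! edge_index e) \<in> arcs E \<and> (L ! j, K ! edge_index e) \<in> arcs E \<and> i \<noteq> j"
    if "e \<in> edges (lollipop 3 l)" "e = {i, j}" "i < j" for e i j
  proof -
    have cc: "(x, y) \<in> arcs E" "(y, z) \<in> arcs E" "(x, z) \<in> arcs E"
     "(x, p) \<in> arcs E" "(y, p) \<in> arcs E" "(y, q) \<in> arcs E" "(z, q) \<in> arcs E" "(z, u) \<in> arcs E" "(x, u) \<in> arcs E"
      using c by (auto simp: core_def arcs_def insert_commute)
    from that(1) consider "e = {0, 1}" | "e = {1, 2}" | "e = {0, 2}" | k where "k \<ge> 2" "k < l + 2" "e = {k, k + 1}"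
      unfolding lollipop_edges_iff by blast
    then show ?thesis
    proof cases
      case 4
      then have ij: "i = k" "j = k + 1" using that by (auto simp: doubleton_eq_iff)
      obtain m where m: "k = m + 2" "m < l" using 4 by (metis add.commute le_Suc_ex nat_add_left_cancel_less)
      have "edge_index e = m + 3" using edge_index_simps(6)[OF 4(1)] 4(3) m by simp
      then show ?thesis using a[OF m(2)] ij m by (auto simp: L_def K_def numeral_eq_Suc)
    qed (use that cc in \<open>auto simp: L_def K_def edge_index_simps doubleton_eq_iff\<close>)
  qed
  have K_mem: "K ! edge_index e \<in> set K" if "e \<in> edges (lollipop 3 l)" for e
    using edge_index_less[OF that] len by (intro nth_mem) simp
  have L_mem: "L ! i \<in> set L" if "i < 3 + l" for i
    using that len by (intro nth_mem) simp
  have K_inj: "e = e'" if "e \<in> edges (lollipop 3 l)" "e' \<in> edges (lollipop 3 l)" "K ! edge_index e = K ! edge_index e'" for e e'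
  proof -
    have "edge_index e = edge_index e'"
      using that(3) edge_index_less[OF that(1)] edge_index_less[OF that(2)] dist(2) len
      by (simp add: nth_eq_iff_index_eq)
    then show ?thesis using inj_onD[OF inj_on_edge_index _ that(1,2)] by blast
  qed
  have inj: "inj_on f (verts (edge_blowup (lollipop 3 l) 3))"
    unfolding edge_blowup_verts
  proof (subst inj_on_Un, intro conjI)
    show "inj_on f (Inl ` {..<3 + l})"
      using dist(1) len by (auto simp: inj_on_def f nth_eq_iff_index_eq)
    show "inj_on f ((\<lambda>e. Inr (e, 0)) ` edges (lollipop 3 l))"
      using K_inj by (auto simp: inj_on_def f)
    have "f ` (Inl ` {..<3 + l}) \<subseteq> set L" using L_mem by (auto simp: f)
    moreover have "f ` ((\<lambda>e. Inr (e, 0)) ` edges (lollipop 3 l)) \<subseteq> set K" using K_mem by (auto simp: f)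
    ultimately show "f ` (Inl ` {..<3 + l} - (\<lambda>e. Inr (e, 0)) ` edges (lollipop 3 l)) \<inter>
        f ` ((\<lambda>e. Inr (e, 0)) ` edges (lollipop 3 l) - Inl ` {..<3 + l}) = {}"
      using dist(3) by blast
  qed
  have edge: "f ` e' \<in> E" if "e' \<in> edges (edge_blowup (lollipop 3 l) 3)" for e'
  proof -
    obtain e where e: "e \<in> edges (lollipop 3 l)" "e' \<in> nsets (blowup_clique 3 e) 2"
      using \<open>e' \<in> edges _\<close> by (auto simp: edge_blowup_def)
    obtain i j where ij: "e = {i, j}" "i < j"
      using e(1) unfolding lollipop_edges_iff by force
    have t3: "(L ! i, L ! j) \<in> arcs E" "(L ! i, K ! edge_index e) \<in> arcs E" "(L ! j, K ! edge_index e) \<in> arcs E"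
      using tri[OF e(1) ij] by auto
    obtain v w where vw: "e' = {v, w}" "v \<noteq> w" "v \<in> blowup_clique 3 e" "w \<in> blowup_clique 3 e"
      using e(2) by (auto simp: nsets_def card_2_iff)
    then show ?thesis using t3 ij(1)
      by (auto simp: blowup_clique_3 f arcs_def insert_commute)
  qed
  have sub: "f ` verts (edge_blowup (lollipop 3 l) 3) \<subseteq> V"
  proof -
    have "ps ! i \<in> V" "ws ! i \<in> V" if "i < l" for i using a[OF that] inV by blast+
    then have LV: "set L \<subseteq> V" "set K \<subseteq> V"
      using c inV unfolding L_def K_def core_def by (auto simp: in_set_conv_nth l)
    show ?thesis unfolding edge_blowup_verts using L_mem K_mem LV by (auto simp: f)
  qed
  show ?thesis unfolding contains_copy_def using inj sub edge by (metis fst_conv snd_conv)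
qed

section \<open>The graph H(n, 2, q)\<close>

definition join_edges :: "'a set \<Rightarrow> 'a set \<Rightarrow> 'a set \<Rightarrow> 'a set set" where
  "join_edges X A B = nsets X 2 \<union> (\<lambda>(x, y). {x, y}) ` (X \<times> (A \<union> B)) \<union> (\<lambda>(a, b). {a, b}) ` (A \<times> B)"

lemma card_join_edges:
  assumes "finite X" "finite A" "finite B" "X \<inter> A = {}" "X \<inter> B = {}" "A \<inter> B = {}"
  shows "card (join_edges X A B) = (card X choose 2) + card X * (card A + card B) + card A * card B"
proof -
  let ?P = "nsets X 2" and ?Q = "(\<lambda>(x, y). {x, y}) ` (X \<times> (A \<union> B))" and ?R = "(\<lambda>(a, b). {a, b}) ` (A \<times> B)"
  have fin: "finite ?P" "finite ?Q" "finite ?R" using assms by (auto simp: finite_imp_finite_nsets)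
  have P: "card ?P = card X choose 2"
    using n_subsets[OF assms(1), of 2] by (simp add: nsets_def conj_commute)
      (metis (no_types, lifting) Collect_cong assms(1) finite_subset)
  have Q: "card ?Q = card X * (card A + card B)"
    using assms by (subst card_image) (auto simp: inj_on_def doubleton_eq_iff card_cartesian_product card_Un_disjoint)
  have R: "card ?R = card A * card B"
    using assms by (subst card_image) (auto simp: inj_on_def doubleton_eq_iff card_cartesian_product)
  have "?P \<inter> ?Q = {}" "(?P \<union> ?Q) \<inter> ?R = {}"
    using assms by (auto simp: nsets_def doubleton_eq_iff)
  then have "card (join_edges X A B) = card ?P + card ?Q + card ?R"
    unfolding join_edges_def using fin by (simp add: card_Un_disjoint)
  then show ?thesis using P Q R by simp
qed

lemma join_edges_subset:
  assumes "X \<inter> A = {}" "X \<inter> B = {}" "A \<inter> B = {}"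
  shows "join_edges X A B \<subseteq> nsets (X \<union> A \<union> B) 2"
proof -
  have "{u, v} \<in> nsets (X \<union> A \<union> B) 2" if "u \<noteq> v" "u \<in> X \<union> A \<union> B" "v \<in> X \<union> A \<union> B" for u v
    using that by (simp add: nsets_def)
  moreover have "nsets X 2 \<subseteq> nsets (X \<union> A \<union> B) 2" by (auto simp: nsets_def)
  moreover have "(\<lambda>(x, y). {x, y}) ` (P \<times> Q) \<subseteq> nsets (X \<union> A \<union> B) 2"
    if "P \<inter> Q = {}" "P \<subseteq> X \<union> A \<union> B" "Q \<subseteq> X \<union> A \<union> B" for P Q
  proof -
    have "{a, b} \<in> nsets (X \<union> A \<union> B) 2" if "a \<in> P" "b \<in> Q" for a b
      using that \<open>P \<inter> Q = {}\<close> \<open>P \<subseteq> _\<close> \<open>Q \<subseteq> _\<close> by (intro calculation(1)) auto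
    then show ?thesis by auto
  qed
  from this[of X "A \<union> B"] this[of A B] have "(\<lambda>(x, y). {x, y}) ` (X \<times> (A \<union> B)) \<subseteq> nsets (X \<union> A \<union> B) 2"
    "(\<lambda>(x, y). {x, y}) ` (A \<times> B) \<subseteq> nsets (X \<union> A \<union> B) 2"
    using assms by auto
  ultimately show ?thesis unfolding join_edges_def by simp
qed

lemma join_edges_image:
  assumes "inj_on f (X \<union> A \<union> B)"
  shows "(\<lambda>e. f ` e) ` join_edges X A B = join_edges (f ` X) (f ` A) (f ` B)"
proof -
  have "(\<lambda>e. f ` e) ` nsets X 2 = nsets (f ` X) 2"
  proof -
    have i: "inj_on f X" using assms by (auto intro: inj_on_subset)
    show ?thesis
    proof (intro equalityI subsetI)
      fix e assume "e \<in> nsets (f ` X) 2"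
      then obtain Y where "Y \<subseteq> X" "e = f ` Y" "finite e" "card e = 2"
        by (auto simp: nsets_def subset_image_iff)
      moreover have "inj_on f Y" using i \<open>Y \<subseteq> X\<close> by (rule inj_on_subset)
      ultimately show "e \<in> (\<lambda>e. f ` e) ` nsets X 2"
        by (auto simp: nsets_def card_image finite_image_iff)
    next
      fix e assume "e \<in> (\<lambda>e. f ` e) ` nsets X 2"
      then show "e \<in> nsets (f ` X) 2"
        using i by (auto simp: nsets_def card_image inj_on_subset)
    qed
  qed
  moreover have "(\<lambda>e. f ` e) ` (\<lambda>(x, y). {x, y}) ` (P \<times> Q) = (\<lambda>(x, y). {x, y}) ` (f ` P \<times> f ` Q)" for P Q
  proof -
    have "f ` P \<times> f ` Q = map_prod f f ` (P \<times> Q)" by auto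
    then show ?thesis by (simp add: image_image case_prod_unfold del: map_prod_surj_on)
  qed
  ultimately show ?thesis
    by (simp add: join_edges_def image_Un)
qed

lemma graph_iso_join_edges:
  assumes fin: "finite X" "finite A" "finite B" "finite X'" "finite A'" "finite B'"
    and disj: "X \<inter> A = {}" "X \<inter> B = {}" "A \<inter> B = {}" "X' \<inter> A' = {}" "X' \<inter> B' = {}" "A' \<inter> B' = {}"
    and card: "card X = card X'" "card A = card A'" "card B = card B'"
  shows "graph_iso (X \<union> A \<union> B, join_edges X A B) (X' \<union> A' \<union> B', join_edges X' A' B')"
proof -
  obtain f g h where f: "bij_betw f X X'" and g: "bij_betw g A A'" and h: "bij_betw h B B'"
    using fin card finite_same_card_bij by metis
  define k where "k = (\<lambda>v. if v \<in> X then f v else if v \<in> A then g v else h v)"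
  have "bij_betw k X X' = bij_betw f X X'" by (rule bij_betw_cong) (simp add: k_def)
  moreover have "bij_betw k A A' = bij_betw g A A'" by (rule bij_betw_cong) (use disj in \<open>auto simp: k_def\<close>)
  moreover have "bij_betw k B B' = bij_betw h B B'" by (rule bij_betw_cong) (use disj in \<open>auto simp: k_def\<close>)
  ultimately have kk: "bij_betw k X X'" "bij_betw k A A'" "bij_betw k B B'" using f g h by auto
  have "bij_betw k (X \<union> A) (X' \<union> A')" by (rule bij_betw_combine[OF kk(1,2) disj(4)])
  then have "bij_betw k (X \<union> A \<union> B) (X' \<union> A' \<union> B')" by (rule bij_betw_combine[OF _ kk(3)]) (use disj in blast)
  then have k: "bij_betw k (X \<union> A \<union> B) (X' \<union> A' \<union> B')" "k ` X = X'" "k ` A = A'" "k ` B = B'"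
    using kk by (auto dest: bij_betw_imp_surj_on)
  then show ?thesis
    unfolding graph_iso_def fst_conv snd_conv
    by (intro exI[of _ k]) (simp add: join_edges_image bij_betw_def)
qed

section \<open>The Turan part split by parity\<close>

definition even_part :: "nat \<Rightarrow> nat set" where "even_part m = {i. i < m \<and> even i}"
definition odd_part :: "nat \<Rightarrow> nat set" where "odd_part m = {i. i < m \<and> odd i}"

lemma card_parts: "card (even_part m) = (m + 1) div 2 \<and> card (odd_part m) = m div 2"
proof (induction m)
  case 0
  then show ?case by (simp add: even_part_def odd_part_def)
next
  case (Suc m)
  have "even_part (Suc m) = (if even m then insert m (even_part m) else even_part m)"
    "odd_part (Suc m) = (if odd m then insert m (odd_part m) else odd_part m)"
    by (auto simp: even_part_def odd_part_def less_Suc_eq)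
  moreover have "finite (even_part m)" "finite (odd_part m)" "m \<notin> even_part m" "m \<notin> odd_part m"
    by (auto simp: even_part_def odd_part_def)
  ultimately show ?case using Suc by auto
qed

lemma H_graph_eq:
  "H_graph n 2 (Suc s) = (Inl ` {..<s} \<union> Inr ` even_part (n - s) \<union> Inr ` odd_part (n - s),
     join_edges (Inl ` {..<s}) (Inr ` even_part (n - s)) (Inr ` odd_part (n - s)))"
proof -
  let ?m = "n - s"
  have p: "even_part ?m \<union> odd_part ?m = {..<?m}" by (auto simp: even_part_def odd_part_def)
  have 1: "(\<lambda>e. Inl ` e :: (nat + nat) set) ` nsets {..<s} 2 = nsets (Inl ` {..<s}) 2"
    using join_edges_image[of "Inl :: nat \<Rightarrow> nat + nat" "{..<s}" "{}" "{}"] by (simp add: join_edges_def)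
  have 2: "(\<lambda>e. Inr ` e :: (nat + nat) set) ` edges (turan_graph 2 ?m)
      = (\<lambda>(a, b). {a, b}) ` (Inr ` even_part ?m \<times> Inr ` odd_part ?m)" (is "?L = ?R")
  proof (intro equalityI subsetI)
    fix e assume "e \<in> ?L"
    then obtain i j where ij: "e = {Inr i, Inr j}" "i < ?m" "j < ?m" "i mod 2 \<noteq> j mod 2"
      by (auto simp: turan_graph_def)
    then consider "even i" "odd j" | "odd i" "even j" by (metis odd_iff_mod_2_eq_one even_iff_mod_2_eq_zero)
    then show "e \<in> ?R"
      by cases (use ij in \<open>auto simp: even_part_def odd_part_def image_iff insert_commute\<close>)
  next
    fix e assume "e \<in> ?R"
    then obtain i j where ij: "e = Inr ` {i, j}" "i < ?m" "j < ?m" "even i" "odd j"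
      by (auto simp: even_part_def odd_part_def)
    then have "{i, j} \<in> edges (turan_graph 2 ?m)"
      unfolding turan_graph_def snd_conv by (intro CollectI exI[of _ i] exI[of _ j]) presburger
    then show "e \<in> ?L" using ij(1) by blast
  qed
  have 3: "{{Inl u, Inr v} | u v. u \<in> {..<s} \<and> v \<in> {..<?m}} = (\<lambda>(x, y). {x, y}) ` (Inl ` {..<s} \<times> (Inr ` even_part ?m \<union> Inr ` odd_part ?m))"
    unfolding image_Un[symmetric] p by (auto simp: image_iff)
  have 4: "Inr ` {..<?m} = Inr ` even_part ?m \<union> Inr ` odd_part ?m" unfolding image_Un[symmetric] p ..
  have 5: "Suc s - 1 = s" "n + 1 - Suc s = n - s" by auto
  have 6: "verts (complete_graph s) = {..<s}" "edges (complete_graph s) = nsets {..<s} 2"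
    "verts (turan_graph 2 ?m) = {..<?m}" by (simp_all add: complete_graph_def turan_graph_def)
  show ?thesis
    unfolding H_graph_def graph_join_def join_edges_def 5 6 1 2 3 4 by (simp only: Un_ac)
qed

definition hedges :: "nat \<Rightarrow> nat \<Rightarrow> nat" where
  "hedges s n = (s choose 2) + s * (n - s) + ((n - s) div 2) * ((n - s + 1) div 2)"

lemma H_graph_props:
  assumes "s \<le> n"
  shows "simple_graph (H_graph n 2 (Suc s))" "card (verts (H_graph n 2 (Suc s))) = n"
    "card (edges (H_graph n 2 (Suc s))) = hedges s n"
proof -
  have fin: "finite (even_part (n - s))" "finite (odd_part (n - s))" "even_part (n - s) \<inter> odd_part (n - s) = {}"
    by (auto simp: even_part_def odd_part_def)
  have half: "(n - s) div 2 + (n - s + 1) div 2 = n - s" by presburger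
  show "simple_graph (H_graph n 2 (Suc s))"
    unfolding H_graph_eq simple_graph_def fst_conv snd_conv
    using fin by (intro conjI join_edges_subset) auto
  have c: "card (Inl ` {..<s} :: (nat + nat) set) = s"
     "card (Inr ` even_part (n - s) :: (nat + nat) set) = (n - s + 1) div 2"
     "card (Inr ` odd_part (n - s) :: (nat + nat) set) = (n - s) div 2"
    using card_parts by (auto simp: card_image)
  let ?X = "Inl ` {..<s} :: (nat + nat) set" and ?A = "Inr ` even_part (n - s) :: (nat + nat) set"
    and ?B = "Inr ` odd_part (n - s) :: (nat + nat) set"
  have d: "finite ?X" "finite ?A" "finite ?B" "?X \<inter> ?A = {}" "?X \<inter> ?B = {}" "?A \<inter> ?B = {}"
    using fin by auto
  have "card (?X \<union> ?A \<union> ?B) = card (?X \<union> ?A) + card ?B"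
    using d by (intro card_Un_disjoint) blast+
  also have "card (?X \<union> ?A) = card ?X + card ?A"
    using d by (intro card_Un_disjoint) blast+
  finally show "card (verts (H_graph n 2 (Suc s))) = n"
    unfolding H_graph_eq fst_conv c using half assms by linarith
  have "card ?A + card ?B = n - s" unfolding c using half by linarith
  then show "card (edges (H_graph n 2 (Suc s))) = hedges s n"
    unfolding H_graph_eq snd_conv card_join_edges[OF d] by (simp only: c hedges_def mult.commute)
qed

text \<open>Among the \<open>Inr\<close> vertices, adjacency changes the parity, and three numbers
  cannot have pairwise different parities.\<close>

lemma H_graph_triangle:
  assumes "{u, v} \<in> edges (H_graph n 2 (Suc s))" "{u, w} \<in> edges (H_graph n 2 (Suc s))" "{v, w} \<in> edges (H_graph n 2 (Suc s))"
    "u \<noteq> v" "u \<noteq> w" "v \<noteq> w"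
  shows "\<exists>y\<in>{u, v, w}. y \<in> range Inl"
proof (rule ccontr)
  assume "\<not> ?thesis"
  then obtain i j k where ijk: "u = Inr i" "v = Inr j" "w = Inr k"
    by (metis (no_types) insertI1 insertI2 rangeI sumE)
  have "even a \<noteq> even b" if e: "{Inr a, Inr b} \<in> edges (H_graph n 2 (Suc s))" for a b
  proof -
    have n1: "{Inr a, Inr b :: nat + nat} \<notin> nsets (Inl ` {..<s}) 2" by (auto simp: nsets_def)
    have n2: "{Inr a, Inr b :: nat + nat} \<notin> (\<lambda>(x, y). {x, y}) ` (Inl ` {..<s} \<times> Y)" for Y
    proof
      assume "{Inr a, Inr b :: nat + nat} \<in> (\<lambda>(x, y). {x, y}) ` (Inl ` {..<s} \<times> Y)"
      then obtain x and y :: "nat + nat" where "{Inr a, Inr b} = {Inl x, y}" by blast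
      then have "Inl x \<in> {Inr a, Inr b :: nat + nat}" by (simp only: insertI1)
      then show False by simp
    qed
    have "{Inr a, Inr b :: nat + nat} \<in> (\<lambda>(x, y). {x, y}) ` (Inr ` even_part (n - s) \<times> Inr ` odd_part (n - s))"
      using e unfolding H_graph_eq snd_conv join_edges_def Un_iff by (elim disjE) (erule notE[OF n1] | erule notE[OF n2] | assumption)+
    then obtain i j where "{Inr a, Inr b :: nat + nat} = {Inr i, Inr j}" "even i" "odd j"
      by (auto simp: even_part_def odd_part_def)
    then show ?thesis by (auto simp: doubleton_eq_iff)
  qed
  then show False using assms unfolding ijk by metis
qed

lemma H_graph_lollipop_free:
  assumes "s = Suc (l div 2)"
  shows "\<not> contains_copy (H_graph n 2 (Suc s)) (edge_blowup (lollipop 3 l) 3)"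
proof
  let ?F = "edge_blowup (lollipop 3 l) 3" and ?E = "edges (H_graph n 2 (Suc s))"
  assume "contains_copy (H_graph n 2 (Suc s)) ?F"
  then obtain f where inj: "inj_on f (verts ?F)" and fV: "f ` verts ?F \<subseteq> verts (H_graph n 2 (Suc s))"
    and fE: "\<And>e. e \<in> edges ?F \<Longrightarrow> f ` e \<in> ?E" unfolding contains_copy_def by blast
  define P where "P = {v \<in> verts ?F. f v \<in> range Inl}"
  have "f ` P \<subseteq> Inl ` {..<s}" using fV by (auto simp: P_def H_graph_eq)
  moreover have injP: "inj_on f P" using inj by (rule inj_on_subset) (auto simp: P_def)
  ultimately have finP: "finite P" and cardP: "card P \<le> s"
    using card_inj_on_le[of f P "Inl ` {..<s}"] by (auto simp: card_image intro: inj_on_finite[of f P])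
  have hit: "\<exists>v\<in>P. v \<in> {Inl i, Inl j, Inr ({i, j}, 0)}" if ij: "{i, j} \<in> edges (lollipop 3 l)" "i \<noteq> j" for i j
  proof -
    let ?u = "Inl i" and ?v = "Inl j" and ?w = "Inr ({i, j}, 0)"
    have C: "blowup_clique 3 {i, j} = {?u, ?v, ?w}" by (auto simp: blowup_clique_3)
    have sub: "blowup_clique 3 {i, j} \<subseteq> verts ?F" using ij(1) by (auto simp: edge_blowup_def)
    then have V: "?u \<in> verts ?F" "?v \<in> verts ?F" "?w \<in> verts ?F" unfolding C by auto
    have "nsets {?u, ?v, ?w} 2 \<subseteq> edges ?F" using ij(1) unfolding edge_blowup_def snd_conv C[symmetric] by blast
    moreover have "{?u, ?v} \<in> nsets {?u, ?v, ?w} 2" "{?u, ?w} \<in> nsets {?u, ?v, ?w} 2" "{?v, ?w} \<in> nsets {?u, ?v, ?w} 2"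
      using ij(2) by (auto simp: nsets_def)
    ultimately have "f ` {?u, ?v} \<in> ?E" "f ` {?u, ?w} \<in> ?E" "f ` {?v, ?w} \<in> ?E" using fE by blast+
    then have "{f ?u, f ?v} \<in> ?E" "{f ?u, f ?w} \<in> ?E" "{f ?v, f ?w} \<in> ?E" by simp_all
    moreover have "f ?u \<noteq> f ?v" "f ?u \<noteq> f ?w" "f ?v \<noteq> f ?w"
      using inj_onD[OF inj] V ij(2) by blast+
    ultimately have "\<exists>y\<in>{f ?u, f ?v, f ?w}. y \<in> range Inl" by (rule H_graph_triangle)
    then show ?thesis using V unfolding P_def by blast
  qed
  obtain a where a: "a \<in> P" "a \<in> {Inl 0, Inl 1, Inr ({0, 1}, 0)}" using hit[of 0 1] by (auto simp: lollipop_edges_iff)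
  obtain b where b: "b \<in> P" "b \<in> {Inl 1, Inl 2, Inr ({1, 2}, 0)}" using hit[of 1 2] by (auto simp: lollipop_edges_iff)
  obtain c where c: "c \<in> P" "c \<in> {Inl 0, Inl 2, Inr ({0, 2}, 0)}" using hit[of 0 2] by (auto simp: lollipop_edges_iff)
  \<comment> \<open>Every second path edge is used, so that the triangles are disjoint. The first is
    \<open>{3, 4}\<close>, because \<open>{2, 3}\<close> meets the cycle in vertex 2.\<close>
  have "\<exists>v\<in>P. v \<in> {Inl (3 + 2 * j), Inl (4 + 2 * j), Inr ({3 + 2 * j, 4 + 2 * j}, 0)}" if "j < l div 2" for j
  proof (rule hit)
    have "3 + 2 * j < l + 2" using that by presburger
    then show "{3 + 2 * j, 4 + 2 * j} \<in> edges (lollipop 3 l)" unfolding lollipop_edges_iff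
      by (intro disjI2 exI[of _ "3 + 2 * j"]) auto
  qed simp
  then obtain g where g: "\<And>j. j < l div 2 \<Longrightarrow> g j \<in> P \<and> g j \<in> {Inl (3 + 2 * j), Inl (4 + 2 * j), Inr ({3 + 2 * j, 4 + 2 * j}, 0)}"
    by metis
  \<comment> \<open>\<open>h\<close> recovers \<open>j\<close> from any of the three candidates for
    \<open>g j\<close>; the division by two identifies \<open>3 + 2 * j\<close> with
    \<open>4 + 2 * j\<close>. This makes \<open>g\<close> injective.\<close>
  define h :: "nat + nat set \<times> nat \<Rightarrow> nat" where "h = (\<lambda>v. case v of Inl i \<Rightarrow> (i - 3) div 2 | Inr (e, _) \<Rightarrow> (Min e - 3) div 2)"
  have "h (g j) = j" if "j < l div 2" for j
    using g[OF that] by (elim conjE insertE emptyE) (simp_all add: h_def)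
  then have "inj_on g {..<l div 2}" by (intro inj_on_inverseI[where g = h]) simp
  then have cg: "card (g ` {..<l div 2}) = l div 2" by (simp add: card_image)
  \<comment> \<open>No vertex lies in all three core triangles: the first two share only
    \<open>Inl 1\<close>, which the third avoids.\<close>
  have "\<exists>D\<subseteq>P. card D = 2 \<and> D \<subseteq> {a, b, c}"
  proof (cases "a = b")
    case True
    have ne: "{0, 1} \<noteq> {1, 2 :: nat}" by (simp add: doubleton_eq_iff)
    have "a = Inl 1" using a(2) b(2) ne unfolding True[symmetric] by (elim insertE emptyE) simp_all
    then have "c \<noteq> a" using c(2) by (elim insertE emptyE) simp_all
    then show ?thesis using a(1) c(1) by (intro exI[of _ "{a, c}"]) auto
  next
    case False
    then show ?thesis using a(1) b(1) by (intro exI[of _ "{a, b}"]) auto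
  qed
  then obtain D where D: "D \<subseteq> P" "card D = 2" "D \<subseteq> {a, b, c}" by blast
  have "{a, b, c} \<inter> g ` {..<l div 2} = {}"
  proof -
    have "{a, b, c} \<subseteq> {Inl 0, Inl 1, Inl 2, Inr ({0, 1}, 0), Inr ({1, 2}, 0), Inr ({0, 2}, 0)}"
      using a(2) b(2) c(2) by auto
    moreover have "g j \<notin> {Inl 0, Inl 1, Inl 2, Inr ({0, 1}, 0), Inr ({1, 2}, 0), Inr ({0, 2}, 0)}" if "j < l div 2" for j
    proof -
      have "{3 + 2 * j, 4 + 2 * j} \<notin> {{0, 1}, {1, 2}, {0, 2}}" by (simp add: doubleton_eq_iff)
      then show ?thesis using g[OF that] by (elim conjE insertE[of "g j"] emptyE) simp_all
    qed
    ultimately show ?thesis by blast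
  qed
  then have "D \<inter> g ` {..<l div 2} = {}" using D(3) by blast
  then have "card (D \<union> g ` {..<l div 2}) = 2 + l div 2"
    using D(1) finP cg D(2) by (subst card_Un_disjoint) (auto intro: finite_subset)
  moreover have "D \<union> g ` {..<l div 2} \<subseteq> P" using D(1) g by auto
  ultimately have "2 + l div 2 \<le> card P" using card_mono[OF finP] by metis
  then show False using cardP assms by simp
qed

section \<open>Reduction by deleting small vertex sets\<close>

definition arc_graph :: "'a set \<Rightarrow> ('a \<times> 'a) set \<Rightarrow> bool" where
  "arc_graph V r \<longleftrightarrow> finite V \<and> r \<subseteq> V \<times> V \<and> sym r \<and> irrefl r"

abbreviation deg :: "('a \<times> 'a) set \<Rightarrow> 'a \<Rightarrow> nat" where
  "deg r v \<equiv> card (r `` {v})"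

lemma arc_graphD:
  assumes "arc_graph V r"
  shows "finite V" "finite r" "finite (r `` Y)" "(a, b) \<in> r \<Longrightarrow> (b, a) \<in> r" "(a, b) \<in> r \<Longrightarrow> a \<in> V"
    "(a, b) \<in> r \<Longrightarrow> b \<in> V" "(a, a) \<notin> r" "r `` Y \<subseteq> V"
proof -
  show f: "finite V" "finite r" "r `` Y \<subseteq> V" using assms by (auto simp: arc_graph_def intro: finite_subset[of r "V \<times> V"])
  then show "finite (r `` Y)" by (auto intro: finite_subset)
qed (use assms in \<open>auto simp: arc_graph_def sym_def irrefl_def\<close>)

definition del_vertex :: "'a \<Rightarrow> ('a \<times> 'a) set \<Rightarrow> ('a \<times> 'a) set" where
  "del_vertex v r = {(a, b). (a, b) \<in> r \<and> a \<noteq> v \<and> b \<noteq> v}"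

lemma arc_graph_del_vertex: "arc_graph V r \<Longrightarrow> arc_graph (V - {v}) (del_vertex v r)"
  by (auto simp: arc_graph_def del_vertex_def sym_def irrefl_def)

lemma del_vertex_subset: "del_vertex v r \<subseteq> r"
  by (auto simp: del_vertex_def)

lemma card_del_vertex:
  assumes "arc_graph V r"
  shows "card r = card (del_vertex v r) + 2 * deg r v"
proof -
  note g = arc_graphD[OF assms]
  let ?A = "Pair v ` (r `` {v})" and ?B = "(\<lambda>u. (u, v)) ` (r `` {v})"
  have r: "r = del_vertex v r \<union> (?A \<union> ?B)"
    using g(4) by (auto simp: del_vertex_def image_iff)
  have "card ?A = deg r v" "card ?B = deg r v" by (auto intro!: card_image simp: inj_on_def)
  moreover have "?A \<inter> ?B = {}" using g(7) by auto
  ultimately have "card (?A \<union> ?B) = 2 * deg r v" using g(3) by (subst card_Un_disjoint) auto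
  moreover have "del_vertex v r \<inter> (?A \<union> ?B) = {}" by (auto simp: del_vertex_def)
  moreover have "finite (del_vertex v r)" using g(2) del_vertex_subset finite_subset by metis
  ultimately show ?thesis using g(3) by (subst r, subst card_Un_disjoint) auto
qed

lemma deg_del_vertex:
  assumes "arc_graph V r" "u \<noteq> v"
  shows "deg r u = deg (del_vertex v r) u + (if (u, v) \<in> r then 1 else 0)"
proof -
  note g = arc_graphD[OF assms(1)]
  have "del_vertex v r `` {u} = r `` {u} - {v}" using assms(2) by (auto simp: del_vertex_def)
  then show ?thesis using g(3)[of "{u}"] card_Suc_Diff1[of "r `` {u}" v]
    by (cases "(u, v) \<in> r") simp_all
qed

lemma tchain_arcs_mono: "tchain r m p S \<Longrightarrow> r \<subseteq> r' \<Longrightarrow> tchain r' m p S"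
  by (induction m arbitrary: p S) (simp, simp, blast)

lemma has_lollipop_mono: "has_lollipop r l \<Longrightarrow> r \<subseteq> r' \<Longrightarrow> has_lollipop r' l"
  unfolding has_lollipop_def core_def by (meson subsetD tchain_arcs_mono)

text \<open>The extremal graph grows by a vertex on its smaller side, which meets the
  \<open>s\<close> apexes and the whole larger side.\<close>

lemma hedges_Suc:
  assumes "s \<le> n"
  shows "hedges s (Suc n) = hedges s n + s + (Suc n - s) div 2"
proof -
  obtain m where m: "n = s + m" using assms le_Suc_ex by blast
  have "(Suc m div 2) * ((Suc m + 1) div 2) = (m div 2) * ((m + 1) div 2) + Suc m div 2"
  proof (cases "even m")
    case True
    then obtain k where "m = 2 * k" by blast
    then show ?thesis by simp
  next
    case False
    then obtain k where "m = 2 * k + 1" using oddE by blast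
    then show ?thesis by simp
  qed
  then show ?thesis unfolding hedges_def m by simp
qed

text \<open>The deleted vertices are one vertex of the larger side, one vertex of each side, and two
  vertices of each side. The summands 1 and 4 on the left are the edges among them, which a degree
  sum counts twice.\<close>

lemma hedges_minus:
  assumes "s + 4 \<le> n"
  shows "hedges s n = hedges s (n - 1) + s + (n - s) div 2"
    and "hedges s n + 1 = hedges s (n - 2) + s + n"
    and "hedges s n + 4 = hedges s (n - 4) + 2 * s + 2 * n"
proof -
  define q where "q = n - s - 4"
  have n: "n = s + q + 4" using assms by (simp add: q_def)
  have step: "hedges s (s + i + 1) = hedges s (s + i) + s + (i + 1) div 2" for i
    using hedges_Suc[of s "s + i"] by simp
  have h: "hedges s (s + q + 1) = hedges s (s + q) + s + (q + 1) div 2"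
    "hedges s (s + q + 2) = hedges s (s + q + 1) + s + (q + 2) div 2"
    "hedges s (s + q + 3) = hedges s (s + q + 2) + s + (q + 3) div 2"
    "hedges s (s + q + 4) = hedges s (s + q + 3) + s + (q + 4) div 2"
    using step[of q] step[of "q + 1"] step[of "q + 2"] step[of "q + 3"] by (simp_all add: numeral_eq_Suc)
  have d: "n - 1 = s + q + 3" "n - 2 = s + q + 2" "n - 4 = s + q" "n - s = q + 4" using n by auto
  show "hedges s n = hedges s (n - 1) + s + (n - s) div 2"
    using h(4) unfolding d unfolding n .
  have d43: "(q + 4) div 2 + (q + 3) div 2 = q + 3" by presburger
  then show "hedges s n + 1 = hedges s (n - 2) + s + n" using h(3,4) unfolding d unfolding n by linarith
  have d21: "(q + 2) div 2 + (q + 1) div 2 = q + 1" by presburger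
  show "hedges s n + 4 = hedges s (n - 4) + 2 * s + 2 * n" using h d43 d21 unfolding d unfolding n add_mult_distrib2 by linarith
qed

text \<open>The bounds are the numbers of edges that a vertex, an edge and a four-set with five or six edges meet in the
  extremal graph.\<close>

definition reduced :: "nat \<Rightarrow> 'a set \<Rightarrow> ('a \<times> 'a) set \<Rightarrow> bool" where
  "reduced s V r \<longleftrightarrow> arc_graph V r \<and> (\<forall>v\<in>V. card V + s \<le> 2 * deg r v + 1) \<and>
     (\<forall>u v. (u, v) \<in> r \<longrightarrow> card V + s \<le> deg r u + deg r v) \<and>
     (\<forall>a a' b b'. (a, a') \<in> r \<longrightarrow> (a, b) \<in> r \<longrightarrow> (a, b') \<in> r \<longrightarrow> (a', b) \<in> r \<longrightarrow> (a', b') \<in> r \<longrightarrow> b \<noteq> b' \<longrightarrow>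
        2 * card V + 2 * s + 1 + (if (b, b') \<in> r then 1 else 0) \<le> deg r a + deg r a' + deg r b + deg r b')"

lemma not_reduced_step:
  assumes g: "arc_graph V r" and n: "s + 4 \<le> card V" and e: "2 * hedges s (card V) + 2 * k \<le> card r"
    and nr: "\<not> reduced s V r"
  shows "\<exists>V' r'. arc_graph V' r' \<and> r' \<subseteq> r \<and> card V' < card V \<and> card V \<le> card V' + 4 \<and>
    2 * hedges s (card V') + 2 * Suc k \<le> card r'"
proof -
  note gd = arc_graphD[OF g]
  have cV: "card (V - {v}) = card V - 1" if "v \<in> V" for v using that gd(1) by simp
  from nr g consider v where "v \<in> V" "2 * deg r v + 1 < card V + s"
    | u v where "(u, v) \<in> r" "deg r u + deg r v < card V + s"
    | a a' b b' where "(a, a') \<in> r" "(a, b) \<in> r" "(a, b') \<in> r" "(a', b) \<in> r" "(a', b') \<in> r" "b \<noteq> b'"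
      "deg r a + deg r a' + deg r b + deg r b' < 2 * card V + 2 * s + 1 + (if (b, b') \<in> r then 1 else 0)"
    unfolding reduced_def not_le[symmetric] by blast
  then show ?thesis
  proof cases
    case 1
    obtain d h where d: "(card V - s) div 2 = d" "hedges s (card V - 1) = h" by blast
    have "deg r v < s + (card V - s) div 2" using 1(2) n by presburger
    then have "2 * hedges s (card V - 1) + 2 * Suc k \<le> card (del_vertex v r)"
      using e card_del_vertex[OF g, of v] hedges_minus(1)[OF n] unfolding d by arith
    then show ?thesis
      using arc_graph_del_vertex[OF g, of v] del_vertex_subset[of v r] cV[OF 1(1)] n
      by (intro exI[of _ "V - {v}"] exI[of _ "del_vertex v r"]) simp
  next
    case 2
    obtain h where h: "hedges s (card V - 2) = h" by blast
    have uv: "u \<in> V" "v \<in> V" "u \<noteq> v" using 2(1) gd(5,6,7) by blast+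
    let ?r = "del_vertex v (del_vertex u r)"
    note g1 = arc_graph_del_vertex[OF g, of u]
    have "card r = card ?r + 2 * deg (del_vertex u r) v + 2 * deg r u"
      using card_del_vertex[OF g, of u] card_del_vertex[OF g1, of v] by simp
    moreover have "deg r v = deg (del_vertex u r) v + 1" using deg_del_vertex[OF g, of v u] 2(1) uv gd(4) by auto
    ultimately have "2 * hedges s (card V - 2) + 2 * Suc k \<le> card ?r"
      using e hedges_minus(2)[OF n] 2(2) unfolding h by arith
    moreover have "card (V - {u} - {v}) = card V - 2" using uv gd(1) by simp
    ultimately show ?thesis
      using arc_graph_del_vertex[OF g1, of v] del_vertex_subset[of v "del_vertex u r"] del_vertex_subset[of u r] n
      by (intro exI[of _ "V - {u} - {v}"] exI[of _ ?r]) (auto simp: subset_trans)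
  next
    case 3
    obtain h t where h: "hedges s (card V - 4) = h" "(if (b, b') \<in> r then 1 else 0 :: nat) = t" by blast
    have ab: "a \<in> V" "a' \<in> V" "b \<in> V" "b' \<in> V" "a \<noteq> a'" "a \<noteq> b" "a \<noteq> b'" "a' \<noteq> b" "a' \<noteq> b'" "b \<noteq> b'"
      using 3 gd(5,6,7) by blast+
    let ?r1 = "del_vertex a r"
    let ?r2 = "del_vertex a' ?r1"
    let ?r3 = "del_vertex b ?r2"
    let ?r = "del_vertex b' ?r3"
    note g1 = arc_graph_del_vertex[OF g, of a]
    note g2 = arc_graph_del_vertex[OF g1, of a']
    note g3 = arc_graph_del_vertex[OF g2, of b]
    note g4 = arc_graph_del_vertex[OF g3, of b']
    have c: "card r = card ?r + 2 * deg ?r3 b' + 2 * deg ?r2 b + 2 * deg ?r1 a' + 2 * deg r a"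
      using card_del_vertex[OF g, of a] card_del_vertex[OF g1, of a'] card_del_vertex[OF g2, of b] card_del_vertex[OF g3, of b'] by linarith
    have "(a', a) \<in> r" "(b, a) \<in> r" "(b, a') \<in> r" "(b', a) \<in> r" "(b', a') \<in> r" using 3 gd(4) by blast+
    moreover have "(b', b) \<in> r \<longleftrightarrow> (b, b') \<in> r" using gd(4) by blast
    ultimately have "deg r a' = deg ?r1 a' + 1" "deg r b = deg ?r1 b + 1" "deg ?r1 b = deg ?r2 b + 1"
      "deg r b' = deg ?r1 b' + 1" "deg ?r1 b' = deg ?r2 b' + 1" "deg ?r2 b' = deg ?r3 b' + (if (b, b') \<in> r then 1 else 0)"
      using deg_del_vertex[OF g, of a' a] deg_del_vertex[OF g, of b a] deg_del_vertex[OF g, of b' a]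
        deg_del_vertex[OF g1, of b a'] deg_del_vertex[OF g1, of b' a'] deg_del_vertex[OF g2, of b' b] ab
      by (auto simp: del_vertex_def)
    \<comment> \<open>The degree sum counts the five or six inner edges twice. Hence the four-set
      meets at most \<open>2 * card V + 2 * s - 5\<close> edges, one fewer than
      \<open>hedges\<close> loses.\<close>
    then have "2 * hedges s (card V - 4) + 2 * k + 2 \<le> card ?r"
      using e c hedges_minus(3)[OF n] 3(7) unfolding h by linarith
    moreover have "card (V - {a} - {a'} - {b} - {b'}) = card V - 4" using ab gd(1) by simp
    moreover have "?r \<subseteq> r" using del_vertex_subset by (metis subset_trans)
    ultimately show ?thesis
      using g4 n by (intro exI[of _ "V - {a} - {a'} - {b} - {b'}"] exI[of _ ?r]) auto
  qed
qed

text \<open>Each deletion step raises the surplus \<open>k\<close> by one and removes at most four vertices, so \<open>card V + 4 * k\<close> does not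
  decrease, while \<open>k\<close> is bounded once \<open>card V < N\<close>.\<close>

lemma no_surplus:
  assumes base: "\<And>V r. reduced s V r \<Longrightarrow> \<not> has_lollipop r l \<Longrightarrow> N \<le> card V \<Longrightarrow> card r \<le> 2 * hedges s (card (V :: 'a set))"
    and N: "s + 4 \<le> N" and N2: "N + 4 * N * N \<le> N2"
    and "arc_graph (V :: 'a set) r" "\<not> has_lollipop r l" "2 * hedges s (card V) + 2 * k \<le> card r" "k > 0" "N2 \<le> card V + 4 * k"
  shows False
  using assms(4-)
proof (induction "card V" arbitrary: V r k rule: less_induct)
  case less
  show False
  proof (cases "N \<le> card V")
    case False
    have "card r \<le> card (V \<times> V)" using less.prems(1) by (intro card_mono) (auto simp: arc_graph_def)
    also have "\<dots> = card V * card V" by (simp add: card_cartesian_product)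
    also have "\<dots> \<le> N * N" using False by (intro mult_mono) auto
    finally have "2 * k \<le> N * N" using less.prems(3) by linarith
    then show False using less.prems(5) N2 False by linarith
  next
    case True
    then have "\<not> reduced s V r" using base[of V r] less.prems by linarith
    then obtain V' r' where V': "arc_graph V' r'" "r' \<subseteq> r" "card V' < card V" "card V \<le> card V' + 4"
      "2 * hedges s (card V') + 2 * Suc k \<le> card r'"
      using not_reduced_step[OF less.prems(1) _ less.prems(3)] N True by (meson le_trans)
    show False
      by (rule less.hyps[OF V'(3,1) _ V'(5)]) (use less.prems V' has_lollipop_mono in auto)
  qed
qed

text \<open>A deletion from a graph that reaches the bound would leave a positive surplus, which
  \<open>no_surplus\<close> forbids on so many vertices.\<close>

lemma reduced_if_many_arcs:
  assumes base: "\<And>V r. reduced s V r \<Longrightarrow> \<not> has_lollipop r l \<Longrightarrow> N \<le> card V \<Longrightarrow> card r \<le> 2 * hedges s (card (V :: 'a set))"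
    and N: "s + 4 \<le> N"
    and g: "arc_graph (V :: 'a set) r" "\<not> has_lollipop r l" "2 * hedges s (card V) \<le> card r" "N + 4 * N * N \<le> card V"
  shows "reduced s V r"
proof (rule ccontr)
  assume "\<not> reduced s V r"
  then obtain V' r' where V': "arc_graph V' r'" "r' \<subseteq> r" "card V' < card V" "card V \<le> card V' + 4"
      "2 * hedges s (card V') + 2 * Suc 0 \<le> card r'"
    using not_reduced_step[OF g(1), of s 0] N g(3,4) by fastforce
  show False
    by (rule no_surplus[where N = N and s = s and l = l and  V = V' and r = r' and k = "Suc 0", OF base N order_refl]) (use V' g has_lollipop_mono in auto)
qed

section \<open>Triangles and light edges\<close>

lemma ex_not_in_small:
  assumes "finite S" "card S < card A"
  shows "\<exists>x\<in>A. x \<notin> S"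
  using assms by (meson card_mono not_le subsetI)

abbreviation codeg :: "('a \<times> 'a) set \<Rightarrow> 'a \<Rightarrow> 'a \<Rightarrow> nat" where
  "codeg r u v \<equiv> card (r `` {u} \<inter> r `` {v})"

lemma tchain_greedy:
  assumes g: "arc_graph V r" and M: "\<And>u v. (u, v) \<in> r \<Longrightarrow> M \<le> codeg r u v"
    and "(p, p') \<in> r" "finite S" "card S + 2 * m < M"
  shows "tchain r m p S"
  using assms(3-)
proof (induction m arbitrary: p p' S)
  case (Suc m)
  note gd = arc_graphD[OF g]
  \<comment> \<open>Only codegrees are bounded from below, so the edge \<open>pp'\<close> is what
    certifies that \<open>p\<close> has many neighbours.\<close>
  have "card S < codeg r p p'" using M[OF Suc.prems(1)] Suc.prems(3) by linarith
  then obtain q where q: "(p, q) \<in> r" "q \<notin> S" using ex_not_in_small[OF Suc.prems(2)] by blast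
  have "card (insert q S) < codeg r p q"
    using M[OF q(1)] Suc.prems(2,3) by (simp add: card_insert_if)
  then obtain w where w: "(p, w) \<in> r" "(q, w) \<in> r" "w \<notin> insert q S"
    using ex_not_in_small[of "insert q S"] Suc.prems(2) by blast
  have "card (insert q (insert w S)) \<le> card S + 2"
    using Suc.prems(2) by (simp add: card_insert_if)
  then have "tchain r m q (insert q (insert w S))"
    using Suc.prems gd(4)[OF q(1)] by (intro Suc.IH[of q p]) simp_all
  then show ?case using q w unfolding tchain.simps by (intro exI[of _ q] exI[of _ w] conjI) auto
qed simp

text \<open>A greedy choice has to avoid at most the six core vertices and the \<open>2 * l\<close>
  vertices of the chain, whence \<open>2 * l + 7\<close>.\<close>

lemma has_lollipop_if_codeg_ge:
  assumes g: "arc_graph V r" and M: "\<And>u v. (u, v) \<in> r \<Longrightarrow> 2 * l + 7 \<le> codeg r u v" and "r \<noteq> {}"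
  shows "has_lollipop r l"
proof -
  note gd = arc_graphD[OF g]
  have pick: "\<exists>w. (u, w) \<in> r \<and> (v, w) \<in> r \<and> w \<notin> set xs" if "(u, v) \<in> r" "length xs \<le> 5" for u v xs
    using M[OF that(1)] that(2) card_length[of xs] ex_not_in_small[of "set xs" "r `` {u} \<inter> r `` {v}"] by fastforce
  obtain x y where xy: "(x, y) \<in> r" using \<open>r \<noteq> {}\<close> by auto
  obtain z where z: "(x, z) \<in> r" "(y, z) \<in> r" using pick[OF xy, of "[]"] by auto
  obtain p where p: "(x, p) \<in> r" "(y, p) \<in> r" "p \<notin> set [x, y, z]" using pick[OF xy, of "[x, y, z]"] by auto
  obtain q where q: "(y, q) \<in> r" "(z, q) \<in> r" "q \<notin> set [x, y, z, p]" using pick[OF z(2), of "[x, y, z, p]"] by auto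
  obtain u where u: "(x, u) \<in> r" "(z, u) \<in> r" "u \<notin> set [x, y, z, p, q]" using pick[OF z(1), of "[x, y, z, p, q]"] by auto
  have "x \<noteq> y" "x \<noteq> z" "y \<noteq> z" using xy z gd(7) by auto
  then have "core r x y z p q u" using xy z p q u gd(4) by (auto simp: core_def)
  moreover have "card {x, y, z, p, q, u} \<le> 6" using card_length[of "[x, y, z, p, q, u]"] by simp
  then have "tchain r l z {x, y, z, p, q, u}"
    by (intro tchain_greedy[OF g M gd(4)[OF z(1)]]) auto
  ultimately show ?thesis unfolding has_lollipop_def by blast
qed

text \<open>Pairs are ordered: an edge in the neighbourhood of \<open>x\<close> counts twice, and
  summing over all \<open>x\<close> counts each triangle six times.\<close>

definition triangles_at :: "('a \<times> 'a) set \<Rightarrow> 'a \<Rightarrow> ('a \<times> 'a) set" where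
  "triangles_at r x = (SIGMA y : r `` {x}. r `` {x} \<inter> r `` {y})"

lemma card_triangles_at:
  assumes "arc_graph V r"
  shows "finite (triangles_at r x)" "card (triangles_at r x) = (\<Sum>y\<in>r `` {x}. codeg r x y)"
  using arc_graphD(3)[OF assms] by (auto simp: triangles_at_def)

lemma card_delete_edge:
  assumes g: "arc_graph V r" and uv: "(u, v) \<in> r" and M: "codeg r u v \<le> M"
  defines "r' \<equiv> r - {(u, v), (v, u)}"
  shows "arc_graph V r'" "card r = card r' + 2"
    "(\<Sum>x\<in>V. card (triangles_at r x)) \<le> (\<Sum>x\<in>V. card (triangles_at r' x)) + 6 * M"
proof -
  note gd = arc_graphD[OF g]
  have vu: "(v, u) \<in> r" "u \<noteq> v" using gd(4,7) uv by auto
  show g': "arc_graph V r'" using g by (auto simp: arc_graph_def r'_def sym_def irrefl_def)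
  have "card r' = card r - card {(u, v), (v, u)}"
    unfolding r'_def using uv vu gd(2) by (intro card_Diff_subset) auto
  moreover have "card {(u, v), (v, u)} \<le> card r" using uv vu gd(2) by (intro card_mono) auto
  ultimately show "card r = card r' + 2" using vu by auto
  let ?C = "r `` {u} \<inter> r `` {v}"
  let ?T = "Sigma V (triangles_at r)" and ?T' = "Sigma V (triangles_at r')"
  let ?U = "(\<lambda>z. (u, v, z)) ` ?C \<union> (\<lambda>z. (v, u, z)) ` ?C \<union> (\<lambda>z. (u, z, v)) ` ?C \<union> (\<lambda>z. (v, z, u)) ` ?C
      \<union> (\<lambda>z. (z, u, v)) ` ?C \<union> (\<lambda>z. (z, v, u)) ` ?C"
  have "?T \<subseteq> ?T' \<union> ?U"
  proof
    fix t assume "t \<in> ?T"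
    then obtain x y z where t: "t = (x, y, z)" "x \<in> V" "(x, y) \<in> r" "(x, z) \<in> r" "(y, z) \<in> r"
      by (auto simp: triangles_at_def)
    show "t \<in> ?T' \<union> ?U"
    proof (cases "(x, y) \<in> r' \<and> (x, z) \<in> r' \<and> (y, z) \<in> r'")
      case True
      then show ?thesis using t by (auto simp: triangles_at_def)
    next
      case False
      then have "(x, y) \<in> {(u, v), (v, u)} \<or> (x, z) \<in> {(u, v), (v, u)} \<or> (y, z) \<in> {(u, v), (v, u)}"
        using t unfolding r'_def by blast
      then have "t \<in> ?U"
        using t gd(4)[OF t(3)] gd(4)[OF t(4)] gd(4)[OF t(5)] by (elim disjE insertE emptyE) simp_all
      then show ?thesis by (rule UnI2)
    qed
  qed
  moreover have f: "finite ?T'" "finite ?C"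
    using gd(1,3) card_triangles_at(1)[OF g'] by auto
  ultimately have "card ?T \<le> card (?T' \<union> ?U)" by (intro card_mono) auto
  also have "\<dots> \<le> card ?T' + card ?U" by (rule card_Un_le)
  also have "card ?U \<le> 6 * card ?C"
  proof -
    have i: "card (h ` ?C) \<le> card ?C" for h :: "'a \<Rightarrow> 'a \<times> 'a \<times> 'a" using f(2) by (rule card_image_le)
    have "card (P1 \<union> P2 \<union> P3 \<union> P4 \<union> P5 \<union> P6) \<le> card P1 + card P2 + card P3 + card P4 + card P5 + card P6" for P1 P2 P3 P4 P5 P6 :: "('a \<times> 'a \<times> 'a) set"
      using card_Un_le[of P1 P2] card_Un_le[of "P1 \<union> P2" P3] card_Un_le[of "P1 \<union> P2 \<union> P3" P4]
        card_Un_le[of "P1 \<union> P2 \<union> P3 \<union> P4" P5] card_Un_le[of "P1 \<union> P2 \<union> P3 \<union> P4 \<union> P5" P6] by linarith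
    then have "card ?U \<le> card ((\<lambda>z. (u, v, z)) ` ?C) + card ((\<lambda>z. (v, u, z)) ` ?C) + card ((\<lambda>z. (u, z, v)) ` ?C)
      + card ((\<lambda>z. (v, z, u)) ` ?C) + card ((\<lambda>z. (z, u, v)) ` ?C) + card ((\<lambda>z. (z, v, u)) ` ?C)" .
    then show ?thesis
      using i[of "\<lambda>z. (u, v, z)"] i[of "\<lambda>z. (v, u, z)"] i[of "\<lambda>z. (u, z, v)"] i[of "\<lambda>z. (v, z, u)"]
        i[of "\<lambda>z. (z, u, v)"] i[of "\<lambda>z. (z, v, u)"] by linarith
  qed
  finally have "card ?T \<le> card ?T' + 6 * M" using M by simp
  moreover have "card ?T = (\<Sum>x\<in>V. card (triangles_at r x))"
    using gd(1) card_triangles_at(1)[OF g] by (intro card_SigmaI) auto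
  moreover have "card ?T' = (\<Sum>x\<in>V. card (triangles_at r' x))"
    using gd(1) card_triangles_at(1)[OF g'] by (intro card_SigmaI) auto
  ultimately show "(\<Sum>x\<in>V. card (triangles_at r x)) \<le> (\<Sum>x\<in>V. card (triangles_at r' x)) + 6 * M" by simp
qed

text \<open>As long as edges remain, one of them lies in at most \<open>2 * l + 7\<close> triangles.
  Deleting it removes two arcs and at most \<open>6 * (2 * l + 7)\<close> ordered triangles, that
  is, \<open>3 * (2 * l + 7)\<close> for each arc.\<close>

lemma few_triangles:
  assumes "arc_graph V r" "\<not> has_lollipop r l"
  shows "(\<Sum>x\<in>V. card (triangles_at r x)) \<le> 3 * (2 * l + 7) * card r"
  using assms
proof (induction "card r" arbitrary: r rule: less_induct)
  case less
  note gd = arc_graphD[OF less.prems(1)]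
  show ?case
  proof (cases "r = {}")
    case True
    then show ?thesis by (simp add: triangles_at_def)
  next
    case False
    then obtain u v where uv: "(u, v) \<in> r" "codeg r u v \<le> 2 * l + 7"
      using has_lollipop_if_codeg_ge[OF less.prems(1), of l] less.prems(2) by (meson linear)
    let ?r = "r - {(u, v), (v, u)}"
    note d = card_delete_edge[OF less.prems(1) uv]
    have "\<not> has_lollipop ?r l" using less.prems(2) has_lollipop_mono[of ?r l r] by blast
    then have "(\<Sum>x\<in>V. card (triangles_at ?r x)) \<le> 3 * (2 * l + 7) * card ?r"
      using d by (intro less.hyps) auto
    then show ?thesis using d(2,3) by (simp add: algebra_simps)
  qed
qed

text \<open>By averaging, at most an eighth of the vertices see more than
  \<open>24 * M * card V\<close> ordered triangles. Any other vertex \<open>a\<close> has at least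
  \<open>3 / 8\<close> of all vertices as neighbours outside this set; since
  \<open>64 * 3 / 8 = 24\<close>, the edges to them cannot all have codegree above
  \<open>64 * M\<close>.\<close>

lemma ex_light_edge:
  assumes g: "arc_graph V r" and F: "\<not> has_lollipop r l" and d: "\<And>v. v \<in> V \<Longrightarrow> card V \<le> 2 * deg r v"
    and "V \<noteq> {}" and M: "M = 2 * l + 7"
  shows "\<exists>a b. (a, b) \<in> r \<and> codeg r a b \<le> 64 * M \<and> card (triangles_at r a) \<le> 24 * M * card V \<and> card (triangles_at r b) \<le> 24 * M * card V"
proof -
  note gd = arc_graphD[OF g]
  let ?n = "card V" and ?t = "\<lambda>v. card (triangles_at r v)"
  define X where "X = {v \<in> V. 24 * M * ?n < ?t v}"
  have n: "?n > 0" using gd(1) \<open>V \<noteq> {}\<close> by (simp add: card_gt_0_iff)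
  have X: "X \<subseteq> V" "finite X" using gd(1) by (auto simp: X_def)
  have "card r \<le> ?n * ?n"
    using card_mono[of "V \<times> V" r] g by (auto simp: arc_graph_def card_cartesian_product)
  then have "3 * M * card r \<le> 3 * M * (?n * ?n)" by (rule mult_le_mono2)
  then have "(\<Sum>v\<in>V. ?t v) \<le> 3 * M * (?n * ?n)" using few_triangles[OF g F] unfolding M by linarith
  moreover have "card X * (24 * M * ?n) \<le> (\<Sum>v\<in>X. ?t v)"
    using sum_bounded_below[of X "24 * M * ?n" ?t] by (auto simp: X_def)
  moreover have "(\<Sum>v\<in>X. ?t v) \<le> (\<Sum>v\<in>V. ?t v)" using X gd(1) by (intro sum_mono2) auto
  ultimately have "card X * (24 * M * ?n) \<le> 3 * M * (?n * ?n)" by linarith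
  then have "(3 * M * ?n) * (8 * card X) \<le> (3 * M * ?n) * ?n" by (simp add: algebra_simps)
  then have cX: "8 * card X \<le> ?n" using n M by (subst (asm) mult_le_cancel1) auto
  then have "card X < card V" using n by linarith
  then obtain a where a: "a \<in> V" "a \<notin> X" using ex_not_in_small[OF X(2)] by blast
  have "\<exists>b\<in>r `` {a} - X. codeg r a b \<le> 64 * M"
  proof (rule ccontr)
    assume no: "\<not> ?thesis"
    have "card (r `` {a} - X) * (64 * M + 1) \<le> (\<Sum>b\<in>r `` {a} - X. codeg r a b)"
      using no sum_bounded_below[of "r `` {a} - X" "64 * M + 1" "codeg r a"] by force
    also have "\<dots> \<le> ?t a" unfolding card_triangles_at(2)[OF g] using gd(3) by (intro sum_mono2) auto
    also have "\<dots> \<le> 24 * M * ?n" using a by (auto simp: X_def)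
    finally have le: "card (r `` {a} - X) * (64 * M + 1) \<le> 24 * M * ?n" .
    have "deg r a \<le> card (r `` {a} - X) + card X" using gd(3) X(2)
      by (metis add.commute card_Un_disjoint card_mono diff_card_le_card_Diff le_diff_conv)
    then have "3 * ?n \<le> 8 * card (r `` {a} - X)" using d[OF a(1)] cX by linarith
    then have "3 * ?n * (64 * M + 1) \<le> 8 * card (r `` {a} - X) * (64 * M + 1)" by (rule mult_le_mono1)
    then have "3 * ?n * (64 * M + 1) \<le> 8 * (24 * M * ?n)" using le by linarith
    then show False using n by (simp add: algebra_simps)
  qed
  then obtain b where b: "(a, b) \<in> r" "b \<notin> X" "codeg r a b \<le> 64 * M" by auto
  then show ?thesis using a gd(6)[OF b(1)] by (intro exI[of _ a] exI[of _ b]) (auto simp: X_def)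
qed

section \<open>Cherries in one side\<close>

lemma codeg_ge:
  assumes g: "arc_graph V r"
  shows "deg r u + deg r v \<le> codeg r u v + card V"
proof -
  note gd = arc_graphD[OF g]
  have "card (r `` {u} \<union> r `` {v}) \<le> card V" using gd(1,8) by (intro card_mono) auto
  then show ?thesis using card_Un_Int[OF gd(3) gd(3), of "{u}" "{v}"] by linarith
qed

text \<open>Inclusion-exclusion turns degree sums into codegrees. The point of the four-set
  condition is that \<open>ab\<close> and \<open>a'b'\<close> together have at least one common
  neighbour more than two applications of the edge condition give.\<close>

lemma reducedD:
  assumes "reduced s V r"
  shows "arc_graph V r" "v \<in> V \<Longrightarrow> card V + s \<le> 2 * deg r v + 1"
    "(u, v) \<in> r \<Longrightarrow> s \<le> codeg r u v"
    "(a, a') \<in> r \<Longrightarrow> (a, b) \<in> r \<Longrightarrow> (a, b') \<in> r \<Longrightarrow> (a', b) \<in> r \<Longrightarrow> (a', b') \<in> r \<Longrightarrow> b \<noteq> b' \<Longrightarrow>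
      2 * s + 1 + (if (b, b') \<in> r then 1 else 0) \<le> codeg r a b + codeg r a' b'"
proof -
  show g: "arc_graph V r" using assms by (simp add: reduced_def)
  show "v \<in> V \<Longrightarrow> card V + s \<le> 2 * deg r v + 1" using assms by (simp add: reduced_def)
  show "(u, v) \<in> r \<Longrightarrow> s \<le> codeg r u v" using assms codeg_ge[OF g, of u v] by (fastforce simp: reduced_def)
  assume a: "(a, a') \<in> r" "(a, b) \<in> r" "(a, b') \<in> r" "(a', b) \<in> r" "(a', b') \<in> r" "b \<noteq> b'"
  have "2 * card V + 2 * s + 1 + (if (b, b') \<in> r then 1 else 0) \<le> deg r a + deg r a' + deg r b + deg r b'"
    using assms a unfolding reduced_def by blast
  then show "2 * s + 1 + (if (b, b') \<in> r then 1 else 0) \<le> codeg r a b + codeg r a' b'"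
    using codeg_ge[OF g, of a b] codeg_ge[OF g, of a' b'] by linarith
qed

lemma ex_common_neighbour:
  assumes "finite B" "finite X" "\<And>x. x \<in> X \<Longrightarrow> card (B - r `` {x}) \<le> D" "finite S" "card S + card X * D < card B"
  shows "\<exists>b\<in>B. b \<notin> S \<and> (\<forall>x\<in>X. (x, b) \<in> r)"
proof -
  let ?U = "\<Union>x\<in>X. B - r `` {x}"
  have "card ?U \<le> (\<Sum>x\<in>X. card (B - r `` {x}))" using assms(2) by (rule card_UN_le)
  also have "\<dots> \<le> card X * D" using assms(3) sum_bounded_above[of X "\<lambda>x. card (B - r `` {x})" D] by simp
  finally have "card (S \<union> ?U) < card B" using card_Un_le[of S ?U] assms(5) by linarith
  moreover have "finite (S \<union> ?U)" using assms by auto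
  ultimately obtain b where "b \<in> B" "b \<notin> S \<union> ?U" using ex_not_in_small by metis
  then show ?thesis by blast
qed

definition cherry_in :: "('a \<times> 'a) set \<Rightarrow> 'a set \<Rightarrow> 'a \<Rightarrow> 'a \<Rightarrow> 'a \<Rightarrow> bool" where
  "cherry_in r A q c q' \<longleftrightarrow> q \<in> A \<and> c \<in> A \<and> q' \<in> A \<and> q \<noteq> q' \<and> (c, q) \<in> r \<and> (c, q') \<in> r"

text \<open>Each cherry carries two triangles: the chain goes from \<open>b\<close> to the centre
  \<open>c\<close> with private vertex \<open>q\<close>, and from \<open>c\<close> to a new
  \<open>b'\<close> with private vertex \<open>q'\<close>. To enter the next cherry,
  \<open>b'\<close> must also see its centre and one of its ends, so common neighbours of four
  vertices are needed, whence \<open>4 * D\<close>.\<close>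

lemma tchain_cherries:
  assumes g: "arc_graph V r" and fin: "finite B" and AB: "A \<inter> B = {}"
    and D: "\<And>a. a \<in> A \<Longrightarrow> card (B - r `` {a}) \<le> D" and cB: "L + 4 * D < card B"
    and rob: "\<And>S. finite S \<Longrightarrow> card S \<le> L \<Longrightarrow> \<exists>q c q'. cherry_in r (A - S) q c q'"
    and "cherry_in r (A - S) q c q'" "(c, b) \<in> r" "(q, b) \<in> r" "finite S" "card S + 2 * m + 6 \<le> L"
  shows "tchain r m b S"
  using assms(7-)
proof (induction m arbitrary: S q c q' b rule: less_induct)
  case (less m)
  note gd = arc_graphD[OF g]
  have ch: "q \<in> A" "c \<in> A" "q' \<in> A" "q \<notin> S" "c \<notin> S" "q' \<notin> S" "q \<noteq> q'" "(c, q) \<in> r" "(c, q') \<in> r"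
    using less.prems(1) by (auto simp: cherry_in_def)
  then have ne: "c \<noteq> q" "c \<noteq> q'" using gd(7) by auto
  note sym = gd(4)[OF less.prems(2)] gd(4)[OF less.prems(3)]
  consider "m = 0" | "m = 1" | m' where "m = Suc (Suc m')" by (metis One_nat_def not0_implies_Suc)
  then show ?case
  proof cases
    case 2
    then show ?thesis using ch ne sym by (auto simp: One_nat_def)
  next
    case 3
    let ?S = "insert c (insert q (insert q' S))"
    have cS: "finite ?S" "card ?S \<le> card S + 3" using less.prems(4) by (auto simp: card_insert_if)
    then obtain q2 c2 q2' where ch2: "cherry_in r (A - ?S) q2 c2 q2'" using rob[of ?S] less.prems(5) by auto
    have "card {c, q', q2, c2} \<le> 4" using card_length[of "[c, q', q2, c2]"] by simp
    then have "card ?S + card {c, q', q2, c2} * D < card B"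
      using cS cB less.prems(5) mult_le_mono1[of "card {c, q', q2, c2}" 4 D] by linarith
    moreover have "card (B - r `` {x}) \<le> D" if "x \<in> {c, q', q2, c2}" for x
      using that ch ch2 by (intro D) (auto simp: cherry_in_def)
    ultimately obtain b' where b': "b' \<in> B" "b' \<notin> ?S" "(c, b') \<in> r" "(q', b') \<in> r" "(q2, b') \<in> r" "(c2, b') \<in> r"
      using ex_common_neighbour[of B "{c, q', q2, c2}" r D ?S] fin cS by auto
    let ?S2 = "insert b' (insert q' (insert c (insert q S)))"
    have "tchain r m' b' ?S2"
    proof (rule less.IH[of m' ?S2 q2 c2 q2' b'])
      show "cherry_in r (A - ?S2) q2 c2 q2'" using ch2 b'(1) AB by (auto simp: cherry_in_def)
      have "card ?S2 \<le> card S + 4" using less.prems(4) by (simp add: card_insert_if)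
      then show "card ?S2 + 2 * m' + 6 \<le> L" using less.prems(5) 3 by linarith
    qed (use b' 3 less.prems(4) in auto)
    moreover have "b' \<noteq> q'" "b' \<notin> insert c (insert q S)" "q' \<notin> insert c (insert q S)" using b'(2) ne ch by auto
    ultimately have "tchain r (Suc m') c (insert c (insert q S))"
      unfolding tchain.simps using b'(3) ch(9) gd(4)[OF b'(4)]
      by (intro exI[of _ b'] exI[of _ q'] conjI) auto
    then show ?thesis unfolding 3 tchain.simps(2)[of _ "Suc m'"] using ch ne sym
      by (intro exI[of _ c] exI[of _ q] conjI) auto
  qed simp
qed

lemma ex_two_distinct:
  assumes "finite Z" "finite Z'" "Z \<noteq> {}" "Z' \<noteq> {}" "\<not> (card Z \<le> 1 \<and> card Z' \<le> 1)"
  shows "\<exists>z\<in>Z. \<exists>z'\<in>Z'. z \<noteq> z'"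
proof (rule ccontr)
  assume no: "\<not> ?thesis"
  obtain z z' where z: "z \<in> Z" "z' \<in> Z'" using assms(3,4) by blast
  have "\<forall>x\<in>Z. \<forall>y\<in>Z'. x = y" using no by simp
  then have "Z \<subseteq> {z'}" "Z' \<subseteq> {z}" using z by auto
  then have "card Z \<le> 1" "card Z' \<le> 1" using card_mono[of "{z'}" Z] card_mono[of "{z}" Z'] by simp_all
  then show False using assms(5) by simp
qed

text \<open>The core sits on a triangle \<open>aa'b\<close> with \<open>aa'\<close> inside
  \<open>A\<close>. The edge condition alone would allow \<open>ab\<close> and \<open>a'b\<close> to
  share their only further common neighbour. The four-set condition at two candidates
  \<open>b1\<close>, \<open>b2\<close> gives codegrees with sum at least 5, so for one of them
  distinct private vertices \<open>z\<close> and \<open>z'\<close> exist.\<close>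

lemma has_lollipop_if_many_cherries:
  assumes red: "reduced s V r" and s: "2 \<le> s" and fin: "finite B" and AB: "A \<inter> B = {}"
    and D: "\<And>a. a \<in> A \<Longrightarrow> card (B - r `` {a}) \<le> D" and cB: "2 * l + 30 + 12 * D < card B"
    and rob: "\<And>S. finite S \<Longrightarrow> card S \<le> 2 * l + 12 \<Longrightarrow> \<exists>q c q'. cherry_in r (A - S) q c q'"
  shows "has_lollipop r l"
proof -
  note g = reducedD(1)[OF red]
  note gd = arc_graphD[OF g]
  have pick: "\<exists>q c q'. cherry_in r (A - set xs) q c q'" if "length xs \<le> 9" for xs
    using rob[of "set xs"] card_length[of xs] that by simp
  obtain a' a q0 where ch0: "cherry_in r (A - {}) a' a q0" using pick[of "[]"] by auto
  \<comment> \<open>Three disjoint cherries are kept in reserve: \<open>z\<close> and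
    \<open>z'\<close> cannot be controlled, but they spoil at most two of them. The later
    \<open>b\<close> is adjacent to all three centres, so the chain can start with any
    survivor.\<close>
  obtain q1 c1 q1' where ch1: "cherry_in r (A - set [a, a']) q1 c1 q1'" using pick[of "[a, a']"] by auto
  obtain q2 c2 q2' where ch2: "cherry_in r (A - set [a, a', q1, c1, q1']) q2 c2 q2'" using pick[of "[a, a', q1, c1, q1']"] by auto
  obtain q3 c3 q3' where ch3: "cherry_in r (A - set [a, a', q1, c1, q1', q2, c2, q2']) q3 c3 q3'"
    using pick[of "[a, a', q1, c1, q1', q2, c2, q2']"] by auto
  have aa: "(a, a') \<in> r" "(a', a) \<in> r" "a \<in> A" "a' \<in> A" "a \<noteq> a'" using ch0 gd(4,7) by (auto simp: cherry_in_def)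
  let ?X = "{a, a', q1, c1, q2, c2, q3, c3}"
  have XA: "?X \<subseteq> A" using ch1 ch2 ch3 aa by (auto simp: cherry_in_def)
  have X8: "card ?X * D \<le> 8 * D" using card_length[of "[a, a', q1, c1, q2, c2, q3, c3]"] by (intro mult_le_mono1) simp
  have common: "\<exists>b\<in>B. b \<notin> set xs \<and> (\<forall>x\<in>?X. (x, b) \<in> r)" if "length xs \<le> 9" for xs
  proof (rule ex_common_neighbour[OF fin])
    show "card (set xs) + card ?X * D < card B" using that card_length[of xs] X8 cB by linarith
    show "card (B - r `` {x}) \<le> D" if "x \<in> ?X" for x using that XA D by blast
  qed simp_all
  obtain b1 where b1: "b1 \<in> B" "\<And>x. x \<in> ?X \<Longrightarrow> (x, b1) \<in> r" using common[of "[]"] by auto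
  obtain b2 where b2: "b2 \<in> B" "b2 \<noteq> b1" "\<And>x. x \<in> ?X \<Longrightarrow> (x, b2) \<in> r" using common[of "[b1]"] by auto
  define Z where "Z = (\<lambda>b. r `` {a} \<inter> r `` {b} - {a'})"
  define Z' where "Z' = (\<lambda>b. r `` {a'} \<inter> r `` {b} - {a})"
  have finZ: "finite (Z b)" "finite (Z' b)" for b using gd(3) by (auto simp: Z_def Z'_def)
  have cZ: "codeg r a b \<le> card (Z b) + 1" "codeg r a' b \<le> card (Z' b) + 1" for b
    unfolding Z_def Z'_def using gd(3) by (metis card_Diff_singleton_if diff_le_self le_diff_conv le_add1 order_refl finite_Int)+
  have ne: "Z b \<noteq> {}" "Z' b \<noteq> {}" if "(a, b) \<in> r" "(a', b) \<in> r" for b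
    using reducedD(3)[OF red that(1)] reducedD(3)[OF red that(2)] cZ[of b] s by force+
  have "\<exists>b\<in>{b1, b2}. \<not> (card (Z b) \<le> 1 \<and> card (Z' b) \<le> 1)"
  proof (rule ccontr)
    assume "\<not> ?thesis"
    then have "codeg r a b1 \<le> 2" "codeg r a' b2 \<le> 2" using cZ[of b1] cZ[of b2] by auto
    moreover have "2 * s + 1 \<le> codeg r a b1 + codeg r a' b2"
      using reducedD(4)[OF red aa(1) b1(2)[of a] b2(3)[of a] b1(2)[of a'] b2(3)[of a']] b2(2) by auto
    ultimately show False using s by linarith
  qed
  then obtain b where b: "b \<in> B" "\<And>x. x \<in> ?X \<Longrightarrow> (x, b) \<in> r" "\<not> (card (Z b) \<le> 1 \<and> card (Z' b) \<le> 1)"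
    using b1 b2 by blast
  then obtain z z' where z: "z \<in> Z b" "z' \<in> Z' b" "z \<noteq> z'"
    using ex_two_distinct[OF finZ ne] by blast
  obtain d where d: "d \<in> B" "d \<notin> {b, z, z'}" "(a, d) \<in> r" "(a', d) \<in> r" using common[of "[b, z, z']"] by auto
  have ab: "a \<noteq> b" "a' \<noteq> b" "a \<noteq> d" "a' \<noteq> d" using aa(3,4) b(1) d(1) AB by auto
  have zz: "(a, z) \<in> r" "(b, z) \<in> r" "z \<noteq> a'" "(a', z') \<in> r" "(b, z') \<in> r" "z' \<noteq> a" using z by (auto simp: Z_def Z'_def)
  then have "z \<noteq> a" "z \<noteq> b" "z' \<noteq> a'" "z' \<noteq> b" using gd(7) by auto
  then have core: "core r a a' b d z' z"
    unfolding core_def using aa ab d zz z(3) b(2)[of a] b(2)[of a'] gd(4)[OF b(2)[of a]] by auto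
  let ?S = "{a, a', b, d, z', z}"
  have "\<exists>q c q'. cherry_in r (A - ?S) q c q' \<and> c \<in> ?X \<and> q \<in> ?X"
  proof -
    have dis: "{q1, c1, q1'} \<inter> {q2, c2, q2'} = {}" "{q1, c1, q1'} \<inter> {q3, c3, q3'} = {}" "{q2, c2, q2'} \<inter> {q3, c3, q3'} = {}"
      using ch2 ch3 by (auto simp: cherry_in_def)
    have "b \<notin> A" "d \<notin> A" using b(1) d(1) AB by auto
    then have fr: "cherry_in r (A - ?S) q c q'" if "cherry_in r (A - set (a # a' # xs)) q c q'" "{q, c, q'} \<inter> {z, z'} = {}" for q c q' xs
      using that by (auto simp: cherry_in_def)
    consider "{q1, c1, q1'} \<inter> {z, z'} = {}" | "{q2, c2, q2'} \<inter> {z, z'} = {}" | "{q3, c3, q3'} \<inter> {z, z'} = {}"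
      using dis by blast
    then show ?thesis
    proof cases
      case 1
      then show ?thesis using fr[OF ch1] by blast
    next
      case 2
      then show ?thesis using fr[OF ch2] by blast
    next
      case 3
      then show ?thesis using fr[OF ch3] by blast
    qed
  qed
  then obtain q c q' where ch: "cherry_in r (A - ?S) q c q'" "c \<in> ?X" "q \<in> ?X" by blast
  have "card ?S \<le> 6" using card_length[of "[a, a', b, d, z', z]"] by simp
  have "tchain r l b ?S"
  proof (rule tchain_cherries[OF g fin AB D _ rob ch(1) b(2)[OF ch(2)] b(2)[OF ch(3)]])
    show "2 * l + 12 + 4 * D < card B" using cB by linarith
    show "card ?S + 2 * l + 6 \<le> 2 * l + 12" using \<open>card ?S \<le> 6\<close> by linarith
  qed simp_all
  then show ?thesis using core unfolding has_lollipop_def by blast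
qed

section \<open>Near-bipartite structure\<close>

lemma few_high_degree:
  assumes g: "arc_graph V r" and A: "A \<subseteq> r `` {b}" and t: "card (triangles_at r b) \<le> k * n" and "n > 0"
  shows "card {x \<in> A. n < 100 * card (r `` {x} \<inter> A)} \<le> 100 * k"
proof -
  note gd = arc_graphD[OF g]
  let ?H = "{x \<in> A. n < 100 * card (r `` {x} \<inter> A)}"
  have fin: "finite A" "finite ?H" using A gd(3) by (auto intro: finite_subset)
  have "card ?H * n \<le> (\<Sum>x\<in>?H. 100 * card (r `` {x} \<inter> A))"
    using sum_bounded_below[of ?H n "\<lambda>x. 100 * card (r `` {x} \<inter> A)"] by auto
  also have "\<dots> \<le> (\<Sum>x\<in>A. 100 * card (r `` {x} \<inter> A))" using fin by (intro sum_mono2) auto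
  also have "\<dots> = 100 * card (SIGMA x : A. r `` {x} \<inter> A)" using fin by (simp add: sum_distrib_left)
  also have "card (SIGMA x : A. r `` {x} \<inter> A) \<le> card (triangles_at r b)"
    using A card_triangles_at(1)[OF g, of b] by (intro card_mono) (auto simp: triangles_at_def)
  also have "\<dots> \<le> k * n" by (rule t)
  finally have "card ?H * n \<le> (100 * k) * n" by simp
  then show ?thesis using \<open>n > 0\<close> by simp
qed

text \<open>At least half of all vertices are neighbours of \<open>x\<close>, and \<open>B\<close>
  is hardly larger than half. So apart from the excess \<open>c\<close>, every missed vertex of
  \<open>B\<close> is paid for by a neighbour of \<open>x\<close> in \<open>A\<close> or
  \<open>W\<close>.\<close>

lemma miss_bound:
  assumes g: "arc_graph V r" and V: "V = A \<union> B \<union> W" and d: "card V \<le> 2 * deg r x" and B: "2 * card B \<le> card V + c"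
  shows "2 * card (B - r `` {x}) \<le> c + 2 * card (r `` {x} \<inter> A) + 2 * card W"
proof -
  note gd = arc_graphD[OF g]
  have fin: "finite A" "finite B" "finite W" using V gd(1) by auto
  have "r `` {x} \<subseteq> (r `` {x} \<inter> A) \<union> (r `` {x} \<inter> B) \<union> W" using V gd(8)[of "{x}"] by blast
  then have "deg r x \<le> card ((r `` {x} \<inter> A) \<union> (r `` {x} \<inter> B) \<union> W)" using fin by (intro card_mono) auto
  also have "\<dots> \<le> card (r `` {x} \<inter> A) + card (r `` {x} \<inter> B) + card W"
    using card_Un_le[of "(r `` {x} \<inter> A) \<union> (r `` {x} \<inter> B)" W] card_Un_le[of "r `` {x} \<inter> A" "r `` {x} \<inter> B"] by linarith
  finally have "deg r x \<le> card (r `` {x} \<inter> A) + card (r `` {x} \<inter> B) + card W" .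
  moreover have "card B = card (B - r `` {x}) + card (r `` {x} \<inter> B)"
    using fin by (metis Int_commute card_Diff_subset_Int card_mono finite_Int inf_le1 le_add_diff_inverse2)
  ultimately show ?thesis using d B by linarith
qed

lemma no_cherry_degree:
  assumes "arc_graph V r" "\<not> (\<exists>q c q'. cherry_in r A q c q')" "a \<in> A"
  shows "card (r `` {a} \<inter> A) \<le> 1"
proof (rule ccontr)
  assume "\<not> ?thesis"
  then have "\<not> card (r `` {a} \<inter> A) \<le> Suc 0" by simp
  then obtain q q' where "q \<in> r `` {a} \<inter> A" "q' \<in> r `` {a} \<inter> A" "q \<noteq> q'"
    using card_le_Suc0_iff_eq[of "r `` {a} \<inter> A"] arc_graphD(3)[OF assms(1), of "{a}"] by auto
  then show False using assms by (auto simp: cherry_in_def)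
qed

definition bip_structure :: "nat \<Rightarrow> 'a set \<Rightarrow> ('a \<times> 'a) set \<Rightarrow> 'a set \<Rightarrow> 'a set \<Rightarrow> 'a set \<Rightarrow> bool" where
  "bip_structure C V r A B W \<longleftrightarrow> V = A \<union> B \<union> W \<and> A \<inter> B = {} \<and> (A \<union> B) \<inter> W = {} \<and> card W \<le> C \<and>
     (\<forall>a\<in>A. card (r `` {a} \<inter> A) \<le> 1) \<and> (\<forall>b\<in>B. card (r `` {b} \<inter> B) \<le> 1) \<and>
     (\<forall>a\<in>A. card (B - r `` {a}) \<le> C) \<and> (\<forall>b\<in>B. card (A - r `` {b}) \<le> C) \<and>
     card V \<le> 4 * card A \<and> card V \<le> 4 * card B"

text \<open>At this stage the inner degrees are bounded only by \<open>card V / 100\<close>, so the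
  missing degrees are linear, at most \<open>card V div 50\<close>. This suffices, because
  \<open>12 / 50\<close> is less than the fraction \<open>2 / 5\<close> of the vertices that
  \<open>B\<close> contains.\<close>

lemma cherry_free_part:
  assumes red: "reduced s V r" and F: "\<not> has_lollipop r l" and s: "2 \<le> s"
    and V: "V = A \<union> B \<union> W" "A \<inter> B = {}" "B \<inter> W = {}" and deg: "\<And>v. v \<in> V \<Longrightarrow> card V \<le> 2 * deg r v"
    and B: "2 * card B \<le> card V + c" and W: "card W \<le> w" and hi: "\<And>a. a \<in> A \<Longrightarrow> 100 * card (r `` {a} \<inter> A) \<le> card V"
    and big: "400 * (2 * l + 31 + c + 2 * w) \<le> card V" and Bbig: "2 * card V \<le> 5 * card B"
  shows "\<exists>S. finite S \<and> card S \<le> 2 * l + 12 \<and> (\<forall>a\<in>A - S. card (r `` {a} \<inter> (A - S)) \<le> 1)"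
proof (rule ccontr)
  assume no: "\<not> ?thesis"
  note g = reducedD(1)[OF red]
  have "has_lollipop r l"
  proof (rule has_lollipop_if_many_cherries[OF red s _ V(2)])
    show "finite B" using arc_graphD(1)[OF g] V(1) by simp
    show "card (B - r `` {a}) \<le> card V div 50" if "a \<in> A" for a
    proof -
      have "2 * card (B - r `` {a}) \<le> c + 2 * card (r `` {a} \<inter> A) + 2 * card W"
        using miss_bound[OF g V(1) deg B] that V(1) by blast
      then have "100 * card (B - r `` {a}) \<le> 50 * (c + 2 * w) + card V" using hi[OF that] W by (simp add: algebra_simps)
      moreover have "50 * (c + 2 * w) \<le> card V" using big by (simp add: algebra_simps)
      ultimately show ?thesis by linarith
    qed
    have "50 * (card V div 50) \<le> card V" by simp
    then show "2 * l + 30 + 12 * (card V div 50) < card B" using Bbig big by (simp add: algebra_simps)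
    show "\<exists>q c q'. cherry_in r (A - S) q c q'" if "finite S" "card S \<le> 2 * l + 12" for S
      using no no_cherry_degree[OF g, of "A - S"] that by blast
  qed
  then show False using F by blast
qed

lemma ex_bip_structure:
  assumes s: "2 \<le> s"
  shows "\<exists>C N. \<forall>(V :: 'a set) r. reduced s V r \<longrightarrow> \<not> has_lollipop r l \<longrightarrow> N \<le> card V \<longrightarrow> (\<exists>A B W. bip_structure C V r A B W)"
proof -
  define M where "M = 2 * l + 7"
  \<comment> \<open>\<open>128 * M\<close> bounds the vertices outside
    \<open>A0 \<union> B0\<close>, and \<open>4800 * M = 2 * (100 * (24 * M))\<close> the vertices
    of high inner degree in the two sides.\<close>
  define w where "w = 128 * M + 4800 * M"
  define C where "C = 2 * (w + 4 * l + 24) + 128 * M + 2"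
  define N where "N = 400 * (2 * l + 31 + 128 * M + 2 * w) + 4 * C"
  have "\<exists>A B W. bip_structure C V r A B W" if red: "reduced s V r" and F: "\<not> has_lollipop r l" and N: "N \<le> card V" for V :: "'a set" and r
  proof -
    note g = reducedD(1)[OF red]
    note gd = arc_graphD[OF g]
    let ?n = "card V"
    have n: "?n > 0" using N by (simp add: N_def)
    have deg: "?n \<le> 2 * deg r v" if "v \<in> V" for v using reducedD(2)[OF red that] s by linarith
    have "V \<noteq> {}" using n by auto
    then obtain a b where ab: "(a, b) \<in> r" "codeg r a b \<le> 64 * M"
      "card (triangles_at r a) \<le> 24 * M * ?n" "card (triangles_at r b) \<le> 24 * M * ?n"
      using ex_light_edge[OF g F deg _ M_def] by blast
    have abV: "a \<in> V" "b \<in> V" using gd(5,6) ab(1) by auto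
    \<comment> \<open>Edges inside \<open>A0\<close> form triangles with \<open>b\<close>, and edges
      inside \<open>B0\<close> form triangles with \<open>a\<close>, so both sides are
      sparse.\<close>
    define A0 where "A0 = r `` {b} - r `` {a}"
    define B0 where "B0 = r `` {a} - r `` {b}"
    have AB0: "A0 \<inter> B0 = {}" "A0 \<subseteq> V" "B0 \<subseteq> V" using gd(8) by (auto simp: A0_def B0_def)
    have cA0: "card A0 + codeg r a b = deg r b" "card B0 + codeg r a b = deg r a"
      unfolding A0_def B0_def using gd(3) by (metis Int_commute add.commute card_Diff_subset_Int card_mono finite_Int inf_le1 le_add_diff_inverse)+
    have finAB0: "finite A0" "finite B0" using AB0 gd(1) by (auto intro: finite_subset)
    have "card (A0 \<union> B0) = card A0 + card B0" using finAB0 AB0(1) by (rule card_Un_disjoint)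
    moreover have "card (A0 \<union> B0) \<le> ?n" using AB0 gd(1) by (intro card_mono) auto
    ultimately have ub: "card A0 + card B0 \<le> ?n" by simp
    have lb: "?n \<le> 2 * card A0 + 128 * M" "?n \<le> 2 * card B0 + 128 * M"
      using cA0 deg[OF abV(1)] deg[OF abV(2)] ab(2) by linarith+
    define HA where "HA = {x \<in> A0. ?n < 100 * card (r `` {x} \<inter> A0)}"
    define HB where "HB = {x \<in> B0. ?n < 100 * card (r `` {x} \<inter> B0)}"
    have H: "card HA \<le> 2400 * M" "card HB \<le> 2400 * M" "HA \<subseteq> A0" "HB \<subseteq> B0"
      using few_high_degree[OF g _ ab(4) n, of A0] few_high_degree[OF g _ ab(3) n, of B0]
      by (auto simp: HA_def HB_def A0_def B0_def)
    define A1 where "A1 = A0 - HA"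
    define B1 where "B1 = B0 - HB"
    define W1 where "W1 = V - (A1 \<union> B1)"
    have fin1: "finite HA" "finite HB" "finite A1" "finite B1" "A1 \<subseteq> V" "B1 \<subseteq> V"
      using H finAB0 AB0 by (auto simp: A1_def B1_def intro: finite_subset)
    have c1: "card A1 + card HA = card A0" "card B1 + card HB = card B0"
      unfolding A1_def B1_def using H fin1 finAB0 by (simp_all add: card_Diff_subset card_mono)
    have "card W1 + card (A1 \<union> B1) = ?n" unfolding W1_def using fin1 gd(1) by (simp add: card_Diff_subset card_mono)
    moreover have "card (A1 \<union> B1) = card A1 + card B1"
      using fin1 AB0(1) by (intro card_Un_disjoint) (auto simp: A1_def B1_def)
    ultimately have W1: "card W1 \<le> w" using lb c1 H by (simp add: w_def)
    have V1: "V = A1 \<union> B1 \<union> W1" "V = B1 \<union> A1 \<union> W1" "A1 \<inter> B1 = {}" "B1 \<inter> A1 = {}" "B1 \<inter> W1 = {}" "A1 \<inter> W1 = {}"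
      using fin1 AB0(1) by (auto simp: W1_def A1_def B1_def)
    have ub1: "2 * card A1 \<le> ?n + 128 * M" "2 * card B1 \<le> ?n + 128 * M" using ub lb c1 by linarith+
    have lb1: "?n \<le> 2 * card A1 + w" "?n \<le> 2 * card B1 + w" using lb c1 H by (simp_all add: w_def)
    have hi: "100 * card (r `` {x} \<inter> A1) \<le> ?n" if "x \<in> A1" for x
    proof -
      have "card (r `` {x} \<inter> A1) \<le> card (r `` {x} \<inter> A0)" using finAB0 by (intro card_mono) (auto simp: A1_def)
      then show ?thesis using that by (auto simp: A1_def HA_def)
    qed
    have hi': "100 * card (r `` {x} \<inter> B1) \<le> ?n" if "x \<in> B1" for x
    proof -
      have "card (r `` {x} \<inter> B1) \<le> card (r `` {x} \<inter> B0)" using finAB0 by (intro card_mono) (auto simp: B1_def)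
      then show ?thesis using that by (auto simp: B1_def HB_def)
    qed
    have big: "400 * (2 * l + 31 + 128 * M + 2 * w) \<le> ?n" using N by (simp add: N_def)
    have Bbig: "2 * ?n \<le> 5 * card A1" "2 * ?n \<le> 5 * card B1" using lb1 big by (simp_all add: algebra_simps)
    obtain SA where SA: "finite SA" "card SA \<le> 2 * l + 12" "\<And>a. a \<in> A1 - SA \<Longrightarrow> card (r `` {a} \<inter> (A1 - SA)) \<le> 1"
      using cherry_free_part[OF red F s V1(1,3,5) deg ub1(2) W1 hi big Bbig(2)] by auto
    obtain SB where SB: "finite SB" "card SB \<le> 2 * l + 12" "\<And>a. a \<in> B1 - SB \<Longrightarrow> card (r `` {a} \<inter> (B1 - SB)) \<le> 1"
      using cherry_free_part[OF red F s V1(2,4,6) deg ub1(1) W1 hi' big Bbig(1)] by auto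
    define A where "A = A1 - SA"
    define B where "B = B1 - SB"
    define W where "W = V - (A \<union> B)"
    have "W \<subseteq> W1 \<union> SA \<union> SB" using V1(1) by (auto simp: W_def A_def B_def)
    then have "card W \<le> card (W1 \<union> SA \<union> SB)" using SA SB gd(1) by (intro card_mono) (auto simp: W1_def)
    also have "\<dots> \<le> card W1 + card SA + card SB" using card_Un_le[of "W1 \<union> SA" SB] card_Un_le[of W1 SA] by linarith
    finally have cW: "card W \<le> w + 4 * l + 24" using W1 SA SB by linarith
    have cAB: "card A1 \<le> card A + card SA" "card B1 \<le> card B + card SB"
      unfolding A_def B_def using SA(1) SB(1) diff_card_le_card_Diff[of SA A1] diff_card_le_card_Diff[of SB B1] by linarith+
    have "card A \<le> card A1" "card B \<le> card B1" using fin1 by (auto simp: A_def B_def intro: card_mono)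
    then have ub2: "2 * card A \<le> ?n + 128 * M" "2 * card B \<le> ?n + 128 * M" using ub1 by linarith+
    have V2: "V = A \<union> B \<union> W" "V = B \<union> A \<union> W" using fin1 by (auto simp: W_def A_def B_def)
    have i: "card (r `` {x} \<inter> A) \<le> 1" if "x \<in> A" for x using SA(3) that by (simp add: A_def)
    have i': "card (r `` {x} \<inter> B) \<le> 1" if "x \<in> B" for x using SB(3) that by (simp add: B_def)
    have "card (B - r `` {x}) \<le> C" if "x \<in> A" for x
    proof -
      have "x \<in> V" using that V2 by auto
      then show ?thesis using miss_bound[OF g V2(1) deg ub2(2), of x] i[OF that] cW by (simp add: C_def)
    qed
    moreover have "card (A - r `` {x}) \<le> C" if "x \<in> B" for x
    proof -
      have "x \<in> V" using that V2 by auto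
      then show ?thesis using miss_bound[OF g V2(2) deg ub2(1), of x] i'[OF that] cW by (simp add: C_def)
    qed
    moreover have "?n \<le> 4 * card A" "?n \<le> 4 * card B" using lb1 cAB SA(2) SB(2) big by (simp_all add: algebra_simps)
    moreover have "card W \<le> C" using cW by (simp add: C_def)
    moreover have "A \<inter> B = {}" "(A \<union> B) \<inter> W = {}" using V1 by (auto simp: A_def B_def W_def)
    ultimately have "bip_structure C V r A B W"
      unfolding bip_structure_def using V2(1) i i' by blast
    then show ?thesis by blast
  qed
  then show ?thesis by blast
qed

section \<open>Chains through apexes\<close>

text \<open>The constants \<open>l\<close> and \<open>D\<close> leave room for greedy choices avoiding the \<open>O(l)\<close> vertices used before.\<close>

definition apex_system :: "nat \<Rightarrow> nat \<Rightarrow> ('a \<times> 'a) set \<Rightarrow> 'a set \<Rightarrow> 'a set \<Rightarrow> 'a set \<Rightarrow> bool" where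
  "apex_system l D r X P Q \<longleftrightarrow> finite X \<and> finite P \<and> finite Q \<and> P \<inter> Q = {} \<and> X \<inter> (P \<union> Q) = {} \<and>
     (\<forall>x\<in>X. \<forall>p\<in>P \<union> Q. (x, p) \<in> r) \<and> (\<forall>p\<in>P. card (Q - r `` {p}) \<le> D) \<and> (\<forall>q\<in>Q. card (P - r `` {q}) \<le> D) \<and>
     4 * l + 40 + 4 * D < card P \<and> 4 * l + 40 + 4 * D < card Q"

text \<open>Vertices \<open>p\<close> of \<open>G\<close> from which a chain can be finished without a further apex; the gadget that finishes it uses \<open>T\<close>.\<close>

definition chain_ports :: "nat \<Rightarrow> ('a \<times> 'a) set \<Rightarrow> nat \<Rightarrow> 'a set \<Rightarrow> 'a set \<Rightarrow> bool" where
  "chain_ports l r m G T \<longleftrightarrow> 4 * l + 30 < card G \<and> finite T \<and> card T \<le> 3 \<and>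
     (\<forall>p\<in>G. \<forall>S. finite S \<longrightarrow> card S \<le> 4 * l + 20 \<longrightarrow> S \<inter> T = {} \<longrightarrow> tchain r m p S)"

lemma apex_system_swap: "apex_system l D r X P Q \<Longrightarrow> apex_system l D r X Q P"
  unfolding apex_system_def by (simp add: Int_commute Un_commute)

lemma chain_ports_trivial: "apex_system l D r X P Q \<Longrightarrow> chain_ports l r 0 P {}"
  by (simp add: chain_ports_def apex_system_def)

lemma apex_system_opposite:
  assumes ap: "apex_system l D r X P Q" and "p \<in> P \<union> Q" "finite S" "card S \<le> 4 * l + 30"
  shows "\<exists>w\<in>P \<union> Q. w \<notin> S \<and> (p, w) \<in> r"
proof -
  have "\<exists>w\<in>Q. w \<notin> S \<and> (p, w) \<in> r" if "apex_system l D r X P Q" "p \<in> P" for P Q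
    using ex_common_neighbour[of Q "{p}" r D S] that assms(3,4) by (auto simp: apex_system_def)
  from this[OF ap] this[OF apex_system_swap[OF ap]] show ?thesis using assms(2) by blast
qed

text \<open>Between consecutive apexes \<open>x\<close> and \<open>y\<close> the chain passes
  through a side vertex \<open>p\<close>, with triangles \<open>xpw\<close> and \<open>pyw'\<close>.
  Thus every apex of \<open>Y\<close> pays for two triangles and the first apex for one; the chain
  then stands at a port of \<open>G\<close>, which supplies the last \<open>m\<close>.\<close>

lemma tchain_apexes:
  assumes g: "arc_graph V r" and ap: "apex_system l D r X P Q" and GP: "G \<subseteq> P \<union> Q" and G: "chain_ports l r m G T"
    and "x \<in> X" "Y \<subseteq> X - {x}" "finite S" "card S + 4 * card Y + 2 \<le> 4 * l + 20" "S \<inter> (Y \<union> T) = {}" "X \<inter> T = {}"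
  shows "tchain r (2 * card Y + 1 + m) x S"
  using assms(5-)
proof (induction "card Y" arbitrary: x Y S)
  note gd = arc_graphD[OF g]
  have xp: "(x, p) \<in> r" "x \<noteq> p" if "x \<in> X" "p \<in> P \<union> Q" for x p using ap that by (auto simp: apex_system_def)
  have T: "finite T" "card T \<le> 3" using G by (auto simp: chain_ports_def)
  have opp: "\<exists>w\<in>P \<union> Q. w \<notin> S \<union> T \<and> (p, w) \<in> r" if "p \<in> P \<union> Q" "finite S" "card S \<le> 4 * l + 24" for p S
    using apex_system_opposite[OF ap that(1), of "S \<union> T"] that T card_Un_le[of S T] by auto
  {
    case 0
    have "card (S \<union> T) < card G" using 0 T card_Un_le[of S T] G by (simp add: chain_ports_def)
    then obtain p where p: "p \<in> G" "p \<notin> S \<union> T" using ex_not_in_small[of "S \<union> T" G] T 0 by auto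
    have cS: "card (insert p S) \<le> card S + 1" using 0 by (simp add: card_insert_if)
    then obtain w where w: "w \<in> P \<union> Q" "w \<notin> insert p S \<union> T" "(p, w) \<in> r"
      using opp[of p "insert p S"] p(1) GP 0 by auto
    have cS2: "card (insert p (insert w S)) \<le> card S + 2" using 0 by (simp add: card_insert_if)
    have "\<forall>S. finite S \<longrightarrow> card S \<le> 4 * l + 20 \<longrightarrow> S \<inter> T = {} \<longrightarrow> tchain r m p S"
      using G p(1) unfolding chain_ports_def by blast
    moreover have "insert p (insert w S) \<inter> T = {}" using p(2) w(2) 0 by auto
    ultimately have "tchain r m p (insert p (insert w S))" using cS2 0 by simp
    then show ?case
      using p w xp[OF 0(2)] GP 0(1) by (simp del: insert_iff) (intro exI[of _ p] exI[of _ w] conjI, auto)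
  next
    case (Suc j)
    then have finY: "finite Y" by (metis card.infinite nat.distinct(1))
    obtain y where y: "y \<in> Y" using Suc(2) by fastforce
    have j: "card (Y - {y}) = j" using y finY Suc(2) by simp
    have cS: "card S + 4 * j + 6 \<le> 4 * l + 20" using Suc(2,6) by simp
    have "card (S \<union> T) < card P" using cS T card_Un_le[of S T] ap by (simp add: apex_system_def)
    then obtain p where p: "p \<in> P" "p \<notin> S \<union> T" using ex_not_in_small[of "S \<union> T" P] T Suc by auto
    have "card (insert p S) \<le> card S + 1" using Suc by (simp add: card_insert_if)
    then obtain w where w: "w \<in> P \<union> Q" "w \<notin> insert p S \<union> T" "(p, w) \<in> r"
      using opp[of p "insert p S"] p(1) Suc cS by auto
    let ?S1 = "insert p (insert w S)"
    have cS1: "card ?S1 \<le> card S + 2" using Suc by (simp add: card_insert_if)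
    then obtain w' where w': "w' \<in> P \<union> Q" "w' \<notin> ?S1 \<union> T" "(p, w') \<in> r"
      using opp[of p ?S1] p(1) Suc cS by auto
    let ?S2 = "insert y (insert w' ?S1)"
    have yX: "y \<in> X" "x \<in> X" "y \<noteq> x" "y \<notin> S" "y \<notin> T" using y Suc by auto
    have XPQ: "X \<inter> (P \<union> Q) = {}" using ap by (simp add: apex_system_def)
    have cS2: "card ?S2 \<le> card S + 4" using Suc(5) by (simp add: card_insert_if)
    have "tchain r (2 * card (Y - {y}) + 1 + m) y ?S2"
    proof (rule Suc.hyps(1))
      show "Y - {y} \<subseteq> X - {y}" using Suc(4) by blast
      show "card ?S2 + 4 * card (Y - {y}) + 2 \<le> 4 * l + 20" using cS2 cS j by linarith
      have "w \<notin> X" "w' \<notin> X" "p \<notin> X" using XPQ w(1) w'(1) p(1) by auto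
      then show "?S2 \<inter> (Y - {y} \<union> T) = {}" using Suc(4,7) w(2) w'(2) p(2) yX(5) by blast
    qed (use Suc(5,8) j yX in simp_all)
    moreover have "y \<notin> ?S1" "y \<noteq> w'" using yX XPQ w(1) w'(1) p(1) by auto
    ultimately have "tchain r (Suc (2 * j + 1 + m)) p ?S1"
      unfolding tchain.simps j using w'(2,3) xp[OF yX(1), of p] xp[OF yX(1) w'(1)] p(1) gd(4)[of y p]
      by (intro exI[of _ y] exI[of _ w'] conjI) auto
    then have "tchain r (Suc (Suc (2 * j + 1 + m))) x S"
      unfolding tchain.simps(2)[of _ "Suc (2 * j + 1 + m)"] using w p xp[OF yX(2), of p] xp[OF yX(2) w(1)]
      by (intro exI[of _ p] exI[of _ w] conjI) auto
    moreover have "2 * card Y + 1 + m = Suc (Suc (2 * j + 1 + m))" using Suc(2) by linarith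
    ultimately show ?case by (simp only:)
  }
qed

text \<open>The apex \<open>x\<close> is a cycle vertex and lies in two of the private triangles;
  \<open>x'\<close> is the private vertex of the opposite edge \<open>ab\<close>. As the chain
  starts at \<open>x\<close>, this apex also serves the first chain triangle.\<close>

lemma has_lollipop_two_apexes:
  assumes g: "arc_graph V r" and ap: "apex_system l D r X P Q" and GP: "G \<subseteq> P \<union> Q" and G: "chain_ports l r m G T"
    and x: "x \<in> X" "x' \<in> X" "x \<noteq> x'" "Y \<subseteq> X - {x, x'}" and l: "l \<le> 2 * card Y + 1 + m" "card Y \<le> l" and XT: "X \<inter> T = {}"
  shows "has_lollipop r l"
proof -
  note gd = arc_graphD[OF g]
  have xp: "(x, p) \<in> r" "(p, x) \<in> r" "x \<noteq> p" if "x \<in> X" "p \<in> P \<union> Q" for x p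
    using ap that gd(4)[of x p] by (auto simp: apex_system_def)
  have T: "finite T" "card T \<le> 3" using G by (auto simp: chain_ports_def)
  have opp: "\<exists>w\<in>P \<union> Q. w \<notin> set xs \<union> T \<and> (p, w) \<in> r" if "p \<in> P \<union> Q" "length xs \<le> 6" for p xs
    using apex_system_opposite[OF ap that(1), of "set xs \<union> T"] that(2) T card_Un_le[of "set xs" T] card_length[of xs] by auto
  have "card T < card P" using T ap by (simp add: apex_system_def)
  then obtain a where a: "a \<in> P" "a \<notin> T" using ex_not_in_small[OF T(1)] by blast
  then obtain b where b: "b \<in> P \<union> Q" "b \<notin> set [a] \<union> T" "(a, b) \<in> r" using opp[of a "[a]"] by auto
  obtain q where q: "q \<in> P \<union> Q" "q \<notin> set [a, b] \<union> T" "(b, q) \<in> r" using opp[of b "[a, b]"] b(1) by auto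
  obtain u where u: "u \<in> P \<union> Q" "u \<notin> set [a, b, q] \<union> T" "(a, u) \<in> r" using opp[of a "[a, b, q]"] a(1) by auto
  have aPQ: "a \<in> P \<union> Q" using a by auto
  have XPQ: "X \<inter> (P \<union> Q) = {}" using ap by (simp add: apex_system_def)
  have core: "core r a b x x' q u"
    unfolding core_def using x xp[OF x(1) aPQ] xp[OF x(1) b(1)] xp[OF x(1) q(1)] xp[OF x(1) u(1)]
      xp[OF x(2) aPQ] xp[OF x(2) b(1)] xp[OF x(2) q(1)] xp[OF x(2) u(1)] b q u a gd(4) by auto
  have "card {a, b, x, x', q, u} \<le> 6" using card_length[of "[a, b, x, x', q, u]"] by simp
  moreover have "{a, b, x, x', q, u} \<inter> (Y \<union> T) = {}" using x a b q u XT XPQ by auto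
  ultimately have "tchain r (2 * card Y + 1 + m) x {a, b, x, x', q, u}"
    using x l XT by (intro tchain_apexes[OF g ap GP G]) auto
  then have "tchain r l x {a, b, x, x', q, u}" using l(1) by (rule tchain_mono)
  then show ?thesis using core unfolding has_lollipop_def by blast
qed

text \<open>The vertex \<open>a'\<close> replaces the second apex as private vertex of
  \<open>ab\<close>. The blow-up does not join it to \<open>x\<close>, so it suffices that
  \<open>x\<close> sees \<open>a\<close> and that \<open>a\<close>, \<open>a'\<close> have a common
  neighbour \<open>b\<close> in \<open>Q\<close>.\<close>

lemma has_lollipop_apex_edge:
  assumes g: "arc_graph V r" and ap: "apex_system l D r X P Q" and GP: "G \<subseteq> P \<union> Q" and G: "chain_ports l r m G {}"
    and x: "x \<in> X" "Y \<subseteq> X - {x}" and l: "l \<le> 2 * card Y + 1 + m" "card Y \<le> l"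
    and a: "(a, a') \<in> r" "(x, a) \<in> r" "a \<notin> X" "a' \<notin> X" "card (Q - r `` {a}) \<le> D" "card (Q - r `` {a'}) \<le> D"
  shows "has_lollipop r l"
proof -
  note gd = arc_graphD[OF g]
  have xp: "(x, p) \<in> r" "(p, x) \<in> r" "x \<noteq> p" if "x \<in> X" "p \<in> P \<union> Q" for x p
    using ap that gd(4)[of x p] by (auto simp: apex_system_def)
  have Q: "finite Q" "4 * l + 40 + 4 * D < card Q" "P \<inter> Q = {}" using ap by (auto simp: apex_system_def)
  have XPQ: "X \<inter> (P \<union> Q) = {}" using ap by (simp add: apex_system_def)
  have "card {a, a'} * D \<le> 2 * D" by (simp add: card_insert_if)
  moreover have "card {a, a'} \<le> 2" by (simp add: card_insert_if)
  ultimately have "card {a, a'} + card {a, a'} * D < card Q" using Q(2) by linarith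
  then obtain b where b: "b \<in> Q" "b \<notin> {a, a'}" "(a, b) \<in> r" "(a', b) \<in> r"
    using ex_common_neighbour[of Q "{a, a'}" r D "{a, a'}"] Q(1) a(5,6) by auto
  have "card {a, a', b} \<le> 3" by (simp add: card_insert_if)
  then obtain u where u: "u \<in> Q" "u \<notin> {a, a', b}" "(a, u) \<in> r"
    using ex_common_neighbour[of Q "{a}" r D "{a, a', b}"] Q a(5) by auto
  have "card {a, a', b, u} \<le> 4" by (simp add: card_insert_if)
  then obtain q where q: "q \<in> P \<union> Q" "q \<notin> {a, a', b, u}" "(b, q) \<in> r"
    using apex_system_opposite[OF ap, of b "{a, a', b, u}"] b(1) by auto
  have "a \<noteq> a'" using a(1) gd(7) by auto
  have bu: "b \<in> P \<union> Q" "u \<in> P \<union> Q" using b u by auto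
  have core: "core r a b x a' q u"
    unfolding core_def using a x xp[OF x(1) bu(1)] xp[OF x(1) bu(2)] xp[OF x(1) q(1)] b q u gd(4) \<open>a \<noteq> a'\<close> by auto
  have "card {a, b, x, a', q, u} \<le> 6" using card_length[of "[a, b, x, a', q, u]"] by simp
  moreover have "{a, b, x, a', q, u} \<inter> (Y \<union> {}) = {}" using x a b q u XPQ by auto
  ultimately have "tchain r (2 * card Y + 1 + m) x {a, b, x, a', q, u}"
    using x l by (intro tchain_apexes[OF g ap GP G]) auto
  then have "tchain r l x {a, b, x, a', q, u}" using l(1) by (rule tchain_mono)
  then show ?thesis using core unfolding has_lollipop_def by blast
qed

section \<open>Gadgets that end a chain with two triangles\<close>

lemma tchain_two:
  assumes "distinct [h, u, p', q']" "{h, u, p', q'} \<inter> S = {}"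
    "(p, h) \<in> r" "(p, u) \<in> r" "(h, u) \<in> r" "(h, p') \<in> r" "(h, q') \<in> r" "(p', q') \<in> r"
  shows "tchain r 2 p S"
proof -
  have "tchain r (Suc 0) h (insert h (insert u S))"
    unfolding tchain.simps using assms by (intro exI[of _ p'] exI[of _ q'] conjI) auto
  then have "tchain r (Suc (Suc 0)) p S"
    unfolding tchain.simps(2)[of _ "Suc 0"] using assms by (intro exI[of _ h] exI[of _ u] conjI) auto
  then show ?thesis by (simp only: numeral_2_eq_2)
qed

text \<open>\<open>w\<close> is the hub of the final triangles \<open>pwu\<close> and
  \<open>wp'q'\<close>; it acts like an apex that sees only \<open>G\<close> and
  \<open>R\<close>.\<close>

lemma chain_ports_hitter:
  assumes g: "arc_graph V r" and wG: "\<And>p. p \<in> G \<Longrightarrow> (w, p) \<in> r" and wR: "\<And>q. q \<in> R \<Longrightarrow> (w, q) \<in> r"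
    and miss: "\<And>p. p \<in> G \<Longrightarrow> card (R - r `` {p}) \<le> D" and c: "4 * l + 40 < card G" "4 * l + 40 + D < card R"
  shows "chain_ports l r 2 G {w}"
  unfolding chain_ports_def
proof (intro conjI ballI allI impI)
  note gd = arc_graphD[OF g]
  have finR: "finite R" using c(2) by (intro card_ge_0_finite) linarith
  have opp: "\<exists>q\<in>R. q \<notin> S \<and> (p, q) \<in> r" if "p \<in> G" "finite S" "card S \<le> 4 * l + 30" for p S
    using ex_common_neighbour[of R "{p}" r D S] finR miss that c(2) by auto
  fix p and S :: "'a set"
  assume p: "p \<in> G" and S: "finite S" "card S \<le> 4 * l + 20" "S \<inter> {w} = {}"
  obtain u where u: "u \<in> R" "u \<notin> S" "(p, u) \<in> r" using opp[OF p S(1)] S(2) by auto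
  have "card (insert u S) \<le> card S + 1" using S(1) by (simp add: card_insert_if)
  then have "card (insert u S) < card G" using S(2) c(1) by linarith
  then obtain p' where p': "p' \<in> G" "p' \<notin> insert u S" using ex_not_in_small[of "insert u S" G] S(1) by auto
  have "card (insert p' (insert u S)) \<le> card S + 2" using S(1) by (simp add: card_insert_if)
  then obtain q' where q': "q' \<in> R" "q' \<notin> insert p' (insert u S)" "(p', q') \<in> r"
    using opp[OF p'(1), of "insert p' (insert u S)"] S by auto
  have "w \<noteq> u" "w \<noteq> p'" "w \<noteq> q'" using wG wR u(1) p'(1) q'(1) gd(7) by blast+
  then show "tchain r 2 p S"
    using u p' q' S(3) gd(4)[OF wG[OF p]] wG[OF p'(1)] wR by (intro tchain_two[of w u p' q']) auto
qed (use c in auto)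

text \<open>The centre \<open>c\<close> is the hub: the chain enters it from the port with private
  vertex \<open>q\<close> and leaves it for \<open>p'\<close> with private vertex
  \<open>q'\<close>.\<close>

lemma chain_ports_cherry:
  assumes g: "arc_graph V r" and ch: "(c, q) \<in> r" "(c, q') \<in> r" "q \<noteq> q'"
    and miss: "\<And>x. x \<in> {q, c, q'} \<Longrightarrow> card (Q - r `` {x}) \<le> D" and Q: "4 * l + 40 + 4 * D < card Q"
  shows "chain_ports l r 2 (Q \<inter> r `` {c} \<inter> r `` {q}) {q, c, q'}"
  unfolding chain_ports_def
proof (intro conjI ballI allI impI)
  note gd = arc_graphD[OF g]
  have finQ: "finite Q" using Q by (intro card_ge_0_finite) linarith
  have "card Q \<le> card (Q \<inter> r `` {c} \<inter> r `` {q} \<union> (Q - r `` {c}) \<union> (Q - r `` {q}))"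
    using finQ by (intro card_mono) auto
  also have "\<dots> \<le> card (Q \<inter> r `` {c} \<inter> r `` {q}) + card (Q - r `` {c}) + card (Q - r `` {q})"
    using card_Un_le[of "Q \<inter> r `` {c} \<inter> r `` {q} \<union> (Q - r `` {c})" "Q - r `` {q}"]
      card_Un_le[of "Q \<inter> r `` {c} \<inter> r `` {q}" "Q - r `` {c}"] by linarith
  finally show "4 * l + 30 < card (Q \<inter> r `` {c} \<inter> r `` {q})" using miss[of c] miss[of q] Q by auto
  show "card {q, c, q'} \<le> 3" by (simp add: card_insert_if)
  fix p and S :: "'a set"
  assume p: "p \<in> Q \<inter> r `` {c} \<inter> r `` {q}" and S: "finite S" "card S \<le> 4 * l + 20" "S \<inter> {q, c, q'} = {}"
  have c5: "card (S \<union> {q, c, q'}) \<le> card S + 3"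
    using card_Un_le[of S "{q, c, q'}"] \<open>card {q, c, q'} \<le> 3\<close> by linarith
  have "card {c, q'} * D \<le> 2 * D" by (simp add: card_insert_if)
  then have "card (S \<union> {q, c, q'}) + card {c, q'} * D < card Q" using c5 S(2) Q by linarith
  then obtain p' where p': "p' \<in> Q" "p' \<notin> S \<union> {q, c, q'}" "(c, p') \<in> r" "(q', p') \<in> r"
    using ex_common_neighbour[of Q "{c, q'}" r D "S \<union> {q, c, q'}"] miss S(1) finQ by auto
  have "c \<noteq> q" "c \<noteq> q'" using ch gd(7) by auto
  then show "tchain r 2 p S"
    using p p' S(3) ch gd(4)[of c p] gd(4)[of q p] gd(4)[of q' p'] by (intro tchain_two[of c q p' q']) auto
qed auto

text \<open>The core takes two apexes, and the chain gets \<open>s - 1\<close> besides its start: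
  \<open>2 * (s - 1) + 1 = 2 * (l div 2) + 1\<close>, which is at least \<open>l\<close>.\<close>

lemma has_lollipop_Suc_apexes:
  assumes g: "arc_graph V r" and ap: "apex_system l D r X P Q" and s: "s = Suc (l div 2)" and X: "s < card X"
  shows "has_lollipop r l"
proof -
  have finX: "finite X" using ap by (simp add: apex_system_def)
  obtain x where x: "x \<in> X" using X by fastforce
  have "card (X - {x}) \<ge> s" using X x finX by simp
  then have "card (X - {x}) \<noteq> card {}" using s by simp
  then have "X - {x} \<noteq> {}" by metis
  then obtain x' where x': "x' \<in> X - {x}" by blast
  have "card (X - {x} - {x'}) \<ge> s - 1" using X x x' finX by simp
  then obtain Y where Y: "Y \<subseteq> X - {x} - {x'}" "card Y = s - 1" using obtain_subset_with_card_n by metis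
  show ?thesis
  proof (rule has_lollipop_two_apexes[OF g ap _ chain_ports_trivial[OF ap] x, of x' Y])
    show "Y \<subseteq> X - {x, x'}" using Y by auto
    show "l \<le> 2 * card Y + 1 + 0" "card Y \<le> l" using Y s by presburger+
  qed (use x' in auto)
qed

text \<open>The edge \<open>aa'\<close> saves one apex in the core, so the chain again gets
  \<open>s - 1\<close> besides its start.\<close>

lemma has_lollipop_apexes_edge:
  assumes g: "arc_graph V r" and ap: "apex_system l D r X P Q" and s: "s = Suc (l div 2)" and X: "s \<le> card X"
    and x: "x \<in> X" and a: "(a, a') \<in> r" "(x, a) \<in> r" "a \<notin> X" "a' \<notin> X" "card (Q - r `` {a}) \<le> D" "card (Q - r `` {a'}) \<le> D"
  shows "has_lollipop r l"
proof -
  have finX: "finite X" using ap by (simp add: apex_system_def)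
  have "card (X - {x}) \<ge> s - 1" using X x finX by simp
  then obtain Y where Y: "Y \<subseteq> X - {x}" "card Y = s - 1" using obtain_subset_with_card_n by metis
  show ?thesis
  proof (rule has_lollipop_apex_edge[OF g ap _ chain_ports_trivial[OF ap] x Y(1) _ _ a])
    show "l \<le> 2 * card Y + 1 + 0" "card Y \<le> l" using Y s by presburger+
  qed auto
qed

text \<open>The core takes two apexes and leaves \<open>s - 2\<close> for the chain; the two
  triangles behind the ports make up for the missing one.\<close>

lemma has_lollipop_apexes_ports:
  assumes g: "arc_graph V r" and ap: "apex_system l D r X P Q" and s: "s = Suc (l div 2)" "2 \<le> s" and X: "s \<le> card X"
    and G: "chain_ports l r 2 G T" "G \<subseteq> P \<union> Q" "X \<inter> T = {}"
  shows "has_lollipop r l"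
proof -
  have finX: "finite X" using ap by (simp add: apex_system_def)
  obtain x where x: "x \<in> X" using X s by fastforce
  have "card (X - {x}) \<ge> 1" using X x finX s by simp
  then have "card (X - {x}) \<noteq> card {}" by simp
  then have "X - {x} \<noteq> {}" by metis
  then obtain x' where x': "x' \<in> X - {x}" by blast
  have "card (X - {x} - {x'}) \<ge> s - 2" using X x x' finX by simp
  then obtain Y where Y: "Y \<subseteq> X - {x} - {x'}" "card Y = s - 2" using obtain_subset_with_card_n by metis
  show ?thesis
  proof (rule has_lollipop_two_apexes[OF g ap G(2,1) x, of x' Y])
    show "Y \<subseteq> X - {x, x'}" using Y by auto
    show "l \<le> 2 * card Y + 1 + 2" "card Y \<le> l" using Y s by presburger+
  qed (use x' G(3) in auto)
qed

text \<open>Both savings together: the edge spares an apex in the core and the ports one in the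
  chain, so \<open>s - 1\<close> apexes suffice.\<close>

lemma has_lollipop_apexes_edge_ports:
  assumes g: "arc_graph V r" and ap: "apex_system l D r X P Q" and s: "s = Suc (l div 2)" "2 \<le> s" and X: "s \<le> Suc (card X)"
    and G: "chain_ports l r 2 G {}" "G \<subseteq> P \<union> Q"
    and x: "x \<in> X" and a: "(a, a') \<in> r" "(x, a) \<in> r" "a \<notin> X" "a' \<notin> X" "card (Q - r `` {a}) \<le> D" "card (Q - r `` {a'}) \<le> D"
  shows "has_lollipop r l"
proof -
  have finX: "finite X" using ap by (simp add: apex_system_def)
  have "card (X - {x}) \<ge> s - 2" using X x finX by simp
  then obtain Y where Y: "Y \<subseteq> X - {x}" "card Y = s - 2" using obtain_subset_with_card_n by metis
  show ?thesis
  proof (rule has_lollipop_apex_edge[OF g ap G(2,1) x Y(1) _ _ a])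
    show "l \<le> 2 * card Y + 1 + 2" "card Y \<le> l" using Y s by presburger+
  qed
qed

section \<open>Neighbourhood types\<close>

lemma bip_structure_swap: "bip_structure C V r A B W \<Longrightarrow> bip_structure C V r B A W"
  unfolding bip_structure_def by (elim conjE, intro conjI; (assumption | blast))

text \<open>As \<open>W\<close> is bounded, there are boundedly many classes, so only boundedly many
  vertices lie in classes of bounded size. A larger class is fit to be a side of an apex
  system.\<close>

definition iso_class :: "('a \<times> 'a) set \<Rightarrow> 'a set \<Rightarrow> 'a set \<Rightarrow> 'a set \<Rightarrow> 'a set" where
  "iso_class r W A \<tau> = {a \<in> A. r `` {a} \<inter> A = {} \<and> r `` {a} \<inter> W = \<tau>}"

definition edge_class :: "('a \<times> 'a) set \<Rightarrow> 'a set \<Rightarrow> 'a set \<Rightarrow> 'a set \<Rightarrow> 'a set \<Rightarrow> 'a set" where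
  "edge_class r W A \<tau> \<tau>' = {a \<in> A. \<exists>a'\<in>A. (a, a') \<in> r \<and> r `` {a} \<inter> W = \<tau> \<and> r `` {a'} \<inter> W = \<tau>'}"

lemma codeg_le_types:
  assumes g: "arc_graph V r" and b: "bip_structure C V r A B W"
  shows "codeg r a b \<le> card (r `` {a} \<inter> W \<inter> (r `` {b} \<inter> W)) + card (r `` {a} \<inter> A) + card (r `` {b} \<inter> B)"
proof -
  note gd = arc_graphD[OF g]
  have "V = A \<union> B \<union> W" using b by (simp add: bip_structure_def)
  then have "r `` {a} \<inter> r `` {b} \<subseteq> r `` {a} \<inter> W \<inter> (r `` {b} \<inter> W) \<union> r `` {a} \<inter> A \<union> r `` {b} \<inter> B"
    using gd(8)[of "{a}"] by blast
  then have "codeg r a b \<le> card (r `` {a} \<inter> W \<inter> (r `` {b} \<inter> W) \<union> r `` {a} \<inter> A \<union> r `` {b} \<inter> B)"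
    using gd(3) by (intro card_mono) auto
  also have "\<dots> \<le> card (r `` {a} \<inter> W \<inter> (r `` {b} \<inter> W)) + card (r `` {a} \<inter> A) + card (r `` {b} \<inter> B)"
    using card_Un_le[of "r `` {a} \<inter> W \<inter> (r `` {b} \<inter> W) \<union> r `` {a} \<inter> A" "r `` {b} \<inter> B"]
      card_Un_le[of "r `` {a} \<inter> W \<inter> (r `` {b} \<inter> W)" "r `` {a} \<inter> A"] by linarith
  finally show ?thesis .
qed

lemma apex_system_types:
  assumes g: "arc_graph V r" and b: "bip_structure C V r A B W" and X: "X \<subseteq> W"
    and P: "P \<subseteq> A" "\<And>p. p \<in> P \<Longrightarrow> X \<subseteq> r `` {p}" "4 * l + 40 + 4 * C < card P"
    and Q: "Q \<subseteq> B" "\<And>q. q \<in> Q \<Longrightarrow> X \<subseteq> r `` {q}" "4 * l + 40 + 4 * C < card Q"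
  shows "apex_system l C r X P Q"
proof -
  note gd = arc_graphD[OF g]
  have V: "V = A \<union> B \<union> W" "A \<inter> B = {}" "(A \<union> B) \<inter> W = {}" using b by (auto simp: bip_structure_def)
  then have fin: "finite A" "finite B" "finite W" using gd(1) by auto
  have "card (Q - r `` {p}) \<le> C" if "p \<in> P" for p
  proof -
    have "card (Q - r `` {p}) \<le> card (B - r `` {p})" using Q(1) fin by (intro card_mono) auto
    then show ?thesis using b that P(1) unfolding bip_structure_def by (meson le_trans subsetD)
  qed
  moreover have "card (P - r `` {q}) \<le> C" if "q \<in> Q" for q
  proof -
    have "card (P - r `` {q}) \<le> card (A - r `` {q})" using P(1) fin by (intro card_mono) auto
    then show ?thesis using b that Q(1) unfolding bip_structure_def by (meson le_trans subsetD)
  qed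
  moreover have "(x, p) \<in> r" if "x \<in> X" "p \<in> P \<union> Q" for x p using P(2)[of p] Q(2)[of p] that gd(4)[of p x] by auto
  moreover have "finite X" "finite P" "finite Q" using X P(1) Q(1) fin by (auto intro: finite_subset)
  moreover have "P \<inter> Q = {}" "X \<inter> (P \<union> Q) = {}" using V X P(1) Q(1) by auto
  ultimately show ?thesis using P(3) Q(3) unfolding apex_system_def by blast
qed

text \<open>A forbidden vertex spoils itself and at most one matching partner, whence the factor
  2.\<close>

lemma pick_edge:
  assumes g: "arc_graph V r" and deg: "\<And>a. a \<in> A \<Longrightarrow> card (r `` {a} \<inter> A) \<le> 1" and "finite S" "2 * card S < card (edge_class r W A \<tau> \<tau>')"
  shows "\<exists>a\<in>edge_class r W A \<tau> \<tau>'. \<exists>a'\<in>A. (a, a') \<in> r \<and> r `` {a'} \<inter> W = \<tau>' \<and> a \<notin> S \<and> a' \<notin> S"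
proof -
  note gd = arc_graphD[OF g]
  let ?U = "\<Union>x\<in>S \<inter> A. r `` {x} \<inter> A"
  have "card ?U \<le> (\<Sum>x\<in>S \<inter> A. card (r `` {x} \<inter> A))" using assms(3) by (intro card_UN_le) auto
  also have "\<dots> \<le> card (S \<inter> A) * 1" using deg sum_bounded_above[of "S \<inter> A" "\<lambda>x. card (r `` {x} \<inter> A)" 1] by simp
  also have "\<dots> \<le> card S" using assms(3) by (simp add: card_mono)
  finally have "card (S \<union> ?U) < card (edge_class r W A \<tau> \<tau>')" using card_Un_le[of S ?U] assms(4) by linarith
  moreover have "finite (S \<union> ?U)" using assms(3) gd(3) by auto
  ultimately obtain a where a: "a \<in> edge_class r W A \<tau> \<tau>'" "a \<notin> S \<union> ?U" using ex_not_in_small by metis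
  then obtain a' where a': "a' \<in> A" "(a, a') \<in> r" "r `` {a'} \<inter> W = \<tau>'" "a \<in> A" by (auto simp: edge_class_def)
  have "a' \<notin> S" using a(2) a' gd(4)[OF a'(2)] by auto
  then show ?thesis using a a' by blast
qed

text \<open>Passing to the matching partner exchanges the two classes. Thus a bound proved for one
  end of a frequent edge holds for the other end as well.\<close>

lemma card_edge_class_swap:
  assumes g: "arc_graph V r" and deg: "\<And>a. a \<in> A \<Longrightarrow> card (r `` {a} \<inter> A) \<le> 1" and "finite A"
  shows "card (edge_class r W A \<tau> \<tau>') \<le> card (edge_class r W A \<tau>' \<tau>)"
proof -
  note gd = arc_graphD[OF g]
  let ?E = "edge_class r W A \<tau>' \<tau>"
  have fin: "finite ?E" using assms(3) by (simp add: edge_class_def)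
  have "edge_class r W A \<tau> \<tau>' \<subseteq> (\<Union>x\<in>?E. r `` {x} \<inter> A)"
  proof
    fix a assume "a \<in> edge_class r W A \<tau> \<tau>'"
    then obtain a' where a': "a \<in> A" "a' \<in> A" "(a, a') \<in> r" "r `` {a} \<inter> W = \<tau>" "r `` {a'} \<inter> W = \<tau>'"
      by (auto simp: edge_class_def)
    then have "a' \<in> ?E" using gd(4)[OF a'(3)] by (auto simp: edge_class_def)
    then show "a \<in> (\<Union>x\<in>?E. r `` {x} \<inter> A)" using a' gd(4)[OF a'(3)] by blast
  qed
  then have "card (edge_class r W A \<tau> \<tau>') \<le> card (\<Union>x\<in>?E. r `` {x} \<inter> A)" using fin gd(3) by (intro card_mono) auto
  also have "\<dots> \<le> (\<Sum>x\<in>?E. card (r `` {x} \<inter> A))" using fin by (rule card_UN_le)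
  also have "\<dots> \<le> card ?E * 1"
    using deg sum_bounded_above[of ?E "\<lambda>x. card (r `` {x} \<inter> A)" 1] by (simp add: edge_class_def)
  finally show ?thesis by simp
qed

text \<open>The four-set condition applied to an edge \<open>aa'\<close> of \<open>A\<close> and two isolated vertices of \<open>B\<close> yields \<open>s\<close> common
  apexes, and together with the edge \<open>aa'\<close> these give a copy.\<close>

lemma edge_iso_impossible:
  assumes red: "reduced s V r" and F: "\<not> has_lollipop r l" and s: "s = Suc (l div 2)" "2 \<le> s" and b: "bip_structure C V r A B W"
    and K: "K = 16 * l + 200 + 16 * C" and E: "K < card (edge_class r W A \<tau> \<tau>')" and I: "K < card (iso_class r W B \<sigma>)"
  shows False
proof -
  note g = reducedD(1)[OF red]
  note gd = arc_graphD[OF g]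
  have V: "V = A \<union> B \<union> W" "A \<inter> B = {}" "(A \<union> B) \<inter> W = {}" using b by (auto simp: bip_structure_def)
  then have fin: "finite A" "finite B" "finite W" using gd(1) by auto
  have degA: "card (r `` {a} \<inter> A) \<le> 1" if "a \<in> A" for a using b that by (simp add: bip_structure_def)
  have missA: "card (Q - r `` {a}) \<le> C" if "a \<in> A" "Q \<subseteq> B" for a Q
  proof -
    have "card (Q - r `` {a}) \<le> card (B - r `` {a})" using that(2) fin by (intro card_mono) auto
    then show ?thesis using b that(1) unfolding bip_structure_def by (meson le_trans)
  qed
  have small: "card (\<tau> \<inter> \<sigma>) < s" if E: "K < card (edge_class r W A \<tau> \<tau>')" for \<tau> \<tau>'
  proof (rule ccontr)
    assume "\<not> ?thesis"
    then have ge: "s \<le> card (\<tau> \<inter> \<sigma>)" by simp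
    have "edge_class r W A \<tau> \<tau>' \<noteq> {}" using E by auto
    then obtain a a' where a: "a \<in> A" "a' \<in> A" "(a, a') \<in> r" "r `` {a} \<inter> W = \<tau>" by (auto simp: edge_class_def)
    have "\<tau> \<inter> \<sigma> \<subseteq> W" using a(4) by auto
    then have ap: "apex_system l C r (\<tau> \<inter> \<sigma>) (edge_class r W A \<tau> \<tau>') (iso_class r W B \<sigma>)"
      using E I by (intro apex_system_types[OF g b]) (auto simp: edge_class_def iso_class_def K)
    have "\<tau> \<inter> \<sigma> \<noteq> {}" using ge s by auto
    then obtain x where x: "x \<in> \<tau> \<inter> \<sigma>" by blast
    then have "(x, a) \<in> r" using a(4) gd(4)[of a x] by auto
    moreover have "a \<notin> \<tau> \<inter> \<sigma>" "a' \<notin> \<tau> \<inter> \<sigma>" using \<open>\<tau> \<inter> \<sigma> \<subseteq> W\<close> a V(3) by auto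
    moreover have "iso_class r W B \<sigma> \<subseteq> B" by (auto simp: iso_class_def)
    ultimately have "has_lollipop r l"
      using has_lollipop_apexes_edge[OF g ap s(1) ge x a(3)] missA a(1,2) by blast
    then show False using F by blast
  qed
  have "edge_class r W A \<tau> \<tau>' \<noteq> {}" using E by auto
  then obtain a a' where a: "a \<in> A" "a' \<in> A" "(a, a') \<in> r" "r `` {a} \<inter> W = \<tau>" "r `` {a'} \<inter> W = \<tau>'" by (auto simp: edge_class_def)
  let ?Q = "iso_class r W B \<sigma>"
  have Q: "?Q \<subseteq> B" "finite ?Q" using fin by (auto simp: iso_class_def)
  have miss2: "card {a, a'} * C \<le> 2 * C" by (simp add: card_insert_if)
  have m: "card (?Q - r `` {x}) \<le> C" if "x \<in> {a, a'}" for x using missA that a(1,2) Q(1) by blast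
  have Qbig: "1 + card {a, a'} * C < card ?Q" using miss2 I unfolding K by linarith
  then have "card {} + card {a, a'} * C < card ?Q" by simp
  then obtain b1 where b1: "b1 \<in> ?Q" "(a, b1) \<in> r" "(a', b1) \<in> r"
    using ex_common_neighbour[of ?Q "{a, a'}" r C "{}"] Q(2) m by auto
  have "card {b1} + card {a, a'} * C < card ?Q" using Qbig by simp
  then obtain b2 where b2: "b2 \<in> ?Q" "(a, b2) \<in> r" "(a', b2) \<in> r" "b2 \<noteq> b1"
    using ex_common_neighbour[of ?Q "{a, a'}" r C "{b1}"] Q(2) m by auto
  have iso: "r `` {b} \<inter> B = {}" "r `` {b} \<inter> W = \<sigma>" if "b \<in> ?Q" for b using that by (auto simp: iso_class_def)
  \<comment> \<open>Both intersections are below \<open>s\<close>, and outside \<open>W\<close> the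
    only possible common neighbour is the partner \<open>a'\<close> or \<open>a\<close>. So the two
    codegrees sum to at most \<open>2 * s\<close>.\<close>
  have "2 * s + 1 \<le> codeg r a b1 + codeg r a' b2"
    using reducedD(4)[OF red a(3) b1(2) b2(2) b1(3) b2(3)] b2(4) by auto
  moreover have "codeg r a b1 \<le> card (\<tau> \<inter> \<sigma>) + 1"
    using codeg_le_types[OF g b, of a b1] iso[OF b1(1)] a(4) degA[OF a(1)] by simp
  moreover have "codeg r a' b2 \<le> card (\<tau>' \<inter> \<sigma>) + 1"
    using codeg_le_types[OF g b, of a' b2] iso[OF b2(1)] a(5) degA[OF a(2)] by simp
  moreover have "card (\<tau> \<inter> \<sigma>) < s" using small[OF E] .
  moreover have "card (\<tau>' \<inter> \<sigma>) < s" using small[of \<tau>' \<tau>] card_edge_class_swap[OF g degA fin(1), of W \<tau> \<tau>'] E by simp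
  ultimately show False by linarith
qed

text \<open>Here only \<open>s - 1\<close> common apexes are forced; the missing one is replaced by an edge of \<open>B\<close> followed by an edge of \<open>A\<close>
  at the end of the chain.\<close>

lemma edge_edge_impossible:
  assumes red: "reduced s V r" and F: "\<not> has_lollipop r l" and s: "s = Suc (l div 2)" "2 \<le> s" and b: "bip_structure C V r A B W"
    and K: "K = 16 * l + 200 + 16 * C" and E: "K < card (edge_class r W A \<tau> \<tau>')" and E': "K < card (edge_class r W B \<sigma> \<sigma>')"
  shows False
proof -
  note g = reducedD(1)[OF red]
  note gd = arc_graphD[OF g]
  have V: "V = A \<union> B \<union> W" "A \<inter> B = {}" "(A \<union> B) \<inter> W = {}" using b by (auto simp: bip_structure_def)
  then have fin: "finite A" "finite B" "finite W" using gd(1) by auto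
  have degA: "card (r `` {a} \<inter> A) \<le> 1" if "a \<in> A" for a using b that by (simp add: bip_structure_def)
  have degB: "card (r `` {a} \<inter> B) \<le> 1" if "a \<in> B" for a using b that by (simp add: bip_structure_def)
  have missA: "card (B - r `` {a}) \<le> C" if "a \<in> A" for a using b that unfolding bip_structure_def by blast
  have missB: "card (A - r `` {a}) \<le> C" if "a \<in> B" for a using b that unfolding bip_structure_def by blast
  have pickA: "\<exists>a\<in>edge_class r W A \<tau> \<tau>'. \<exists>a'\<in>A. (a, a') \<in> r \<and> r `` {a'} \<inter> W = \<tau>' \<and> a \<notin> S \<and> a' \<notin> S \<and> (p, a) \<in> r \<and> (p, a') \<in> r"
    if "K < card (edge_class r W A \<tau> \<tau>')" "p \<in> B" "finite S" "card S \<le> 4 * l + 30" for \<tau> \<tau>' p S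
  proof -
    have "2 * card (S \<union> (A - r `` {p})) < card (edge_class r W A \<tau> \<tau>')"
      using card_Un_le[of S "A - r `` {p}"] missB[OF that(2)] that(1,4) by (simp add: K)
    then show ?thesis using pick_edge[OF g degA, of "S \<union> (A - r `` {p})" W \<tau> \<tau>'] that(3) fin
      by (auto simp: edge_class_def)
  qed
  have pickB: "\<exists>a\<in>edge_class r W B \<tau> \<tau>'. \<exists>a'\<in>B. (a, a') \<in> r \<and> r `` {a'} \<inter> W = \<tau>' \<and> a \<notin> S \<and> a' \<notin> S \<and> (p, a) \<in> r \<and> (p, a') \<in> r"
    if "K < card (edge_class r W B \<tau> \<tau>')" "p \<in> A" "finite S" "card S \<le> 4 * l + 30" for \<tau> \<tau>' p S
  proof -
    have "2 * card (S \<union> (B - r `` {p})) < card (edge_class r W B \<tau> \<tau>')"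
      using card_Un_le[of S "B - r `` {p}"] missA[OF that(2)] that(1,4) by (simp add: K)
    then show ?thesis using pick_edge[OF g degB, of "S \<union> (B - r `` {p})" W \<tau> \<tau>'] that(3) fin
      by (auto simp: edge_class_def)
  qed
  have small: "Suc (card (\<tau> \<inter> \<sigma>)) < s" if E: "K < card (edge_class r W A \<tau> \<tau>')" and E': "K < card (edge_class r W B \<sigma> \<sigma>')" for \<tau> \<tau>' \<sigma> \<sigma>'
  proof (rule ccontr)
    assume "\<not> ?thesis"
    then have ge: "s \<le> Suc (card (\<tau> \<inter> \<sigma>))" by simp
    let ?P = "edge_class r W A \<tau> \<tau>'" and ?Q = "edge_class r W B \<sigma> \<sigma>'"
    have "?P \<noteq> {}" using E by auto
    then obtain a a' where a: "a \<in> A" "a' \<in> A" "(a, a') \<in> r" "r `` {a} \<inter> W = \<tau>" by (auto simp: edge_class_def)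
    have W: "\<tau> \<inter> \<sigma> \<subseteq> W" using a(4) by auto
    have ap: "apex_system l C r (\<tau> \<inter> \<sigma>) ?P ?Q"
      using E E' W by (intro apex_system_types[OF g b]) (auto simp: edge_class_def K)
    have "\<tau> \<inter> \<sigma> \<noteq> {}" using ge s by auto
    then obtain x where x: "x \<in> \<tau> \<inter> \<sigma>" by blast
    then have xa: "(x, a) \<in> r" using a(4) gd(4)[of a x] by auto
    have na: "a \<notin> \<tau> \<inter> \<sigma>" "a' \<notin> \<tau> \<inter> \<sigma>" using W a V(3) by auto
    have QB: "?Q \<subseteq> B" "?P \<subseteq> A" by (auto simp: edge_class_def)
    have mm: "card (?Q - r `` {u}) \<le> C" if "u \<in> A" for u
    proof -
      have "card (?Q - r `` {u}) \<le> card (B - r `` {u})" using QB fin by (intro card_mono) auto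
      then show ?thesis using missA[OF that] by linarith
    qed
    \<comment> \<open>The hub is an end \<open>u\<close> of an edge \<open>uu'\<close> of
      \<open>B\<close>, and the triangles are \<open>puu'\<close> and \<open>uvv'\<close> with
      \<open>vv'\<close> an edge of \<open>A\<close>. Such edges abound, so none has to be
      reserved.\<close>
    have "chain_ports l r 2 ?P {}"
      unfolding chain_ports_def
    proof (intro conjI ballI allI impI)
      show "4 * l + 30 < card ?P" using E K by simp
      fix p and S :: "'a set"
      assume p: "p \<in> ?P" and S: "finite S" "card S \<le> 4 * l + 20"
      have pA: "p \<in> A" using p QB by auto
      obtain u u' where u: "u \<in> B" "u' \<in> B" "(u, u') \<in> r" "u \<notin> S" "u' \<notin> S" "(p, u) \<in> r" "(p, u') \<in> r"
        using pickB[OF E' pA S(1)] S(2) QB(1) by fastforce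
      have "card (insert u (insert u' S)) \<le> 4 * l + 30" using S by (simp add: card_insert_if)
      then obtain v v' where v: "v \<in> A" "v' \<in> A" "(v, v') \<in> r" "v \<notin> S" "v' \<notin> S" "(u, v) \<in> r" "(u, v') \<in> r"
        using pickA[OF E u(1), of "insert u (insert u' S)"] S(1) QB(2) by fastforce
      have "u \<noteq> u'" "v \<noteq> v'" using u v gd(7) by auto
      then show "tchain r 2 p S"
        using u v V(2) by (intro tchain_two[of u u' v v']) auto
    qed auto
    then have "has_lollipop r l"
      using mm[OF a(1)] mm[OF a(2)] has_lollipop_apexes_edge_ports[OF g ap s ge _ _ x a(3) xa na] by blast
    then show False using F by blast
  qed
  have "edge_class r W A \<tau> \<tau>' \<noteq> {}" using E by auto
  then obtain a a' where a: "a \<in> A" "a' \<in> A" "(a, a') \<in> r" "r `` {a} \<inter> W = \<tau>" "r `` {a'} \<inter> W = \<tau>'" by (auto simp: edge_class_def)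
  \<comment> \<open>The vertices missed by \<open>a\<close> or \<open>a'\<close> are forbidden, so
    that the edge \<open>cc'\<close> found next is completely joined to \<open>aa'\<close>.\<close>
  have "2 * card ((B - r `` {a'}) \<union> (B - r `` {a})) < card (edge_class r W B \<sigma> \<sigma>')"
    using card_Un_le[of "B - r `` {a'}" "B - r `` {a}"] missA[OF a(1)] missA[OF a(2)] E' by (simp add: K)
  then obtain c c' where c: "c \<in> B" "c' \<in> B" "(c, c') \<in> r" "r `` {c} \<inter> W = \<sigma>" "r `` {c'} \<inter> W = \<sigma>'"
    "(a, c) \<in> r" "(a', c) \<in> r" "(a, c') \<in> r" "(a', c') \<in> r"
    using pick_edge[OF g degB, of "(B - r `` {a'}) \<union> (B - r `` {a})" W \<sigma> \<sigma>'] fin(2) by (auto simp: edge_class_def)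
  have "c \<noteq> c'" using c(3) gd(7) by auto
  then have "2 * s + 1 + 1 \<le> codeg r a c + codeg r a' c'"
    using reducedD(4)[OF red a(3) c(6) c(8) c(7) c(9)] c(3) by auto
  moreover have "codeg r a c \<le> card (\<tau> \<inter> \<sigma>) + 2"
    using codeg_le_types[OF g b, of a c] c(4) a(4) degA[OF a(1)] degB[OF c(1)] by simp
  moreover have "codeg r a' c' \<le> card (\<tau>' \<inter> \<sigma>') + 2"
    using codeg_le_types[OF g b, of a' c'] c(5) a(5) degA[OF a(2)] degB[OF c(2)] by simp
  moreover have "Suc (card (\<tau> \<inter> \<sigma>)) < s" using small[OF E E'] .
  moreover have "Suc (card (\<tau>' \<inter> \<sigma>')) < s"
    using small[of \<tau>' \<tau> \<sigma>' \<sigma>] card_edge_class_swap[OF g degA fin(1), of W \<tau> \<tau>'] card_edge_class_swap[OF g degB fin(2), of W \<sigma> \<sigma>'] E E' by simp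
  ultimately show False by linarith
qed

text \<open>Adjacent vertices that are isolated in their sides have all common neighbours in
  \<open>W\<close>, so the edge condition gives at least \<open>s\<close>; one more common apex
  would give a copy.\<close>

lemma iso_iso_meet:
  assumes red: "reduced s V r" and F: "\<not> has_lollipop r l" and s: "s = Suc (l div 2)" and b: "bip_structure C V r A B W"
    and K: "K = 16 * l + 200 + 16 * C" and I: "K < card (iso_class r W A \<tau>)" and J: "K < card (iso_class r W B \<sigma>)"
  shows "card (\<tau> \<inter> \<sigma>) = s" "apex_system l C r (\<tau> \<inter> \<sigma>) (iso_class r W A \<tau>) (iso_class r W B \<sigma>)"
proof -
  note g = reducedD(1)[OF red]
  let ?P = "iso_class r W A \<tau>" and ?Q = "iso_class r W B \<sigma>"
  have "?P \<noteq> {}" using I by auto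
  then obtain a where a: "a \<in> ?P" by blast
  then have a': "a \<in> A" "r `` {a} \<inter> W = \<tau>" "r `` {a} \<inter> A = {}" by (auto simp: iso_class_def)
  show ap: "apex_system l C r (\<tau> \<inter> \<sigma>) ?P ?Q"
    using I J a'(2) by (intro apex_system_types[OF g b]) (auto simp: iso_class_def K)
  have "card (\<tau> \<inter> \<sigma>) \<le> s" using has_lollipop_Suc_apexes[OF g ap s] F by force
  moreover have "s \<le> card (\<tau> \<inter> \<sigma>)"
  proof -
    obtain b' where b': "b' \<in> ?Q" "(a, b') \<in> r"
      using ap J K a ex_common_neighbour[of ?Q "{a}" r C "{}"] by (auto simp: apex_system_def)
    then have "r `` {b'} \<inter> W = \<sigma>" "r `` {b'} \<inter> B = {}" by (auto simp: iso_class_def)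
    then have "codeg r a b' \<le> card (\<tau> \<inter> \<sigma>)" using codeg_le_types[OF g b, of a b'] a' by simp
    then show ?thesis using reducedD(3)[OF red b'(2)] by linarith
  qed
  ultimately show "card (\<tau> \<inter> \<sigma>) = s" by simp
qed

text \<open>A vertex of \<open>\<tau>' \<inter> \<sigma>\<close> outside \<open>\<tau> \<inter> \<sigma>\<close> would act as one more apex at the end of the chain.\<close>

lemma iso_meet_subset:
  assumes red: "reduced s V r" and F: "\<not> has_lollipop r l" and s: "s = Suc (l div 2)" "2 \<le> s" and b: "bip_structure C V r A B W"
    and K: "K = 16 * l + 200 + 16 * C" and I: "K < card (iso_class r W A \<tau>)" and J: "K < card (iso_class r W B \<sigma>)"
    and I': "K < card (iso_class r W A \<tau>')"
  shows "\<tau> \<inter> \<sigma> \<subseteq> \<tau>'"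
proof -
  note g = reducedD(1)[OF red]
  note gd = arc_graphD[OF g]
  note m = iso_iso_meet[OF red F s(1) b K I J] and m' = iso_iso_meet[OF red F s(1) b K I' J]
  have fin: "finite (\<tau> \<inter> \<sigma>)" using m(2) by (simp add: apex_system_def)
  have "\<tau>' \<inter> \<sigma> \<subseteq> \<tau> \<inter> \<sigma>"
  proof (rule ccontr)
    assume "\<not> ?thesis"
    then obtain w where w: "w \<in> \<tau>'" "w \<in> \<sigma>" "w \<notin> \<tau> \<inter> \<sigma>" by blast
    have "chain_ports l r 2 (iso_class r W B \<sigma>) {w}"
    proof (rule chain_ports_hitter[OF g, of _ _ "iso_class r W A \<tau>'" C])
      show "(w, p) \<in> r" if "p \<in> iso_class r W B \<sigma>" for p using that w(2) gd(4)[of p w] by (auto simp: iso_class_def)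
      show "(w, p) \<in> r" if "p \<in> iso_class r W A \<tau>'" for p using that w(1) gd(4)[of p w] by (auto simp: iso_class_def)
      show "card (iso_class r W A \<tau>' - r `` {p}) \<le> C" if "p \<in> iso_class r W B \<sigma>" for p
        using m'(2) that by (auto simp: apex_system_def)
    qed (use I' J K in auto)
    then have "has_lollipop r l"
      using w(3) m(1) by (intro has_lollipop_apexes_ports[OF g m(2) s]) auto
    then show False using F by blast
  qed
  then have "\<tau>' \<inter> \<sigma> = \<tau> \<inter> \<sigma>" using card_subset_eq[OF fin] m(1) m'(1) by simp
  then show ?thesis by blast
qed

section \<open>Frequent and rare types\<close>

lemma card_rare_iso:
  assumes "finite W" "finite A"
  shows "card {a \<in> A. r `` {a} \<inter> A = {} \<and> card (iso_class r W A (r `` {a} \<inter> W)) \<le> K} \<le> 2 ^ card W * K"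
proof -
  let ?I = "\<lambda>\<tau>. if card (iso_class r W A \<tau>) \<le> K then iso_class r W A \<tau> else {}"
  have "{a \<in> A. r `` {a} \<inter> A = {} \<and> card (iso_class r W A (r `` {a} \<inter> W)) \<le> K} \<subseteq> (\<Union>\<tau>\<in>Pow W. ?I \<tau>)"
  proof
    fix a assume a: "a \<in> {a \<in> A. r `` {a} \<inter> A = {} \<and> card (iso_class r W A (r `` {a} \<inter> W)) \<le> K}"
    then have "a \<in> ?I (r `` {a} \<inter> W)" by (simp add: iso_class_def)
    then show "a \<in> (\<Union>\<tau>\<in>Pow W. ?I \<tau>)" by (rule UN_I[rotated]) simp
  qed
  moreover have "finite (\<Union>\<tau>\<in>Pow W. ?I \<tau>)" using assms by (auto simp: iso_class_def)
  ultimately have "card {a \<in> A. r `` {a} \<inter> A = {} \<and> card (iso_class r W A (r `` {a} \<inter> W)) \<le> K} \<le> card (\<Union>\<tau>\<in>Pow W. ?I \<tau>)"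
    by (rule card_mono[rotated])
  also have "\<dots> \<le> (\<Sum>\<tau>\<in>Pow W. card (?I \<tau>))" using assms by (intro card_UN_le) auto
  also have "\<dots> \<le> card (Pow W) * K" using sum_bounded_above[of "Pow W" "\<lambda>\<tau>. card (?I \<tau>)" K] by simp
  finally show ?thesis using assms(1) by (simp add: card_Pow)
qed

lemma card_rare_edge:
  assumes "finite W" "finite A" "\<And>\<tau> \<tau>'. card (edge_class r W A \<tau> \<tau>') \<le> K"
  shows "card {a \<in> A. r `` {a} \<inter> A \<noteq> {}} \<le> 2 ^ card W * 2 ^ card W * K"
proof -
  let ?T = "Pow W \<times> Pow W"
  let ?I = "\<lambda>t. edge_class r W A (fst t) (snd t)"
  have "{a \<in> A. r `` {a} \<inter> A \<noteq> {}} \<subseteq> (\<Union>t\<in>?T. ?I t)"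
  proof
    fix a assume "a \<in> {a \<in> A. r `` {a} \<inter> A \<noteq> {}}"
    then obtain a' where "a \<in> A" "a' \<in> A" "(a, a') \<in> r" by auto
    then have "a \<in> ?I (r `` {a} \<inter> W, r `` {a'} \<inter> W)" by (auto simp: edge_class_def)
    then show "a \<in> (\<Union>t\<in>?T. ?I t)" by (rule UN_I[rotated]) simp
  qed
  moreover have "finite (\<Union>t\<in>?T. ?I t)" using assms by (auto simp: edge_class_def)
  ultimately have "card {a \<in> A. r `` {a} \<inter> A \<noteq> {}} \<le> card (\<Union>t\<in>?T. ?I t)" by (rule card_mono[rotated])
  also have "\<dots> \<le> (\<Sum>t\<in>?T. card (?I t))" using assms by (intro card_UN_le) auto
  also have "\<dots> \<le> card ?T * K" using assms(3) sum_bounded_above[of ?T "\<lambda>t. card (?I t)" K] by simp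
  finally show ?thesis using assms(1) by (simp add: card_Pow card_cartesian_product)
qed

definition popular :: "('a \<times> 'a) set \<Rightarrow> 'a set \<Rightarrow> 'a set \<Rightarrow> nat \<Rightarrow> 'a set" where
  "popular r W A K = {a \<in> A. r `` {a} \<inter> A = {} \<and> K < card (iso_class r W A (r `` {a} \<inter> W))}"

lemma card_unpopular:
  assumes "finite W" "finite A" "\<And>\<tau> \<tau>'. card (edge_class r W A \<tau> \<tau>') \<le> K" "card W \<le> C"
  shows "card (A - popular r W A K) \<le> (2 ^ C + 2 ^ C * 2 ^ C) * K"
proof -
  let ?R = "{a \<in> A. r `` {a} \<inter> A = {} \<and> card (iso_class r W A (r `` {a} \<inter> W)) \<le> K}" and ?N = "{a \<in> A. r `` {a} \<inter> A \<noteq> {}}"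
  have "card (A - popular r W A K) \<le> card (?R \<union> ?N)"
    using assms(2) by (intro card_mono) (auto simp: popular_def)
  also have "\<dots> \<le> card ?R + card ?N" by (rule card_Un_le)
  also have "\<dots> \<le> 2 ^ card W * K + 2 ^ card W * 2 ^ card W * K"
    using card_rare_iso[OF assms(1,2), of r K] card_rare_edge[OF assms(1,2,3)] by linarith
  also have "\<dots> = (2 ^ card W + 2 ^ card W * 2 ^ card W) * K" by (simp add: algebra_simps)
  also have "\<dots> \<le> (2 ^ C + 2 ^ C * 2 ^ C) * K"
    using assms(4) by (intro mult_le_mono1 add_mono mult_mono power_increasing) auto
  finally show ?thesis .
qed

text \<open>A frequent edge class in \<open>A\<close> excludes every frequent class in
  \<open>B\<close>: the edge classes by \<open>edge_edge_impossible\<close>, the others by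
  \<open>edge_iso_impossible\<close>. But \<open>B\<close> is too large to consist of rare
  classes.\<close>

lemma no_popular_edges:
  assumes red: "reduced s V r" and F: "\<not> has_lollipop r l" and s: "s = Suc (l div 2)" "2 \<le> s" and b: "bip_structure C V r A B W"
    and K: "K = 16 * l + 200 + 16 * C" and n: "4 * ((2 ^ C + 2 ^ C * 2 ^ C) * K) < card V"
  shows "card (edge_class r W A \<tau> \<tau>') \<le> K"
proof (rule ccontr)
  assume "\<not> ?thesis"
  then have E: "K < card (edge_class r W A \<tau> \<tau>')" by simp
  have V: "V = A \<union> B \<union> W" "card W \<le> C" "card V \<le> 4 * card B" using b by (auto simp: bip_structure_def)
  have fin: "finite A" "finite B" "finite W" using arc_graphD(1)[OF reducedD(1)[OF red]] V by auto
  have nE: "card (edge_class r W B \<sigma> \<sigma>') \<le> K" for \<sigma> \<sigma>'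
    using edge_edge_impossible[OF red F s b K E, of \<sigma> \<sigma>'] by force
  have "card B \<le> card (B - popular r W B K) + card (popular r W B K)"
    using fin card_mono[of "B - popular r W B K \<union> popular r W B K" B] card_Un_le[of "B - popular r W B K" "popular r W B K"]
    by (auto simp: popular_def)
  then have "card (popular r W B K) > 0" using card_unpopular[OF fin(3,2) nE V(2)] V(3) n by linarith
  then obtain b' where "b' \<in> popular r W B K" by fastforce
  then have "K < card (iso_class r W B (r `` {b'} \<inter> W))" by (simp add: popular_def)
  then show False by (rule edge_iso_impossible[OF red F s b K E])
qed

lemma ex_popular_core:
  assumes red: "reduced s V r" and F: "\<not> has_lollipop r l" and s: "s = Suc (l div 2)" "2 \<le> s" and b: "bip_structure C V r A B W"
    and K: "K = 16 * l + 200 + 16 * C" and n: "4 * ((2 ^ C + 2 ^ C * 2 ^ C) * K) < card V"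
  shows "\<exists>X\<subseteq>W. card X = s \<and> (\<forall>a\<in>popular r W A K \<union> popular r W B K. X \<subseteq> r `` {a})"
    "card (A - popular r W A K) \<le> (2 ^ C + 2 ^ C * 2 ^ C) * K" "card (B - popular r W B K) \<le> (2 ^ C + 2 ^ C * 2 ^ C) * K"
proof -
  note b' = bip_structure_swap[OF b]
  have V: "V = A \<union> B \<union> W" "card W \<le> C" "card V \<le> 4 * card B" "card V \<le> 4 * card A" using b by (auto simp: bip_structure_def)
  have fin: "finite A" "finite B" "finite W" using arc_graphD(1)[OF reducedD(1)[OF red]] V by auto
  show cA: "card (A - popular r W A K) \<le> (2 ^ C + 2 ^ C * 2 ^ C) * K"
    using no_popular_edges[OF red F s b K n] V(2) fin by (intro card_unpopular) auto
  show cB: "card (B - popular r W B K) \<le> (2 ^ C + 2 ^ C * 2 ^ C) * K"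
    using no_popular_edges[OF red F s b' K n] V(2) fin by (intro card_unpopular) auto
  have "popular r W A K \<noteq> {}"
  proof
    assume "popular r W A K = {}"
    then show False using cA n V(4) by simp
  qed
  then obtain a where a: "a \<in> popular r W A K" by blast
  have "popular r W B K \<noteq> {}"
  proof
    assume "popular r W B K = {}"
    then show False using cB n V(3) by simp
  qed
  then obtain c where c: "c \<in> popular r W B K" by blast
  let ?\<tau> = "r `` {a} \<inter> W" and ?\<sigma> = "r `` {c} \<inter> W"
  have I: "K < card (iso_class r W A ?\<tau>)" using a by (simp add: popular_def)
  have J: "K < card (iso_class r W B ?\<sigma>)" using c by (simp add: popular_def)
  have "?\<tau> \<inter> ?\<sigma> \<subseteq> r `` {v}" if "v \<in> popular r W A K" for v
  proof -
    have "K < card (iso_class r W A (r `` {v} \<inter> W))" using that by (simp add: popular_def)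
    from iso_meet_subset[OF red F s b K I J this] show ?thesis by blast
  qed
  moreover have "?\<tau> \<inter> ?\<sigma> \<subseteq> r `` {v}" if "v \<in> popular r W B K" for v
  proof -
    have "K < card (iso_class r W B (r `` {v} \<inter> W))" using that by (simp add: popular_def)
    from iso_meet_subset[OF red F s b' K J I this] show ?thesis by blast
  qed
  moreover have "card (?\<tau> \<inter> ?\<sigma>) = s" by (rule iso_iso_meet(1)[OF red F s(1) b K I J])
  ultimately show "\<exists>X\<subseteq>W. card X = s \<and> (\<forall>a\<in>popular r W A K \<union> popular r W B K. X \<subseteq> r `` {a})"
    by (intro exI[of _ "?\<tau> \<inter> ?\<sigma>"]) auto
qed

section \<open>The two sides are independent\<close>

lemma no_edge_touching_apex:
  assumes g: "arc_graph V r" and F: "\<not> has_lollipop r l" and s: "s = Suc (l div 2)"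
    and ap: "apex_system l D r X P Q" and X: "card X = s" and XA: "X \<inter> A = {}"
    and miss: "\<And>a. a \<in> A \<Longrightarrow> card (Q - r `` {a}) \<le> D"
    and "u \<in> A" "v \<in> A" "(u, v) \<in> r" "x \<in> X"
  shows "(x, u) \<notin> r"
proof
  assume xu: "(x, u) \<in> r"
  have "u \<notin> X" "v \<notin> X" using XA assms(8,9) by auto
  then have "has_lollipop r l"
    using has_lollipop_apexes_edge[OF g ap s _ assms(11,10) xu] X miss assms(8,9) by simp
  then show False using F by blast
qed

text \<open>An edge \<open>uv\<close> of \<open>A\<close> keeps all apexes away from
  \<open>u\<close>. A neighbour \<open>b\<close> of \<open>u\<close> in \<open>Q\<close> sees an
  apex and therefore has no neighbour in \<open>B\<close>. So the at least two common neighbours of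
  \<open>u\<close> and \<open>b\<close> lie in \<open>A\<close> and form a cherry with centre
  \<open>u\<close>.\<close>

lemma independent_side:
  assumes red: "reduced s V r" and F: "\<not> has_lollipop r l" and s: "s = Suc (l div 2)" "2 \<le> s"
    and ap: "apex_system l D r X P Q" and X: "card X = s" and V: "V = X \<union> A \<union> B" "X \<inter> A = {}" and QB: "Q \<subseteq> B"
    and miss: "\<And>a. a \<in> A \<Longrightarrow> card (Q - r `` {a}) \<le> D"
    and noB: "\<And>u v x. u \<in> B \<Longrightarrow> v \<in> B \<Longrightarrow> (u, v) \<in> r \<Longrightarrow> x \<in> X \<Longrightarrow> (x, u) \<notin> r"
    and uv: "u \<in> A" "v \<in> A"
  shows "(u, v) \<notin> r"
proof
  assume r: "(u, v) \<in> r"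
  note g = reducedD(1)[OF red]
  note gd = arc_graphD[OF g]
  have Q: "finite Q" "4 * l + 40 + 4 * D < card Q" using ap by (auto simp: apex_system_def)
  have nX: "(x, u) \<notin> r" if "x \<in> X" for x
    using no_edge_touching_apex[OF g F s(1) ap X V(2) miss uv r that] .
  obtain b where b: "b \<in> Q" "(u, b) \<in> r"
    using ex_common_neighbour[of Q "{u}" r D "{}"] miss[OF uv(1)] Q by auto
  obtain x where x: "x \<in> X" using X s by fastforce
  have xb: "(x, b) \<in> r" using ap x b(1) by (auto simp: apex_system_def)
  have sub: "z \<in> A" if "z \<in> r `` {u} \<inter> r `` {b}" for z
  proof -
    have z: "z \<in> V" "(u, z) \<in> r" "(b, z) \<in> r" using that gd(6) by auto
    have "z \<notin> X" using nX gd(4)[OF z(2)] by blast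
    moreover have "z \<notin> B" using noB[of b z x] b(1) QB z(3) x xb by blast
    ultimately show ?thesis using z(1) V(1) by blast
  qed
  have "\<not> codeg r u b \<le> Suc 0" using reducedD(3)[OF red b(2)] s(2) by linarith
  then obtain z z' where z: "z \<in> r `` {u} \<inter> r `` {b}" "z' \<in> r `` {u} \<inter> r `` {b}" "z \<noteq> z'"
    using card_le_Suc0_iff_eq[of "r `` {u} \<inter> r `` {b}"] gd(3) by blast
  have zA: "z \<in> A" "z' \<in> A" using sub z by blast+
  have "chain_ports l r 2 (Q \<inter> r `` {u} \<inter> r `` {z}) {z, u, z'}"
    using z zA uv(1) miss Q(2) by (intro chain_ports_cherry[OF g]) auto
  moreover have "X \<inter> {z, u, z'} = {}" using zA uv(1) V(2) by auto
  ultimately have "has_lollipop r l"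
    using X by (intro has_lollipop_apexes_ports[OF g ap s]) auto
  then show False using F by blast
qed

lemma apex_partition:
  assumes red: "reduced s V r" and F: "\<not> has_lollipop r l" and s: "s = Suc (l div 2)" "2 \<le> s" and b: "bip_structure C V r A B W"
    and K: "K = 16 * l + 200 + 16 * C" and Z: "Z = (2 ^ C + 2 ^ C * 2 ^ C) * K" and h: "h = 4 * l + 40 + C"
    and D: "D = 2 + 4 * C + 2 * h + 4 * Z" and n: "4 * (Z + 4 * l + 40 + 4 * D) < card V"
  shows "\<exists>X A' B'. V = X \<union> A' \<union> B' \<and> X \<inter> A' = {} \<and> X \<inter> B' = {} \<and> A' \<inter> B' = {} \<and> card X = s \<and>
    r \<inter> A' \<times> A' = {} \<and> r \<inter> B' \<times> B' = {}"
proof -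
  note g = reducedD(1)[OF red]
  note gd = arc_graphD[OF g]
  note b' = bip_structure_swap[OF b]
  have V: "V = A \<union> B \<union> W" "A \<inter> B = {}" "(A \<union> B) \<inter> W = {}" "card W \<le> C" "card V \<le> 4 * card A" "card V \<le> 4 * card B"
    using b by (auto simp: bip_structure_def)
  have fin: "finite A" "finite B" "finite W" using gd(1) V by auto
  have deg: "card V \<le> 2 * deg r v" if "v \<in> V" for v using reducedD(2)[OF red that] s(2) by linarith
  let ?P = "popular r W A K" and ?Q = "popular r W B K"
  have n': "4 * Z + 16 * l + 160 + 16 * D < card V" using n by (simp add: algebra_simps)
  have n4: "4 * ((2 ^ C + 2 ^ C * 2 ^ C) * K) < card V" using n' unfolding Z[symmetric] by linarith
  note pc = ex_popular_core[OF red F s b K n4]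
  obtain X where X: "X \<subseteq> W" "card X = s" "\<And>a. a \<in> ?P \<union> ?Q \<Longrightarrow> X \<subseteq> r `` {a}" using pc(1) by blast
  have PQ: "?P \<subseteq> A" "?Q \<subseteq> B" by (auto simp: popular_def)
  have finPQ: "finite ?P" "finite ?Q" using PQ fin by (auto intro: finite_subset)
  have cP: "card A \<le> card ?P + Z" "card B \<le> card ?Q + Z"
    using pc(2,3) diff_card_le_card_Diff[OF finPQ(1), of A] diff_card_le_card_Diff[OF finPQ(2), of B] unfolding Z by linarith+
  have bigP: "4 * l + 40 + 4 * D < card ?P" "4 * l + 40 + 4 * D < card ?Q" using n' cP V(5,6) by linarith+
  have CD: "C \<le> D" "h + C \<le> D" unfolding D by linarith+
  have bigP': "4 * l + 40 + 4 * C < card ?P" "4 * l + 40 + 4 * C < card ?Q" using bigP CD by linarith+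
  have ap0: "apex_system l C r X ?P ?Q"
    using X PQ bigP' by (intro apex_system_types[OF g b]) auto
  have ap: "apex_system l D r X ?P ?Q"
    using ap0 bigP CD(1) unfolding apex_system_def by (auto intro: le_trans)
  \<comment> \<open>A vertex of \<open>B\<close> has at most one neighbour in \<open>B\<close> and
    \<open>C\<close> in \<open>W\<close>. Its degree thus forces \<open>A\<close> to contain almost
    half of the vertices, which leaves little more than half for \<open>B\<close>.\<close>
  have ub: "2 * card B \<le> card V + (2 + 2 * C)" if "bip_structure C V r A B W" for A B
  proof -
    have V: "V = A \<union> B \<union> W" "A \<inter> B = {}" "card W \<le> C" "card V \<le> 4 * card B" using that by (auto simp: bip_structure_def)
    have fin: "finite A" "finite B" "finite W" using gd(1) V by auto
    have "card B \<noteq> 0" using V(4) n' by linarith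
    then obtain y where y: "y \<in> B" by fastforce
    have "r `` {y} \<subseteq> A \<union> (r `` {y} \<inter> B) \<union> W" using gd(8)[of "{y}"] V(1) by blast
    then have "deg r y \<le> card (A \<union> (r `` {y} \<inter> B) \<union> W)" using fin by (intro card_mono) auto
    also have "\<dots> \<le> card A + card (r `` {y} \<inter> B) + card W"
      using card_Un_le[of "A \<union> (r `` {y} \<inter> B)" W] card_Un_le[of A "r `` {y} \<inter> B"] by linarith
    finally have "deg r y \<le> card A + 1 + C" using that y V(3) unfolding bip_structure_def by fastforce
    moreover have "card V \<le> 2 * deg r y" using deg y V(1) by blast
    moreover have "card (A \<union> B) \<le> card V" using V(1) gd(1) by (intro card_mono) auto
    then have "card A + card B \<le> card V" using card_Un_disjoint[OF fin(1,2) V(2)] by simp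
    ultimately show ?thesis by linarith
  qed
  let ?W = "V - (?P \<union> ?Q)"
  have "card ?W \<le> card (W \<union> (A - ?P) \<union> (B - ?Q))" using fin V(1) by (intro card_mono) auto
  also have "\<dots> \<le> card W + card (A - ?P) + card (B - ?Q)"
    using card_Un_le[of "W \<union> (A - ?P)" "B - ?Q"] card_Un_le[of W "A - ?P"] by linarith
  finally have cW: "card ?W \<le> C + 2 * Z" using pc(2,3) V(4) unfolding Z by linarith
  have VPQ: "V = ?P \<union> ?Q \<union> ?W" "V = ?Q \<union> ?P \<union> ?W" using PQ V(1) by auto
  have "card ?P \<le> card A" "card ?Q \<le> card B" using PQ fin by (auto intro: card_mono)
  then have ubPQ: "2 * card ?P \<le> card V + (2 + 2 * C)" "2 * card ?Q \<le> card V + (2 + 2 * C)" using ub[OF b] ub[OF b'] by linarith+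
  \<comment> \<open>The threshold \<open>h\<close> meets the demands of
    \<open>chain_ports_hitter\<close>: a vertex outside \<open>X\<close> with more than
    \<open>h\<close> neighbours in both \<open>?P\<close> and \<open>?Q\<close> would be a hub. So
    every vertex outside \<open>X\<close> is sorted by the side it barely sees.\<close>
  define A' where "A' = {v \<in> V - X. card (r `` {v} \<inter> ?P) \<le> h}"
  define B' where "B' = V - X - A'"
  have XV: "X \<subseteq> V" using X(1) V(1) by blast
  have part: "V = X \<union> A' \<union> B'" "V = X \<union> B' \<union> A'" "X \<inter> A' = {}" "X \<inter> B' = {}" "A' \<inter> B' = {}"
    using XV by (auto simp: A'_def B'_def)
  have PA': "?P \<subseteq> A'"
  proof
    fix a assume a: "a \<in> ?P"
    then have "r `` {a} \<inter> ?P = {}" by (auto simp: popular_def)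
    moreover have "a \<in> V - X" using a PQ V X(1) by blast
    ultimately show "a \<in> A'" by (simp add: A'_def)
  qed
  have QB': "?Q \<subseteq> B'"
  proof
    fix a assume a: "a \<in> ?Q"
    have "card (?P - r `` {a}) \<le> C" using ap0 a by (simp add: apex_system_def)
    moreover have "card ?P \<le> card (?P - r `` {a}) + card (r `` {a} \<inter> ?P)"
      using card_Un_le[of "?P - r `` {a}" "r `` {a} \<inter> ?P"] card_mono[of "(?P - r `` {a}) \<union> (r `` {a} \<inter> ?P)" ?P] finPQ by fastforce
    ultimately have "h < card (r `` {a} \<inter> ?P)" using bigP CD by linarith
    moreover have "a \<in> V - X" using a PQ V X(1) by blast
    ultimately show "a \<in> B'" by (simp add: A'_def B'_def)
  qed
  have hB: "card (r `` {v} \<inter> ?Q) \<le> h" if "v \<in> B'" for v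
  proof (rule ccontr)
    assume "\<not> ?thesis"
    then have hQ: "h < card (r `` {v} \<inter> ?Q)" by simp
    have hP: "h < card (r `` {v} \<inter> ?P)" and vX: "v \<notin> X" using that by (auto simp: A'_def B'_def)
    have "chain_ports l r 2 (r `` {v} \<inter> ?P) {v}"
    proof (rule chain_ports_hitter[OF g, of _ _ "r `` {v} \<inter> ?Q" C])
      show "card (r `` {v} \<inter> ?Q - r `` {p}) \<le> C" if "p \<in> r `` {v} \<inter> ?P" for p
      proof -
        have "card (r `` {v} \<inter> ?Q - r `` {p}) \<le> card (?Q - r `` {p})" using finPQ by (intro card_mono) auto
        then show ?thesis using ap0 that unfolding apex_system_def by (meson IntD2 le_trans)
      qed
    qed (use hP hQ h in auto)
    then have "has_lollipop r l" using vX X(2) by (intro has_lollipop_apexes_ports[OF g ap s]) auto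
    then show False using F by blast
  qed
  \<comment> \<open>\<open>D\<close> adds up the terms of \<open>miss_bound\<close>:
    \<open>2 + 2 * C\<close> for the size of the side, \<open>2 * h\<close> for the inner neighbours
    and \<open>2 * (C + 2 * Z)\<close> for the remainder \<open>?W\<close>.\<close>
  have missA: "card (?Q - r `` {v}) \<le> D" if "v \<in> A'" for v
  proof -
    have "v \<in> V" "card (r `` {v} \<inter> ?P) \<le> h" using that by (auto simp: A'_def)
    then show ?thesis using miss_bound[OF g VPQ(1) deg ubPQ(2), of v] cW D by simp
  qed
  have missB: "card (?P - r `` {v}) \<le> D" if "v \<in> B'" for v
  proof -
    have "v \<in> V" using that by (auto simp: B'_def)
    then show ?thesis using miss_bound[OF g VPQ(2) deg ubPQ(1), of v] hB[OF that] cW D by simp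
  qed
  note ap' = apex_system_swap[OF ap]
  note nA = no_edge_touching_apex[OF g F s(1) ap X(2) part(3) missA]
  note nB = no_edge_touching_apex[OF g F s(1) ap' X(2) part(4) missB]
  have "(u, v) \<notin> r" if "u \<in> A'" "v \<in> A'" for u v
    using independent_side[OF red F s ap X(2) part(1,3) QB' missA nB that] .
  moreover have "(u, v) \<notin> r" if "u \<in> B'" "v \<in> B'" for u v
    using independent_side[OF red F s ap' X(2) part(2,4) PA' missB nA that] .
  ultimately have "r \<inter> A' \<times> A' = {}" "r \<inter> B' \<times> B' = {}" by auto
  then show ?thesis
    by (intro exI[of _ X] exI[of _ A'] exI[of _ B'] conjI part(1,3,4,5) X(2))
qed

lemma ex_apex_partition:
  assumes s: "s = Suc (l div 2)" "2 \<le> s"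
  shows "\<exists>N. \<forall>(V :: 'a set) r. reduced s V r \<longrightarrow> \<not> has_lollipop r l \<longrightarrow> N \<le> card V \<longrightarrow>
    (\<exists>X A B. V = X \<union> A \<union> B \<and> X \<inter> A = {} \<and> X \<inter> B = {} \<and> A \<inter> B = {} \<and> card X = s \<and> r \<inter> A \<times> A = {} \<and> r \<inter> B \<times> B = {})"
proof -
  obtain C N where CN: "\<And>(V :: 'a set) r. reduced s V r \<Longrightarrow> \<not> has_lollipop r l \<Longrightarrow> N \<le> card V \<Longrightarrow> \<exists>A B W. bip_structure C V r A B W"
    using ex_bip_structure[OF s(2), of l] by blast
  define K where "K = 16 * l + 200 + 16 * C"
  define Z where "Z = (2 ^ C + 2 ^ C * 2 ^ C) * K"
  define h where "h = 4 * l + 40 + C"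
  define D where "D = 2 + 4 * C + 2 * h + 4 * Z"
  show ?thesis
  proof (intro exI[of _ "N + 4 * (Z + 4 * l + 40 + 4 * D) + 1"] allI impI)
    fix V :: "'a set" and r
    assume a: "reduced s V r" "\<not> has_lollipop r l" "N + 4 * (Z + 4 * l + 40 + 4 * D) + 1 \<le> card V"
    then obtain A B W where "bip_structure C V r A B W" using CN by (meson add_leD1)
    then show "\<exists>X A B. V = X \<union> A \<union> B \<and> X \<inter> A = {} \<and> X \<inter> B = {} \<and> A \<inter> B = {} \<and> card X = s \<and> r \<inter> A \<times> A = {} \<and> r \<inter> B \<times> B = {}"
      using a(3) by (intro apex_partition[OF a(1,2) s _ K_def Z_def h_def D_def]) auto
  qed
qed

section \<open>Extremality\<close>

lemma arc_graph_arcs: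
  assumes "simple_graph (V, E)"
  shows "arc_graph V (arcs E)"
proof -
  have E: "finite V" "E \<subseteq> nsets V 2" using assms by (auto simp: simple_graph_def)
  have "u \<in> V \<and> v \<in> V \<and> u \<noteq> v" if "{u, v} \<in> E" for u v
    using E(2) that by (auto simp: nsets_def card_2_iff doubleton_eq_iff)
  moreover from this have "{a} \<notin> E" for a by (metis insert_absorb2)
  ultimately show ?thesis using E(1)
    by (auto simp: arc_graph_def arcs_def sym_def irrefl_def insert_commute)
qed

lemma card_arcs:
  assumes "simple_graph (V, E)"
  shows "card (arcs E) = 2 * card E"
proof -
  have E: "finite V" "E \<subseteq> nsets V 2" using assms by (auto simp: simple_graph_def)
  then have fin: "finite E" by (auto intro: finite_subset finite_imp_finite_nsets)
  have two: "card {(u, v). {u, v} = e} = 2" if "e \<in> E" for e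
  proof -
    have "e \<in> nsets V 2" using E(2) that by blast
    then obtain a b where "e = {a, b}" "a \<noteq> b" by (auto simp: nsets_def card_2_iff)
    then have "{(u, v). {u, v} = e} = {(a, b), (b, a)}" by (auto simp: doubleton_eq_iff)
    then show ?thesis using \<open>a \<noteq> b\<close> by simp
  qed
  have "arcs E = (\<Union>e\<in>E. {(u, v). {u, v} = e})" by (auto simp: arcs_def)
  also have "card \<dots> = (\<Sum>e\<in>E. card {(u, v). {u, v} = e})"
  proof (rule card_UN_disjoint[OF fin])
    show "\<forall>e\<in>E. finite {(u, v). {u, v} = e}" using two by (metis card.infinite zero_neq_numeral)
  qed auto
  also have "\<dots> = 2 * card E" using two by simp
  finally show ?thesis .
qed

lemma arcs_of_relation:
  assumes "arc_graph V r"
  shows "simple_graph (V, (\<lambda>(u, v). {u, v}) ` r)" "arcs ((\<lambda>(u, v). {u, v}) ` r) = r"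
proof -
  note gd = arc_graphD[OF assms]
  show "simple_graph (V, (\<lambda>(u, v). {u, v}) ` r)"
    using gd(1,5,6,7) by (fastforce simp: simple_graph_def nsets_def card_2_iff doubleton_eq_iff)
  show "arcs ((\<lambda>(u, v). {u, v}) ` r) = r"
    using gd(4) by (auto simp: arcs_def doubleton_eq_iff)
qed

lemma edges_subset_join_edges:
  assumes "simple_graph (V, E)" "V = X \<union> A \<union> B" "arcs E \<inter> A \<times> A = {}" "arcs E \<inter> B \<times> B = {}"
  shows "E \<subseteq> join_edges X A B"
proof
  fix e assume e: "e \<in> E"
  then have "e \<in> nsets V 2" using assms(1) by (auto simp: simple_graph_def)
  then obtain u v where uv: "e = {u, v}" "u \<noteq> v" "u \<in> V" "v \<in> V"
    by (auto simp: nsets_def card_2_iff)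
  have no: "\<not> (u \<in> A \<and> v \<in> A)" "\<not> (u \<in> B \<and> v \<in> B)" using assms(3,4) e uv(1) by (auto simp: arcs_def)
  have XY: "{a, b} \<in> (\<lambda>(x, y). {x, y}) ` (P \<times> Q)" "{b, a} \<in> (\<lambda>(x, y). {x, y}) ` (P \<times> Q)" if "a \<in> P" "b \<in> Q" for a b and P Q :: "'a set"
    using that by (auto simp: insert_commute)
  consider "u \<in> X" "v \<in> X" | "u \<in> X" "v \<in> A \<union> B" | "v \<in> X" "u \<in> A \<union> B" | "u \<in> A" "v \<in> B" | "u \<in> B" "v \<in> A"
    using uv(3,4) no unfolding assms(2) by blast
  then show "e \<in> join_edges X A B"
  proof cases
    case 1
    then show ?thesis using uv by (auto simp: join_edges_def nsets_def)
  qed (use XY uv(1) in \<open>simp_all add: join_edges_def\<close>)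
qed

lemma product_le_balanced:
  fixes a b m :: nat
  assumes "a + b = m" "a \<le> b"
  shows "a * b \<le> (m div 2) * ((m + 1) div 2)" "a * b = (m div 2) * ((m + 1) div 2) \<Longrightarrow> a = m div 2"
proof -
  define q where "q = (m + 1) div 2"
  obtain k where k: "m div 2 = a + k" using assms by (metis le_Suc_ex add_le_mono div_le_mono le_refl mult_2 nonzero_mult_div_cancel_left zero_neq_numeral)
  have b: "b = q + k" "a + k \<le> q" using assms k unfolding q_def by presburger+
  obtain j where j: "q = a + k + j" using b(2) le_Suc_ex by blast
  \<comment> \<open>Moving \<open>k\<close> units to the smaller factor gains exactly
    \<open>k * (q - a)\<close>. As \<open>a + k \<le> q\<close>, the gain vanishes only for
    \<open>k = 0\<close>.\<close>
  have e: "(a + k) * q = a * b + k * (q - a)" unfolding b(1) j by (simp add: algebra_simps)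
  show "a * b \<le> (m div 2) * ((m + 1) div 2)" unfolding k q_def[symmetric] e by simp
  show "a = m div 2" if "a * b = (m div 2) * ((m + 1) div 2)"
    using that b(2) unfolding k q_def[symmetric] e by auto
qed

lemma join_edges_swap: "join_edges X A B = join_edges X B A"
proof -
  have "(\<lambda>(a, b). {a, b}) ` (A \<times> B) = (\<lambda>(a, b). {a, b}) ` (B \<times> A)" for A B :: "'a set"
    by (force simp: insert_commute image_iff)
  then show ?thesis unfolding join_edges_def by (simp add: Un_commute)
qed

lemma join_edges_extremal:
  assumes "finite X" "finite A" "finite B" "X \<inter> A = {}" "X \<inter> B = {}" "A \<inter> B = {}" "card X = s" "card (X \<union> A \<union> B) = n"
  shows "card (join_edges X A B) \<le> hedges s n"
    "card (join_edges X A B) = hedges s n \<Longrightarrow> graph_iso (X \<union> A \<union> B, join_edges X A B) (H_graph n 2 (Suc s))"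
proof -
  have main: "card (join_edges X A B) \<le> hedges s n \<and>
    (card (join_edges X A B) = hedges s n \<longrightarrow> graph_iso (X \<union> A \<union> B, join_edges X A B) (H_graph n 2 (Suc s)))"
    if fin: "finite A" "finite B" and d: "X \<inter> A = {}" "X \<inter> B = {}" "A \<inter> B = {}" and n: "card (X \<union> A \<union> B) = n" and le: "card B \<le> card A" for A B
  proof -
    have "card (X \<union> A \<union> B) = card (X \<union> A) + card B" using d fin assms(1) by (intro card_Un_disjoint) auto
    also have "card (X \<union> A) = card X + card A" using d fin assms(1) by (intro card_Un_disjoint) auto
    finally have m: "card B + card A = n - s" using n assms(7) by simp
    note p = product_le_balanced[OF m le]
    have c: "card (join_edges X A B) = (s choose 2) + s * (n - s) + card B * card A"
      using card_join_edges[OF assms(1) fin d] assms(7) m by (simp add: add.commute mult.commute)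
    have "graph_iso (X \<union> A \<union> B, join_edges X A B) (H_graph n 2 (Suc s))" if "card (join_edges X A B) = hedges s n"
    proof -
      have B: "card B = (n - s) div 2" using that p(2) unfolding c hedges_def by simp
      then have A: "card A = (n - s + 1) div 2" using m by presburger
      show ?thesis
        unfolding H_graph_eq
        by (rule graph_iso_join_edges)
          (use assms(1,7) fin d A B card_parts in \<open>auto simp: card_image even_part_def odd_part_def\<close>)
    qed
    then show ?thesis using p(1) unfolding c hedges_def by simp
  qed
  have "B \<inter> A = {}" "X \<union> B \<union> A = X \<union> A \<union> B" using assms by auto
  then have "card (join_edges X A B) \<le> hedges s n \<and>
    (card (join_edges X A B) = hedges s n \<longrightarrow> graph_iso (X \<union> A \<union> B, join_edges X A B) (H_graph n 2 (Suc s)))"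
    using main[of A B] main[of B A] assms join_edges_swap[of X A B] by (metis linear)
  then show "card (join_edges X A B) \<le> hedges s n"
    "card (join_edges X A B) = hedges s n \<Longrightarrow> graph_iso (X \<union> A \<union> B, join_edges X A B) (H_graph n 2 (Suc s))" by blast+
qed

lemma ex_extremal_threshold:
  assumes s: "s = Suc (l div 2)" "2 \<le> s"
  shows "\<exists>N. \<forall>V E. simple_graph (V, E :: 'a set set) \<longrightarrow> N \<le> card V \<longrightarrow> \<not> contains_copy (V, E) (edge_blowup (lollipop 3 l) 3) \<longrightarrow>
    hedges s (card V) \<le> card E \<longrightarrow> card E = hedges s (card V) \<and> graph_iso (V, E) (H_graph (card V) 2 (Suc s))"
proof -
  obtain N where N: "\<And>(V :: 'a set) r. reduced s V r \<Longrightarrow> \<not> has_lollipop r l \<Longrightarrow> N \<le> card V \<Longrightarrow>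
    \<exists>X A B. V = X \<union> A \<union> B \<and> X \<inter> A = {} \<and> X \<inter> B = {} \<and> A \<inter> B = {} \<and> card X = s \<and> r \<inter> A \<times> A = {} \<and> r \<inter> B \<times> B = {}"
    using ex_apex_partition[OF s] by blast
  define N1 where "N1 = N + s + 4"
  have up: "card E \<le> hedges s (card V) \<and> (card E = hedges s (card V) \<longrightarrow> graph_iso (V, E) (H_graph (card V) 2 (Suc s)))"
    if g: "simple_graph (V, E)" and red: "reduced s V (arcs E)" and F: "\<not> has_lollipop (arcs E) l" and n: "N \<le> card V" for V :: "'a set" and E
  proof -
    obtain X A B where V: "V = X \<union> A \<union> B" and d: "X \<inter> A = {}" "X \<inter> B = {}" "A \<inter> B = {}" and X: "card X = s"
      and ind: "arcs E \<inter> A \<times> A = {}" "arcs E \<inter> B \<times> B = {}" using N[OF red F n] by blast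
    have fin: "finite X" "finite A" "finite B" using g V by (auto simp: simple_graph_def)
    have sub: "E \<subseteq> join_edges X A B" by (rule edges_subset_join_edges[OF g V ind])
    have finJ: "finite (join_edges X A B)"
      using join_edges_subset[OF d] fin by (auto intro: finite_subset finite_imp_finite_nsets)
    note ext = join_edges_extremal[OF fin d X, of "card V"]
    have "card E \<le> card (join_edges X A B)" using sub finJ by (rule card_mono[rotated])
    moreover have "graph_iso (V, E) (H_graph (card V) 2 (Suc s))" if "card E = hedges s (card V)"
    proof -
      have "card E = card (join_edges X A B)" using that ext(1) V \<open>card E \<le> _\<close> by simp
      then have "E = join_edges X A B" using card_subset_eq[OF finJ sub] by simp
      then show ?thesis using ext(2) that V by simp
    qed
    ultimately show ?thesis using ext(1) V by fastforce
  qed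
  \<comment> \<open>The reduction ranges over arc relations, so each of them is turned back into a
    simple graph before \<open>up\<close> applies.\<close>
  have base: "card r \<le> 2 * hedges s (card V)" if "reduced s V r" "\<not> has_lollipop r l" "N1 \<le> card V" for V :: "'a set" and r
  proof -
    have g: "arc_graph V r" using that(1) by (simp add: reduced_def)
    note a = arcs_of_relation[OF g]
    show ?thesis using up[OF a(1)] that card_arcs[OF a(1)] unfolding a(2) by (simp add: N1_def)
  qed
  show ?thesis
  proof (intro exI[of _ "N1 + 4 * N1 * N1"] allI impI)
    fix V :: "'a set" and E
    assume a: "simple_graph (V, E)" "N1 + 4 * N1 * N1 \<le> card V" "\<not> contains_copy (V, E) (edge_blowup (lollipop 3 l) 3)" "hedges s (card V) \<le> card E"
    have F: "\<not> has_lollipop (arcs E) l" using has_lollipop_contains_copy[OF a(1)] a(3) by blast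
    have "reduced s V (arcs E)"
      using a(2,4) card_arcs[OF a(1)] by (intro reduced_if_many_arcs[OF base _ arc_graph_arcs[OF a(1)] F]) (auto simp: N1_def)
    then show "card E = hedges s (card V) \<and> graph_iso (V, E) (H_graph (card V) 2 (Suc s))"
      using up[OF a(1) _ F] a(2,4) by (simp add: N1_def)
  qed
qed

lemma contains_copy_graph_iso:
  assumes "graph_iso G H" "contains_copy G F"
  shows "contains_copy H F"
proof -
  obtain f where f: "bij_betw f (verts G) (verts H)" "(\<lambda>e. f ` e) ` edges G = edges H" using assms(1) by (auto simp: graph_iso_def)
  obtain g where g: "inj_on g (verts F)" "g ` verts F \<subseteq> verts G" "\<And>e. e \<in> edges F \<Longrightarrow> g ` e \<in> edges G"
    using assms(2) by (auto simp: contains_copy_def)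
  have "inj_on f (g ` verts F)" using f(1) g(2) by (meson bij_betw_imp_inj_on inj_on_subset)
  then have "inj_on (f \<circ> g) (verts F)" using g(1) by (rule comp_inj_on[rotated])
  moreover have "(f \<circ> g) ` verts F \<subseteq> verts H" using f(1) g(2) by (auto simp: bij_betw_def)
  moreover have "(f \<circ> g) ` e \<in> edges H" if "e \<in> edges F" for e
    using g(3)[OF that] f(2) unfolding image_comp[symmetric] by blast
  ultimately show ?thesis unfolding contains_copy_def by blast
qed

lemma ex_nat_H_graph:
  assumes "s \<le> n"
  shows "\<exists>G :: nat ugraph. simple_graph G \<and> card (verts G) = n \<and> card (edges G) = hedges s n \<and> graph_iso G (H_graph n 2 (Suc s))"
proof -
  let ?k = "s + (n - s + 1) div 2"
  have k: "?k \<le> n" using assms by presburger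
  define X A B where "X = {..<s}" and "A = {s..<?k}" and "B = {?k..<n}"
  have fin: "finite X" "finite A" "finite B" and d: "X \<inter> A = {}" "X \<inter> B = {}" "A \<inter> B = {}"
    by (auto simp: X_def A_def B_def)
  have V: "X \<union> A \<union> B = {..<n}" using k assms by (auto simp: X_def A_def B_def)
  have c: "card X = s" "card A = (n - s + 1) div 2" "card B = (n - s) div 2"
    using assms by (simp_all add: X_def A_def B_def)
  have "(n - s) div 2 + (n - s + 1) div 2 = n - s" by presburger
  then have "card A + card B = n - s" using c by simp
  then have e: "card (join_edges X A B) = hedges s n"
    using card_join_edges[OF fin d] c by (simp add: hedges_def mult.commute)
  have "graph_iso (X \<union> A \<union> B, join_edges X A B) (H_graph n 2 (Suc s))"
    by (rule join_edges_extremal(2)[OF fin d c(1) _ e]) (simp add: V)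
  moreover have "simple_graph (X \<union> A \<union> B, join_edges X A B)"
    using join_edges_subset[OF d] fin by (simp add: simple_graph_def)
  ultimately show ?thesis using e V by (intro exI[of _ "(X \<union> A \<union> B, join_edges X A B)"]) simp
qed

theorem theorem3p4:
  fixes l t :: nat
  assumes "l \<ge> 2"
    and "t = 1 + (l - 1) div 2"
  shows "\<exists>n0. \<forall>n\<ge>n0.
    (odd l \<longrightarrow> unique_extremal_graph n (edge_blowup (lollipop 3 l) 3) (H_graph n 2 (t + 1))) \<and>
    (even l \<longrightarrow> unique_extremal_graph n (edge_blowup (lollipop 3 l) 3) (H_graph n 2 (t + 2)))"
proof -
  define s where "s = Suc (l div 2)"
  have s2: "2 \<le> s" using assms(1) unfolding s_def by presburger
  \<comment> \<open>\<open>H_graph n 2 q\<close> has \<open>q - 1\<close> apexes. For odd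
    \<open>l\<close> the number \<open>s\<close> equals \<open>t\<close>, for even \<open>l\<close>
    it is \<open>t + 1\<close>.\<close>
  have t: "odd l \<Longrightarrow> t + 1 = Suc s" "even l \<Longrightarrow> t + 2 = Suc s"
    using assms unfolding s_def by presburger+
  let ?F = "edge_blowup (lollipop 3 l) 3"
  obtain N where N: "\<And>V E. simple_graph (V, E :: nat set set) \<Longrightarrow> N \<le> card V \<Longrightarrow> \<not> contains_copy (V, E) ?F \<Longrightarrow>
    hedges s (card V) \<le> card E \<Longrightarrow> card E = hedges s (card V) \<and> graph_iso (V, E) (H_graph (card V) 2 (Suc s))"
    using ex_extremal_threshold[OF s_def s2] by blast
  have "unique_extremal_graph n ?F (H_graph n 2 (Suc s))" if n: "N + s \<le> n" for n
  proof -
    have sn: "s \<le> n" "N \<le> n" using n by auto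
    note H = H_graph_props[OF sn(1)] H_graph_lollipop_free[OF s_def, of n]
    have "card (edges G) \<le> hedges s n" if "simple_graph G" "card (verts G) = n" "\<not> contains_copy G ?F" for G :: "nat ugraph"
      using N[of "fst G" "snd G"] that sn(2) by (cases "hedges s n \<le> card (edges G)") auto
    then have ext: "extremal_graph n ?F (H_graph n 2 (Suc s))" using H by (auto simp: extremal_graph_def)
    moreover have "graph_iso G (H_graph n 2 (Suc s))" if G: "extremal_graph n ?F G" for G :: "nat ugraph"
    proof -
      \<comment> \<open>Extremality compares only with graphs on natural numbers, while
        \<open>H_graph\<close> lives on a sum type. An isomorphic copy on natural numbers is needed
        to bound the edges of \<open>G\<close> from below.\<close>
      obtain G' :: "nat ugraph" where G': "simple_graph G'" "card (verts G') = n" "card (edges G') = hedges s n"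
        "graph_iso G' (H_graph n 2 (Suc s))" using ex_nat_H_graph[OF sn(1)] by blast
      have "\<not> contains_copy G' ?F" using contains_copy_graph_iso[OF G'(4)] H(4) by blast
      then have "hedges s n \<le> card (edges G)" using G G' unfolding extremal_graph_def by metis
      then show ?thesis using N[of "fst G" "snd G"] G sn(2) by (simp add: extremal_graph_def)
    qed
    ultimately show ?thesis by (simp add: unique_extremal_graph_def)
  qed
  then show ?thesis using t by (intro exI[of _ "N + s"]) auto
qed

end
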